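(* Let $(\hat M,\hat g,\hat\nabla,\Lambda)$ be a quaternionic Kaehler-like statistical manifold of dimension $4m$ whose curvature tensors $\hat R,\hat R^*$ have the form given in the context with real constant $c$, and let $M$ be a Lagrangian statistical submanifold of $\hat M$ of dimension $n$. Suppose $n\ge4$ and that $M$ satisfies the equality case of Chen's first inequality, i.e. for every $p\in M$ there is a $2$-plane $\pi\subset T_pM$ such that at $p$ $$(\tau-\tau_\circ)-(K(\pi)-K_\circ(\pi))=\frac{c}{8}(n-2)(n+1)-\frac{n^2(n-2)}{4(n-1)}\left[\|H\|^2+\|H^*\|^2\right]+2\hat K_\circ(\pi)-2\hat\tau_\circ .$$ Then $M$ is minimal, i.e. $H=H^*=0$.
   Context: Statistical manifold: a Riemannian manifold $(\hat M,\hat g)$ with torsion-free affine connections $\hat\nabla,\hat\nabla^*$ such that $X\hat g(Y,Z)=\hat g(\hat\nabla_XY,Z)+\hat g(Y,\hat\nabla^*_XZ)$ and $(\hat\nabla_X\hat g)(Y,Z)=(\hat\nabla_Y\hat g)(X,Z)$. The Levi-Civita connection is $\hat\nabla^\circ=\frac12(\hat\nabla+\hat\nabla^* )$. The curvature tensors of $\hat\nabla,\hat\nabla^*,\hat\nabla^\circ$ are $\hat R,\hat R^*,\hat R^\circ$. Almost quaternionic structure: a rank-3 subbundle $\Lambda\subset \mathrm{End}(T\hat M)$ with local bases $\{J_1,J_2,J_3\}$ satisfying $J_\alpha^2=-I$, $J_\alpha J_{\alpha+1}=-J_{\alpha+1}J_\alpha=J_{\alpha+2}$ (indices mod 3). Let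 $J_\alpha^*$ be defined by $\hat g(J_\alpha X,Y)+\hat g(X,J_\alpha^*Y)=0$; $(\hat M,\hat\nabla,\Lambda,\hat g)$ is then almost Hermite-like quaternionic statistical. It is quaternionic Kaehler-like if there are locally defined 1-forms $\omega_1,\omega_2,\omega_3$ with $(\hat\nabla_XJ_\alpha)Y=\omega_{\alpha+2}(X)J_{\alpha+1}Y-\omega_{\alpha+1}(X)J_{\alpha+2}Y$. It is assumed that, for a real constant $c$, $$\hat R(X,Y)Z=\tfrac c4\Big\{\hat g(Y,Z)X-\hat g(X,Z)Y+\sum_{\alpha=1}^3[\hat g(Z,J_\alpha Y)J_\alpha X-\hat g(Z,J_\alpha X)J_\alpha Y]+\sum_{\alpha=1}^3[\hat g(X,J_\alpha Y)J_\alpha Z-\hat g(J_\alpha X,Y)J_\alpha Z]\Big\},$$ and $\hat R^*$ is given by the same formula with $J_\alpha$ replaced by $J_\alpha^*$. Submanifold: $M\subset\hat M$ carries the induced metric $g$ and induced connections $\nabla,\nabla^*$, with $\hat\nabla_XY=\nabla_XY+\sigma(X,Y)$, $\hat\nabla^*_XY=\nabla^*_XY+\sigma^*(X,Y)$ (tangential and normal parts). $R,R^*,R^\circ$ are the curvature tensors of $\nabla,\nabla^*$ and the Levi-Civita connection of $g$. $M$ is totally real if $J_\alpha(T_pM)\subset T_p^\perp M$ for all $p\in M$ and $\alpha=1,2,3$; it is Lagrangian if it is totally real of maximal dimension $n=m$. For an orthonormal basis $\{e_1,\dots,e_n\}$ of $T_pM$: $H=\frac1n\sum_i\sigma(e_i,e_i)$,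 $H^*=\frac1n\sum_i\sigma^*(e_i,e_i)$. Curvatures: for a 2-plane $\pi\subset T_pM$ with orthonormal basis $\{X,Y\}$, the sectional $K$-curvature is $K(\pi)=\frac12[g(R(X,Y)Y,X)+g(R^*(X,Y)Y,X)-2g(R^\circ(X,Y)Y,X)]$; $K_\circ(\pi)$ is the usual sectional curvature of $(M,g)$ and $\hat K_\circ(\pi)$ that of $(\hat M,\hat g)$. Further $\tau=\sum_{1\le i<j\le n}K(e_i\wedge e_j)$, $\tau_\circ=\sum_{1\le i<j\le n}K_\circ(e_i\wedge e_j)$, $\hat\tau_\circ=\sum_{1\le i<j\le n}\hat K_\circ(e_i\wedge e_j)$, where $e_i\wedge e_j$ is the plane spanned by $e_i,e_j$. *)

theory Defs
  imports "HOL-Analysis.Analysis"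
begin

section \<open>Smooth manifolds\<close>

text \<open>
  Class \<open>C\<^sup>k\<close> on a set, by iterated directional derivatives in all directions. Only ever used for
  open sets.
\<close>

primrec ck_on ::
  "nat \<Rightarrow> 'e set \<Rightarrow> ('e::euclidean_space \<Rightarrow> 'f::real_normed_vector) \<Rightarrow> bool" where
  "ck_on 0 S f \<longleftrightarrow> continuous_on S f"
| "ck_on (Suc k) S f \<longleftrightarrow>
     (\<forall>x\<in>S. f differentiable (at x)) \<and>
     (\<forall>v. ck_on k S (\<lambda>x. frechet_derivative f (at x) v))"

definition smooth_on ::
  "'e set \<Rightarrow> ('e::euclidean_space \<Rightarrow> 'f::real_normed_vector) \<Rightarrow> bool" where
  "smooth_on S f \<longleftrightarrow> (\<forall>k. ck_on k S f)"

text \<open>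
  A manifold modelled on the Euclidean space \<open>'e\<close> (so of dimension \<open>DIM('e)\<close>) consists of a topology
  and a smooth atlas, which need not be maximal. A chart is a pair of its domain and its
  coordinate map.
\<close>

type_synonym ('a, 'e) chart = "'a set \<times> ('a \<Rightarrow> 'e)"

record ('a, 'e) manifold =
  mtop :: "'a topology"
  atlas :: "('a, 'e) chart set"

abbreviation points :: "('a, 'e) manifold \<Rightarrow> 'a set" where
  "points M \<equiv> topspace (mtop M)"

definition chart_inv :: "('a, 'e) chart \<Rightarrow> 'e \<Rightarrow> 'a" where
  "chart_inv c = inv_into (fst c) (snd c)"

definition smooth_manifold :: "('a, 'e::euclidean_space) manifold \<Rightarrow> bool" where
  "smooth_manifold M \<longleftrightarrow>
     Hausdorff_space (mtop M) \<and> second_countable (mtop M) \<and>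
     points M = (\<Union>c\<in>atlas M. fst c) \<and>
     (\<forall>c\<in>atlas M. openin (mtop M) (fst c) \<and> open (snd c ` fst c) \<and>
        homeomorphic_map (subtopology (mtop M) (fst c)) (top_of_set (snd c ` fst c)) (snd c)) \<and>
     (\<forall>c\<in>atlas M. \<forall>d\<in>atlas M. smooth_on (snd c ` (fst c \<inter> fst d)) (snd d \<circ> chart_inv c))"

text \<open>
  For every point \<open>p\<close> a preferred chart \<open>chart_at M p\<close> of the atlas around \<open>p\<close> is chosen, and the
  tangent space at \<open>p\<close> is identified with the model space \<open>'e\<close> by the coordinates in this chart.
  A vector field is thus a function \<open>'a \<Rightarrow> 'e\<close>, a 1-form a function \<open>'a \<Rightarrow> 'e \<Rightarrow> real\<close>, a metric a
  function \<open>'a \<Rightarrow> 'e \<Rightarrow> 'e \<Rightarrow> real\<close>, and so on. As the preferred chart jumps from point to point,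
  smoothness is always tested on the components in a fixed chart: \<open>chart_coords M c p v\<close> are the
  components of the tangent vector \<open>v\<close> at \<open>p\<close> in the chart \<open>c\<close>. The inner product of \<open>'e\<close> plays no
  role.
\<close>

definition chart_at :: "('a, 'e) manifold \<Rightarrow> 'a \<Rightarrow> ('a, 'e) chart" where
  "chart_at M p = (SOME c. c \<in> atlas M \<and> p \<in> fst c)"

definition chart_coords ::
  "('a, 'e::euclidean_space) manifold \<Rightarrow> ('a, 'e) chart \<Rightarrow> 'a \<Rightarrow> 'e \<Rightarrow> 'e" where
  "chart_coords M c p v =
     frechet_derivative (snd c \<circ> chart_inv (chart_at M p)) (at (snd (chart_at M p) p)) v"

definition vf_rep ::
  "('a, 'e::euclidean_space) manifold \<Rightarrow> ('a, 'e) chart \<Rightarrow> ('a \<Rightarrow> 'e) \<Rightarrow> 'e \<Rightarrow> 'e" where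
  "vf_rep M c X x = chart_coords M c (chart_inv c x) (X (chart_inv c x))"

definition smooth_fun ::
  "('a, 'e::euclidean_space) manifold \<Rightarrow> 'a set \<Rightarrow> ('a \<Rightarrow> real) \<Rightarrow> bool" where
  "smooth_fun M U f \<longleftrightarrow> (\<forall>c\<in>atlas M. smooth_on (snd c ` (U \<inter> fst c)) (f \<circ> chart_inv c))"

definition smooth_vf ::
  "('a, 'e::euclidean_space) manifold \<Rightarrow> 'a set \<Rightarrow> ('a \<Rightarrow> 'e) \<Rightarrow> bool" where
  "smooth_vf M U X \<longleftrightarrow> (\<forall>c\<in>atlas M. smooth_on (snd c ` (U \<inter> fst c)) (vf_rep M c X))"

text \<open>The derivative \<open>X f\<close> of a function along a vector field.\<close>

definition dir_deriv ::
  "('a, 'e::euclidean_space) manifold \<Rightarrow> ('a \<Rightarrow> 'e) \<Rightarrow> ('a \<Rightarrow> real) \<Rightarrow> 'a \<Rightarrow> real" where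
  "dir_deriv M X f p =
     frechet_derivative (f \<circ> chart_inv (chart_at M p)) (at (snd (chart_at M p) p)) (X p)"

text \<open>The coordinate formula \<open>[X,Y]\<^sup>i = X\<^sup>j \<partial>\<^sub>j Y\<^sup>i - Y\<^sup>j \<partial>\<^sub>j X\<^sup>i\<close> in the preferred chart at \<open>p\<close>.\<close>

definition lie_bracket ::
  "('a, 'e::euclidean_space) manifold \<Rightarrow> ('a \<Rightarrow> 'e) \<Rightarrow> ('a \<Rightarrow> 'e) \<Rightarrow> 'a \<Rightarrow> 'e" where
  "lie_bracket M X Y p =
     (let c = chart_at M p; x = snd c p in
        frechet_derivative (vf_rep M c Y) (at x) (X p) -
        frechet_derivative (vf_rep M c X) (at x) (Y p))"

text \<open>The local vector field with constant components \<open>v\<close> in the preferred chart at \<open>p\<close>.\<close>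

definition const_vf ::
  "('a, 'e::euclidean_space) manifold \<Rightarrow> 'a \<Rightarrow> 'e \<Rightarrow> 'a \<Rightarrow> 'e" where
  "const_vf M p v q =
     frechet_derivative (snd (chart_at M q) \<circ> chart_inv (chart_at M p)) (at (snd (chart_at M p) q)) v"


section \<open>Connections and curvature\<close>

text \<open>
  \<open>D X Y\<close> stands for \<open>\<nabla>\<^sub>X Y\<close>. A connection acts on the vector fields over every open set \<open>U\<close>,
  compatibly with restriction (last clause); a field over \<open>U\<close> is represented by any function that
  has the right values on \<open>U\<close>.
\<close>

type_synonym ('a, 'e) connection = "('a \<Rightarrow> 'e) \<Rightarrow> ('a \<Rightarrow> 'e) \<Rightarrow> 'a \<Rightarrow> 'e"

definition affine_connection ::
  "('a, 'e::euclidean_space) manifold \<Rightarrow> ('a, 'e) connection \<Rightarrow> bool" where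
  "affine_connection M D \<longleftrightarrow>
     (\<forall>U X X' Y Y' f.
        openin (mtop M) U \<and> smooth_vf M U X \<and> smooth_vf M U X' \<and>
        smooth_vf M U Y \<and> smooth_vf M U Y' \<and> smooth_fun M U f \<longrightarrow>
          smooth_vf M U (D X Y) \<and>
          (\<forall>p\<in>U. D (\<lambda>q. X q + X' q) Y p = D X Y p + D X' Y p) \<and>
          (\<forall>p\<in>U. D (\<lambda>q. f q *\<^sub>R X q) Y p = f p *\<^sub>R D X Y p) \<and>
          (\<forall>p\<in>U. D X (\<lambda>q. Y q + Y' q) p = D X Y p + D X Y' p) \<and>
          (\<forall>p\<in>U. D X (\<lambda>q. f q *\<^sub>R Y q) p = dir_deriv M X f p *\<^sub>R Y p + f p *\<^sub>R D X Y p) \<and>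
          ((\<forall>q\<in>U. X q = X' q \<and> Y q = Y' q) \<longrightarrow> (\<forall>p\<in>U. D X Y p = D X' Y' p)))"

definition torsion_free ::
  "('a, 'e::euclidean_space) manifold \<Rightarrow> ('a, 'e) connection \<Rightarrow> bool" where
  "torsion_free M D \<longleftrightarrow>
     (\<forall>U X Y. openin (mtop M) U \<and> smooth_vf M U X \<and> smooth_vf M U Y \<longrightarrow>
        (\<forall>p\<in>U. D X Y p - D Y X p = lie_bracket M X Y p))"

text \<open>
  The curvature tensor \<open>R(u,v)w\<close>. Being tensorial, it may be evaluated on any extensions of the
  tangent vectors \<open>u\<close>, \<open>v\<close>, \<open>w\<close> at \<open>p\<close> to vector fields around \<open>p\<close>.
\<close>

definition curvature ::
  "('a, 'e::euclidean_space) manifold \<Rightarrow> ('a, 'e) connection \<Rightarrow> 'a \<Rightarrow> 'e \<Rightarrow> 'e \<Rightarrow> 'e \<Rightarrow> 'e" where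
  "curvature M D p u v w =
     (let X = const_vf M p u; Y = const_vf M p v; Z = const_vf M p w in
        D X (D Y Z) p - D Y (D X Z) p - D (lie_bracket M X Y) Z p)"

type_synonym ('a, 'e) metric = "'a \<Rightarrow> 'e \<Rightarrow> 'e \<Rightarrow> real"

definition riemannian_metric ::
  "('a, 'e::euclidean_space) manifold \<Rightarrow> ('a, 'e) metric \<Rightarrow> bool" where
  "riemannian_metric M g \<longleftrightarrow>
     (\<forall>p\<in>points M. bilinear (g p) \<and> (\<forall>u v. g p u v = g p v u) \<and> (\<forall>v. v \<noteq> 0 \<longrightarrow> 0 < g p v v)) \<and>
     (\<forall>U X Y. openin (mtop M) U \<and> smooth_vf M U X \<and> smooth_vf M U Y \<longrightarrow>
        smooth_fun M U (\<lambda>p. g p (X p) (Y p)))"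

text \<open>\<open>X g(Y,Z) = g(D\<^sub>X Y, Z) + g(Y, D'\<^sub>X Z)\<close>; for \<open>D' = D\<close> this says that \<open>D\<close> is metric.\<close>

definition dual_connections ::
  "('a, 'e::euclidean_space) manifold \<Rightarrow> ('a, 'e) metric \<Rightarrow>
     ('a, 'e) connection \<Rightarrow> ('a, 'e) connection \<Rightarrow> bool" where
  "dual_connections M g D D' \<longleftrightarrow>
     (\<forall>U X Y Z. openin (mtop M) U \<and> smooth_vf M U X \<and> smooth_vf M U Y \<and> smooth_vf M U Z \<longrightarrow>
        (\<forall>p\<in>U. dir_deriv M X (\<lambda>q. g q (Y q) (Z q)) p =
                  g p (D X Y p) (Z p) + g p (Y p) (D' X Z p)))"

definition levi_civita ::
  "('a, 'e::euclidean_space) manifold \<Rightarrow> ('a, 'e) metric \<Rightarrow> ('a, 'e) connection \<Rightarrow> bool" where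
  "levi_civita M g D \<longleftrightarrow> affine_connection M D \<and> torsion_free M D \<and> dual_connections M g D D"

text \<open>
  The Levi-Civita connection is unique only on smooth local vector fields, hence the choice; its
  curvature does not depend on the choice.
\<close>

definition LC ::
  "('a, 'e::euclidean_space) manifold \<Rightarrow> ('a, 'e) metric \<Rightarrow> ('a, 'e) connection" where
  "LC M g = (SOME D. levi_civita M g D)"


section \<open>Statistical manifolds\<close>

definition cov_metric ::
  "('a, 'e::euclidean_space) manifold \<Rightarrow> ('a, 'e) metric \<Rightarrow> ('a, 'e) connection \<Rightarrow>
     ('a \<Rightarrow> 'e) \<Rightarrow> ('a \<Rightarrow> 'e) \<Rightarrow> ('a \<Rightarrow> 'e) \<Rightarrow> 'a \<Rightarrow> real" where
  "cov_metric M g D X Y Z p =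
     dir_deriv M X (\<lambda>q. g q (Y q) (Z q)) p - g p (D X Y p) (Z p) - g p (Y p) (D X Z p)"

definition statistical_manifold ::
  "('a, 'e::euclidean_space) manifold \<Rightarrow> ('a, 'e) metric \<Rightarrow>
     ('a, 'e) connection \<Rightarrow> ('a, 'e) connection \<Rightarrow> bool" where
  "statistical_manifold M g D D' \<longleftrightarrow>
     smooth_manifold M \<and> riemannian_metric M g \<and>
     affine_connection M D \<and> torsion_free M D \<and>
     affine_connection M D' \<and> torsion_free M D' \<and>
     dual_connections M g D D' \<and>
     (\<forall>U X Y Z. openin (mtop M) U \<and> smooth_vf M U X \<and> smooth_vf M U Y \<and> smooth_vf M U Z \<longrightarrow>
        (\<forall>p\<in>U. cov_metric M g D X Y Z p = cov_metric M g D Y X Z p))"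


section \<open>Quaternionic Kaehler-like statistical manifolds\<close>

text \<open>
  A field of endomorphisms is a function \<open>'a \<Rightarrow> 'e \<Rightarrow> 'e\<close>. The index \<open>\<alpha>\<close> ranges over the numeral
  type \<open>3\<close>, whose arithmetic is modulo 3. \<open>\<Lambda> p\<close> is the fibre of the bundle at \<open>p\<close>; the relations
  force the three members of a frame to be linearly independent, so that the fibres have
  dimension 3.
\<close>

definition quaternionic_frame ::
  "('a, 'e::euclidean_space) manifold \<Rightarrow> ('a \<Rightarrow> ('e \<Rightarrow> 'e) set) \<Rightarrow> 'a set \<Rightarrow>
     (3 \<Rightarrow> 'a \<Rightarrow> 'e \<Rightarrow> 'e) \<Rightarrow> bool" where
  "quaternionic_frame M \<Lambda> U J \<longleftrightarrow>
     openin (mtop M) U \<and>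
     (\<forall>p\<in>U.
        (\<forall>\<alpha>. linear (J \<alpha> p)) \<and>
        (\<forall>\<alpha> v. J \<alpha> p (J \<alpha> p v) = - v) \<and>
        (\<forall>\<alpha> v. J \<alpha> p (J (\<alpha> + 1) p v) = J (\<alpha> + 2) p v) \<and>
        (\<forall>\<alpha> v. J (\<alpha> + 1) p (J \<alpha> p v) = - J (\<alpha> + 2) p v) \<and>
        \<Lambda> p = {A. \<exists>a. A = (\<lambda>v. \<Sum>\<alpha>\<in>UNIV. a \<alpha> *\<^sub>R J \<alpha> p v)}) \<and>
     (\<forall>\<alpha> V X. openin (mtop M) V \<and> V \<subseteq> U \<and> smooth_vf M V X \<longrightarrow>
        smooth_vf M V (\<lambda>p. J \<alpha> p (X p)))"

definition almost_quaternionic ::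
  "('a, 'e::euclidean_space) manifold \<Rightarrow> ('a \<Rightarrow> ('e \<Rightarrow> 'e) set) \<Rightarrow> bool" where
  "almost_quaternionic M \<Lambda> \<longleftrightarrow> (\<forall>p\<in>points M. \<exists>U J. p \<in> U \<and> quaternionic_frame M \<Lambda> U J)"

definition one_form ::
  "('a, 'e::euclidean_space) manifold \<Rightarrow> 'a set \<Rightarrow> ('a \<Rightarrow> 'e \<Rightarrow> real) \<Rightarrow> bool" where
  "one_form M U \<omega> \<longleftrightarrow>
     (\<forall>p\<in>U. linear (\<omega> p)) \<and>
     (\<forall>V X. openin (mtop M) V \<and> V \<subseteq> U \<and> smooth_vf M V X \<longrightarrow> smooth_fun M V (\<lambda>p. \<omega> p (X p)))"

text \<open>\<open>A\<^sup>*\<close> with \<open>g(AX,Y) + g(X,A\<^sup>*Y) = 0\<close>.\<close>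

definition conj_endo :: "('e \<Rightarrow> 'e \<Rightarrow> real) \<Rightarrow> ('e \<Rightarrow> 'e) \<Rightarrow> 'e \<Rightarrow> 'e" where
  "conj_endo h A = (THE B. \<forall>X Y. h (A X) Y + h X (B Y) = 0)"

definition quaternionic_kaehler_like ::
  "('a, 'e::euclidean_space) manifold \<Rightarrow> ('a, 'e) connection \<Rightarrow> ('a \<Rightarrow> ('e \<Rightarrow> 'e) set) \<Rightarrow> bool" where
  "quaternionic_kaehler_like M D \<Lambda> \<longleftrightarrow>
     almost_quaternionic M \<Lambda> \<and>
     (\<forall>p\<in>points M. \<exists>U J \<omega>. p \<in> U \<and> quaternionic_frame M \<Lambda> U J \<and> (\<forall>\<alpha>. one_form M U (\<omega> \<alpha>)) \<and>
        (\<forall>V X Y \<alpha>. openin (mtop M) V \<and> V \<subseteq> U \<and> smooth_vf M V X \<and> smooth_vf M V Y \<longrightarrow>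
           (\<forall>q\<in>V. D X (\<lambda>r. J \<alpha> r (Y r)) q - J \<alpha> q (D X Y q) =
                    \<omega> (\<alpha> + 2) q (X q) *\<^sub>R J (\<alpha> + 1) q (Y q) -
                    \<omega> (\<alpha> + 1) q (X q) *\<^sub>R J (\<alpha> + 2) q (Y q))))"

definition model_curvature ::
  "real \<Rightarrow> ('e \<Rightarrow> 'e \<Rightarrow> real) \<Rightarrow> (3 \<Rightarrow> 'e \<Rightarrow> 'e) \<Rightarrow> 'e \<Rightarrow> 'e \<Rightarrow> 'e \<Rightarrow> 'e::real_vector" where
  "model_curvature c h J X Y Z =
     (c / 4) *\<^sub>R
       (h Y Z *\<^sub>R X - h X Z *\<^sub>R Y +
        (\<Sum>\<alpha>\<in>UNIV. h Z (J \<alpha> Y) *\<^sub>R J \<alpha> X - h Z (J \<alpha> X) *\<^sub>R J \<alpha> Y) +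
        (\<Sum>\<alpha>\<in>UNIV. h X (J \<alpha> Y) *\<^sub>R J \<alpha> Z - h (J \<alpha> X) Y *\<^sub>R J \<alpha> Z))"

definition quaternionic_space_form_like ::
  "real \<Rightarrow> ('a, 'e::euclidean_space) manifold \<Rightarrow> ('a, 'e) metric \<Rightarrow>
     ('a, 'e) connection \<Rightarrow> ('a, 'e) connection \<Rightarrow> ('a \<Rightarrow> ('e \<Rightarrow> 'e) set) \<Rightarrow> bool" where
  "quaternionic_space_form_like c M g D D' \<Lambda> \<longleftrightarrow>
     (\<forall>U J. quaternionic_frame M \<Lambda> U J \<longrightarrow> (\<forall>p\<in>U. \<forall>X Y Z.
        curvature M D p X Y Z = model_curvature c (g p) (\<lambda>\<alpha>. J \<alpha> p) X Y Z \<and>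
        curvature M D' p X Y Z = model_curvature c (g p) (\<lambda>\<alpha>. conj_endo (g p) (J \<alpha> p)) X Y Z))"


section \<open>Submanifolds\<close>

text \<open>
  \<open>M\<close> is a subset of \<open>N\<close> with its own topology and atlas such that the inclusion is a smooth
  immersion. \<open>incl_deriv M N p\<close> is the differential of the inclusion at \<open>p\<close>; its range is the
  tangent space of \<open>M\<close> as a subspace of that of \<open>N\<close>.
\<close>

definition incl_deriv ::
  "('a, 'f::euclidean_space) manifold \<Rightarrow> ('a, 'e::euclidean_space) manifold \<Rightarrow> 'a \<Rightarrow> 'f \<Rightarrow> 'e" where
  "incl_deriv M N p v =
     frechet_derivative (snd (chart_at N p) \<circ> chart_inv (chart_at M p)) (at (snd (chart_at M p) p)) v"

definition submanifold ::
  "('a, 'f::euclidean_space) manifold \<Rightarrow> ('a, 'e::euclidean_space) manifold \<Rightarrow> bool" where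
  "submanifold M N \<longleftrightarrow>
     smooth_manifold M \<and> smooth_manifold N \<and> points M \<subseteq> points N \<and>
     continuous_map (mtop M) (mtop N) (\<lambda>p. p) \<and>
     (\<forall>c\<in>atlas M. \<forall>d\<in>atlas N. smooth_on (snd c ` (fst c \<inter> fst d)) (snd d \<circ> chart_inv c)) \<and>
     (\<forall>p\<in>points M. inj (incl_deriv M N p))"

definition induced_metric ::
  "('a, 'f::euclidean_space) manifold \<Rightarrow> ('a, 'e::euclidean_space) manifold \<Rightarrow>
     ('a, 'e) metric \<Rightarrow> ('a, 'f) metric" where
  "induced_metric M N g p u v = g p (incl_deriv M N p u) (incl_deriv M N p v)"

text \<open>
  \<open>D\<^sub>u V\<close> for \<open>u\<close> tangent to \<open>M\<close> at \<open>p\<close> and a field \<open>V\<close> of tangent vectors of \<open>N\<close> along \<open>M\<close>. In the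
  preferred chart of \<open>N\<close> at \<open>p\<close>, with coordinate fields \<open>\<partial>\<^sub>k\<close>, this is
  \<open>u(V\<^sup>k) \<partial>\<^sub>k + V\<^sup>k D\<^sub>u \<partial>\<^sub>k\<close>; it agrees with the value at \<open>p\<close> of \<open>D X Y\<close> for all local fields \<open>X\<close>, \<open>Y\<close> on
  \<open>N\<close> extending \<open>u\<close> and \<open>V\<close>.
\<close>

definition cov_along ::
  "('a, 'f::euclidean_space) manifold \<Rightarrow> ('a, 'e::euclidean_space) manifold \<Rightarrow>
     ('a, 'e) connection \<Rightarrow> 'a \<Rightarrow> 'f \<Rightarrow> ('a \<Rightarrow> 'e) \<Rightarrow> 'e" where
  "cov_along M N D p u V =
     frechet_derivative
       (\<lambda>x. let q = chart_inv (chart_at M p) x in chart_coords N (chart_at N p) q (V q))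
       (at (snd (chart_at M p) p)) u +
     D (const_vf N p (incl_deriv M N p u)) (const_vf N p (V p)) p"

definition tangential ::
  "('a, 'f::euclidean_space) manifold \<Rightarrow> ('a, 'e::euclidean_space) manifold \<Rightarrow>
     ('a, 'e) metric \<Rightarrow> 'a \<Rightarrow> 'e \<Rightarrow> 'f" where
  "tangential M N g p w =
     (THE u. \<forall>v. g p (w - incl_deriv M N p u) (incl_deriv M N p v) = 0)"

definition induced_conn ::
  "('a, 'f::euclidean_space) manifold \<Rightarrow> ('a, 'e::euclidean_space) manifold \<Rightarrow>
     ('a, 'e) metric \<Rightarrow> ('a, 'e) connection \<Rightarrow> ('a, 'f) connection" where
  "induced_conn M N g D X Y p =
     tangential M N g p (cov_along M N D p (X p) (\<lambda>q. incl_deriv M N q (Y q)))"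

text \<open>
  \<open>\<sigma>(u,v)\<close>, the normal part of \<open>D\<^sub>u Y\<close>. It does not depend on the extension \<open>Y\<close> of \<open>v\<close> to a local
  vector field on \<open>M\<close>.
\<close>

definition second_ff ::
  "('a, 'f::euclidean_space) manifold \<Rightarrow> ('a, 'e::euclidean_space) manifold \<Rightarrow>
     ('a, 'e) metric \<Rightarrow> ('a, 'e) connection \<Rightarrow> 'a \<Rightarrow> 'f \<Rightarrow> 'f \<Rightarrow> 'e" where
  "second_ff M N g D p u v =
     (let w = cov_along M N D p u (\<lambda>q. incl_deriv M N q (const_vf M p v q)) in
        w - incl_deriv M N p (tangential M N g p w))"

definition statistical_submanifold ::
  "('a, 'f::euclidean_space) manifold \<Rightarrow> ('a, 'e::euclidean_space) manifold \<Rightarrow>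
     ('a, 'e) metric \<Rightarrow> ('a, 'e) connection \<Rightarrow> ('a, 'e) connection \<Rightarrow> bool" where
  "statistical_submanifold M N g D D' \<longleftrightarrow>
     submanifold M N \<and>
     statistical_manifold M (induced_metric M N g) (induced_conn M N g D) (induced_conn M N g D')"

definition totally_real ::
  "('a, 'f::euclidean_space) manifold \<Rightarrow> ('a, 'e::euclidean_space) manifold \<Rightarrow>
     ('a, 'e) metric \<Rightarrow> ('a \<Rightarrow> ('e \<Rightarrow> 'e) set) \<Rightarrow> bool" where
  "totally_real M N g \<Lambda> \<longleftrightarrow>
     (\<forall>U J. quaternionic_frame N \<Lambda> U J \<longrightarrow> (\<forall>p\<in>U \<inter> points M. \<forall>\<alpha> u v.
        g p (J \<alpha> p (incl_deriv M N p u)) (incl_deriv M N p v) = 0))"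

definition lagrangian ::
  "('a, 'f::euclidean_space) manifold \<Rightarrow> ('a, 'e::euclidean_space) manifold \<Rightarrow>
     ('a, 'e) metric \<Rightarrow> ('a \<Rightarrow> ('e \<Rightarrow> 'e) set) \<Rightarrow> bool" where
  "lagrangian M N g \<Lambda> \<longleftrightarrow> totally_real M N g \<Lambda> \<and> DIM('e) = 4 * DIM('f)"


section \<open>Curvature invariants\<close>

text \<open>A 2-plane in a tangent space is given by an orthonormal basis \<open>u\<close>, \<open>v\<close> of it.\<close>

definition orthonormal_pair :: "('e \<Rightarrow> 'e \<Rightarrow> real) \<Rightarrow> 'e \<Rightarrow> 'e \<Rightarrow> bool" where
  "orthonormal_pair h u v \<longleftrightarrow> h u u = 1 \<and> h v v = 1 \<and> h u v = 0"

definition sec_curv ::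
  "('a, 'e::euclidean_space) manifold \<Rightarrow> ('a, 'e) metric \<Rightarrow> 'a \<Rightarrow> 'e \<Rightarrow> 'e \<Rightarrow> real" where
  "sec_curv M g p u v = g p (curvature M (LC M g) p u v v) u"

definition K_curv ::
  "('a, 'e::euclidean_space) manifold \<Rightarrow> ('a, 'e) metric \<Rightarrow>
     ('a, 'e) connection \<Rightarrow> ('a, 'e) connection \<Rightarrow> 'a \<Rightarrow> 'e \<Rightarrow> 'e \<Rightarrow> real" where
  "K_curv M g D D' p u v =
     (g p (curvature M D p u v v) u + g p (curvature M D' p u v v) u
        - 2 * g p (curvature M (LC M g) p u v v) u) / 2"

text \<open>
  Orthonormal bases \<open>e 1, \<dots>, e n\<close> with \<open>n = DIM('f)\<close>. The invariants below do not depend on the one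
  chosen by \<open>onb\<close>.
\<close>

definition orthonormal_basis :: "('f::euclidean_space \<Rightarrow> 'f \<Rightarrow> real) \<Rightarrow> (nat \<Rightarrow> 'f) \<Rightarrow> bool" where
  "orthonormal_basis h e \<longleftrightarrow>
     (\<forall>i\<in>{1..DIM('f)}. \<forall>j\<in>{1..DIM('f)}. h (e i) (e j) = (if i = j then 1 else 0))"

definition onb :: "('f::euclidean_space \<Rightarrow> 'f \<Rightarrow> real) \<Rightarrow> nat \<Rightarrow> 'f" where
  "onb h = (SOME e. orthonormal_basis h e)"

definition sum_planes :: "('f::euclidean_space \<Rightarrow> 'f \<Rightarrow> real) \<Rightarrow> ('f \<Rightarrow> 'f \<Rightarrow> real) \<Rightarrow> real" where
  "sum_planes h k = (\<Sum>i\<in>{1..DIM('f)}. \<Sum>j\<in>{i<..DIM('f)}. k (onb h i) (onb h j))"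

definition mean_curv ::
  "('a, 'f::euclidean_space) manifold \<Rightarrow> ('a, 'e::euclidean_space) manifold \<Rightarrow>
     ('a, 'e) metric \<Rightarrow> ('a, 'e) connection \<Rightarrow> 'a \<Rightarrow> 'e" where
  "mean_curv M N g D p =
     (1 / real DIM('f)) *\<^sub>R
       (\<Sum>i\<in>{1..DIM('f)}. second_ff M N g D p
          (onb (induced_metric M N g p) i) (onb (induced_metric M N g p) i))"

text \<open>
  The equality case of Chen's first inequality at \<open>p\<close> for the plane spanned by the orthonormal pair
  \<open>u\<close>, \<open>v\<close>. Here \<open>KM\<close>, \<open>K0\<close> and \<open>KN\<close> are the sectional \<open>K\<close>-curvature of \<open>M\<close> and the sectional
  curvatures of \<open>M\<close> and \<open>N\<close>, as functions of orthonormal pairs tangent to \<open>M\<close>.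
\<close>

definition chen_equality ::
  "real \<Rightarrow> ('a, 'f::euclidean_space) manifold \<Rightarrow> ('a, 'e::euclidean_space) manifold \<Rightarrow>
     ('a, 'e) metric \<Rightarrow> ('a, 'e) connection \<Rightarrow> ('a, 'e) connection \<Rightarrow> 'a \<Rightarrow> 'f \<Rightarrow> 'f \<Rightarrow> bool" where
  "chen_equality c M N g D D' p u v \<longleftrightarrow>
     (let n = real DIM('f);
          gM = induced_metric M N g;
          KM = K_curv M gM (induced_conn M N g D) (induced_conn M N g D') p;
          K0 = sec_curv M gM p;
          KN = (\<lambda>x y. sec_curv N g p (incl_deriv M N p x) (incl_deriv M N p y));
          \<tau> = sum_planes (gM p) KM;
          \<tau>0 = sum_planes (gM p) K0;
          \<tau>N = sum_planes (gM p) KN;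
          H = mean_curv M N g D p;
          H' = mean_curv M N g D' p
      in (\<tau> - \<tau>0) - (KM u v - K0 u v) =
           c / 8 * (n - 2) * (n + 1)
             - n\<^sup>2 * (n - 2) / (4 * (n - 1)) * (g p H H + g p H' H')
             + 2 * KN u v - 2 * \<tau>N)"

end

theory Submission
  imports Defs
begin

text \<open>
  By the Gauss equations of \<open>D\<close>, \<open>D'\<close> and the Levi-Civita connection, the difference of the two sides of
  Chen's inequality is a sum of squares of the components of \<open>\<sigma>\<close> and \<open>\<sigma>\<^sup>*\<close>. Equality therefore forces,
  in a basis adapted to the plane, \<open>\<sigma>(e\<^sub>i,e\<^sub>j) = 0\<close> for \<open>i \<noteq> j\<close> outside the plane and
  \<open>\<sigma>(e\<^sub>3,e\<^sub>3) = \<dots> = \<sigma>(e\<^sub>n,e\<^sub>n) = n H / (n - 1)\<close>, and likewise for \<open>\<sigma>\<^sup>*\<close>. Differentiating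
  \<open>g(Y, J\<^sub>\<alpha> Z) = 0\<close> along \<open>M\<close> shows that \<open>g(\<sigma>\<^sup>*(X,Y), J\<^sub>\<alpha> Z)\<close> and \<open>g(J\<^sub>\<alpha> \<sigma>(X,Y), Z)\<close> are totally symmetric.
  For \<open>n \<ge> 4\<close> the two facts together give \<open>g(H\<^sup>*, J\<^sub>\<alpha> Z) = 0 = g(J\<^sub>\<alpha> H, Z)\<close>, and since
  \<open>TM\<close> and the \<open>J\<^sub>\<alpha> TM\<close> span the ambient tangent space, both mean curvature vectors vanish.
\<close>

section \<open>Calculus\<close>

text \<open>The curvature hypothesis says nothing about the Levi-Civita curvature of the ambient
  space. It never has to be computed: passing from the sectional K-curvature to its difference with
  the sectional curvature subtracts the Levi-Civita curvature of the submanifold twice, and the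
  ambient sectional curvatures in Chen's equality compensate exactly this. The same subtraction
  cancels the mixed products of the two second fundamental forms, so that each form has a sum of
  squares of its own. The \<open>J \<alpha>\<close> are not assumed skew for the metric. Hence the
  spaces \<open>J \<alpha> TM\<close> need not be orthogonal to each other, and the two mean
  curvature vectors are killed by two different pairings. The formal obstacle is the Gauss equation.
  Tangent spaces are identified through preferred charts that jump from point to point, and fields
  along the submanifold are not extended to the ambient space. Everything is therefore
  differentiated in fixed charts, with the inclusion as an explicit map whose second and third
  derivatives must cancel.\<close>

lemma frechet_derivative_cong_open:
  assumes "open S" "x \<in> S" "\<And>y. y \<in> S \<Longrightarrow> f y = g y"
  shows "frechet_derivative f (at x) = frechet_derivative g (at x)"
proof -
  have "(f has_derivative F) (at x) \<longleftrightarrow> (g has_derivative F) (at x)" for F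
    using has_derivative_transform_within_open[OF _ assms(1,2)] assms(3) by metis
  then show ?thesis
    by (simp add: frechet_derivative_def)
qed

lemma differentiable_cong_open:
  assumes "open S" "x \<in> S" "\<And>y. y \<in> S \<Longrightarrow> f y = g y" "f differentiable (at x)"
  shows "g differentiable (at x)"
  using assms has_derivative_transform_within_open[OF _ assms(1,2)]
  unfolding differentiable_def by metis

text \<open>A differentiation rule identifies a directional derivative with its formula only at
  points of \<open>S\<close>. The closure properties below use this lemma to carry the induction
  hypothesis from the formula over to \<open>frechet_derivative\<close> itself.\<close>

lemma ck_on_cong:
  assumes "open S" "\<And>x. x \<in> S \<Longrightarrow> f x = g x" "ck_on k S f"
  shows "ck_on k S g"
  using assms(2,3)
proof (induction k arbitrary: f g)
  case 0
  then show ?case by (simp cong: continuous_on_cong)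
next
  case (Suc k)
  have "frechet_derivative f (at x) = frechet_derivative g (at x)" if "x \<in> S" for x
    using frechet_derivative_cong_open[OF assms(1) that] Suc.prems by blast
  moreover have "g differentiable (at x)" if "x \<in> S" for x
    using differentiable_cong_open[OF assms(1) that, of f g] Suc.prems that by auto
  ultimately show ?case
    using Suc.prems Suc.IH[of "\<lambda>x. frechet_derivative f (at x) v" "\<lambda>x. frechet_derivative g (at x) v" for v]
    by auto
qed

lemma ck_on_subset: "ck_on k S f \<Longrightarrow> T \<subseteq> S \<Longrightarrow> ck_on k T f"
  by (induction k arbitrary: f) (auto intro: continuous_on_subset)

lemma ck_on_SucD: "ck_on (Suc k) S f \<Longrightarrow> ck_on k S f"
proof (induction k arbitrary: f)
  case 0
  then show ?case
    by (auto intro!: continuous_at_imp_continuous_on differentiable_imp_continuous_within)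
next
  case (Suc k)
  then show ?case by (metis ck_on.simps(2))
qed

lemma ck_on_const: "ck_on k S (\<lambda>x. c)"
  by (induction k arbitrary: c) auto

lemma ck_on_linear:
  assumes "open S" "bounded_linear L" "ck_on k S f"
  shows "ck_on k S (\<lambda>x. L (f x))"
  using assms(3)
proof (induction k arbitrary: f)
  case 0
  then show ?case
    using assms(2) by (auto intro!: continuous_on_compose2[OF linear_continuous_on[OF assms(2), of UNIV]])
next
  case (Suc k)
  have der: "((\<lambda>x. L (f x)) has_derivative (\<lambda>v. L (frechet_derivative f (at x) v))) (at x)" if "x \<in> S" for x
    using Suc.prems that bounded_linear.has_derivative[OF assms(2)] by (auto simp: frechet_derivative_works)
  have "ck_on k S (\<lambda>x. frechet_derivative (\<lambda>x. L (f x)) (at x) v)" for v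
    by (rule ck_on_cong[OF assms(1) _ Suc.IH[of "\<lambda>x. frechet_derivative f (at x) v"]])
      (use Suc.prems frechet_derivative_at[OF der] in \<open>auto simp: fun_eq_iff\<close>)
  with der show ?case by (auto simp: differentiable_def)
qed

lemma ck_on_add:
  assumes "open S" "ck_on k S f" "ck_on k S g"
  shows "ck_on k S (\<lambda>x. f x + g x)"
  using assms(2,3)
proof (induction k arbitrary: f g)
  case 0
  then show ?case by (auto intro: continuous_intros)
next
  case (Suc k)
  have der: "((\<lambda>x. f x + g x) has_derivative
      (\<lambda>v. frechet_derivative f (at x) v + frechet_derivative g (at x) v)) (at x)" if "x \<in> S" for x
    using Suc.prems that by (auto simp: frechet_derivative_works intro: has_derivative_add)
  have "ck_on k S (\<lambda>x. frechet_derivative (\<lambda>x. f x + g x) (at x) v)" for v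
    by (rule ck_on_cong[OF assms(1) _ Suc.IH[of "\<lambda>x. frechet_derivative f (at x) v"
            "\<lambda>x. frechet_derivative g (at x) v"]])
      (use Suc.prems frechet_derivative_at[OF der] in \<open>auto simp: fun_eq_iff\<close>)
  with der show ?case by (auto simp: differentiable_def)
qed

lemma ck_on_sum:
  assumes "open S" "\<And>i. i \<in> I \<Longrightarrow> ck_on k S (f i)"
  shows "ck_on k S (\<lambda>x. \<Sum>i\<in>I. f i x)"
  using assms(2)
  by (induction I rule: infinite_finite_induct) (auto simp: ck_on_const ck_on_add[OF assms(1)])

text \<open>The product rule leaves one factor underived, which is why the induction relies on
  \<open>ck_on_SucD\<close>.\<close>

lemma ck_on_bilinear:
  assumes "open S" "bounded_bilinear B" "ck_on k S f" "ck_on k S g"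
  shows "ck_on k S (\<lambda>x. B (f x) (g x))"
  using assms(3,4)
proof (induction k arbitrary: f g)
  case 0
  then show ?case using bounded_bilinear.continuous_on[OF assms(2)] by auto
next
  case (Suc k)
  have der: "((\<lambda>x. B (f x) (g x)) has_derivative
      (\<lambda>v. B (f x) (frechet_derivative g (at x) v) + B (frechet_derivative f (at x) v) (g x))) (at x)"
    if "x \<in> S" for x
    using Suc.prems that by (auto simp: frechet_derivative_works intro: bounded_bilinear.FDERIV[OF assms(2)])
  have "ck_on k S (\<lambda>x. B (f x) (frechet_derivative g (at x) v) + B (frechet_derivative f (at x) v) (g x))" for v
    using Suc.prems ck_on_SucD[OF Suc.prems(1)] ck_on_SucD[OF Suc.prems(2)]
    by (auto intro!: ck_on_add[OF assms(1)] Suc.IH)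
  then have "ck_on k S (\<lambda>x. frechet_derivative (\<lambda>x. B (f x) (g x)) (at x) v)" for v
    by (rule ck_on_cong[OF assms(1), rotated]) (use frechet_derivative_at[OF der] in \<open>auto simp: fun_eq_iff\<close>)
  with der show ?case by (auto simp: differentiable_def)
qed

lemma linear_basis_expansion:
  fixes f :: "'e::euclidean_space \<Rightarrow> 'f::real_vector"
  assumes "linear f"
  shows "f v = (\<Sum>b\<in>Basis. (v \<bullet> b) *\<^sub>R f b)"
proof -
  have "f (\<Sum>b\<in>Basis. (v \<bullet> b) *\<^sub>R b) = (\<Sum>b\<in>Basis. (v \<bullet> b) *\<^sub>R f b)"
    by (simp add: linear_sum[OF assms] linear_cmul[OF assms])
  then show ?thesis by (simp add: euclidean_representation)
qed

lemma frechet_derivative_basis: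
  fixes f :: "'e::euclidean_space \<Rightarrow> 'f::real_normed_vector"
  assumes "f differentiable (at x)"
  shows "frechet_derivative f (at x) v = (\<Sum>b\<in>Basis. (v \<bullet> b) *\<^sub>R frechet_derivative f (at x) b)"
  by (rule linear_basis_expansion[OF linear_frechet_derivative[OF assms]])

text \<open>The chain rule differentiates \<open>f\<close> in the moving direction
  \<open>frechet_derivative g (at x) v\<close>, whereas \<open>ck_on\<close> controls fixed
  directions. Expanding the moving direction in \<open>Basis\<close> leaves a finite sum of
  products, and the induction hypothesis applies to the derivatives of \<open>f\<close> in basis
  directions.\<close>

lemma ck_on_compose:
  fixes f :: "'d::euclidean_space \<Rightarrow> 'f::real_normed_vector" and g :: "'e::euclidean_space \<Rightarrow> 'd"
  assumes "open S" "g ` S \<subseteq> T" "ck_on k S g" "ck_on k T f"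
  shows "ck_on k S (\<lambda>x. f (g x))"
  using assms(3,4)
proof (induction k arbitrary: f)
  case 0
  then show ?case using assms(2) by (auto intro: continuous_on_compose2)
next
  case (Suc k)
  have der: "((\<lambda>x. f (g x)) has_derivative
      (\<lambda>v. frechet_derivative f (at (g x)) (frechet_derivative g (at x) v))) (at x)" if "x \<in> S" for x
  proof -
    have "g differentiable (at x)" "f differentiable (at (g x))" using Suc.prems that assms(2) by auto
    then show ?thesis
      using has_derivative_compose[of g _ x UNIV f] by (simp add: frechet_derivative_works)
  qed
  have "ck_on k S (\<lambda>x. \<Sum>b\<in>Basis. (frechet_derivative g (at x) v \<bullet> b) *\<^sub>R frechet_derivative f (at (g x)) b)" for v
  proof (rule ck_on_sum[OF assms(1)])
    fix b :: 'd
    have "ck_on k S (\<lambda>x. frechet_derivative g (at x) v \<bullet> b)"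
      using Suc.prems by (auto intro!: ck_on_linear[OF assms(1) bounded_linear_inner_left])
    moreover have "ck_on k S (\<lambda>x. frechet_derivative f (at (g x)) b)"
      using Suc.prems ck_on_SucD[OF Suc.prems(1)] by (auto intro!: Suc.IH)
    ultimately show "ck_on k S (\<lambda>x. (frechet_derivative g (at x) v \<bullet> b) *\<^sub>R frechet_derivative f (at (g x)) b)"
      by (rule ck_on_bilinear[OF assms(1) bounded_bilinear_scaleR])
  qed
  then have "ck_on k S (\<lambda>x. frechet_derivative (\<lambda>x. f (g x)) (at x) v)" for v
  proof (rule ck_on_cong[OF assms(1), rotated])
    fix x assume x: "x \<in> S"
    have "f differentiable (at (g x))" using Suc.prems x assms(2) by auto
    from frechet_derivative_basis[OF this]
    show "(\<Sum>b\<in>Basis. (frechet_derivative g (at x) v \<bullet> b) *\<^sub>R frechet_derivative f (at (g x)) b) =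
         frechet_derivative (\<lambda>x. f (g x)) (at x) v"
      using frechet_derivative_at[OF der[OF x]] by metis
  qed
  with der show ?case by (auto simp: differentiable_def)
qed

lemma smooth_on_cong:
  assumes "open S" "\<And>x. x \<in> S \<Longrightarrow> f x = g x" "smooth_on S f"
  shows "smooth_on S g"
  using assms ck_on_cong unfolding smooth_on_def by blast

lemma smooth_on_subset: "smooth_on S f \<Longrightarrow> T \<subseteq> S \<Longrightarrow> smooth_on T f"
  unfolding smooth_on_def using ck_on_subset by blast

lemma smooth_on_const: "smooth_on S (\<lambda>x. c)"
  by (simp add: smooth_on_def ck_on_const)

lemma smooth_on_linear:
  "open S \<Longrightarrow> bounded_linear L \<Longrightarrow> smooth_on S f \<Longrightarrow> smooth_on S (\<lambda>x. L (f x))"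
  by (simp add: smooth_on_def ck_on_linear)

lemma smooth_on_add:
  "open S \<Longrightarrow> smooth_on S f \<Longrightarrow> smooth_on S g \<Longrightarrow> smooth_on S (\<lambda>x. f x + g x)"
  by (simp add: smooth_on_def ck_on_add)

lemma smooth_on_bilinear:
  "open S \<Longrightarrow> bounded_bilinear B \<Longrightarrow> smooth_on S f \<Longrightarrow> smooth_on S g \<Longrightarrow> smooth_on S (\<lambda>x. B (f x) (g x))"
  by (simp add: smooth_on_def ck_on_bilinear)

lemma smooth_on_compose:
  fixes f :: "'d::euclidean_space \<Rightarrow> 'f::real_normed_vector" and g :: "'e::euclidean_space \<Rightarrow> 'd"
  shows "open S \<Longrightarrow> g ` S \<subseteq> T \<Longrightarrow> smooth_on S g \<Longrightarrow> smooth_on T f \<Longrightarrow> smooth_on S (\<lambda>x. f (g x))"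
  unfolding smooth_on_def by (blast intro: ck_on_compose[of S g T])

lemma smooth_on_differentiable: "smooth_on S f \<Longrightarrow> x \<in> S \<Longrightarrow> f differentiable (at x)"
  unfolding smooth_on_def by (metis ck_on.simps(2))

lemma smooth_on_frechet: "smooth_on S f \<Longrightarrow> smooth_on S (\<lambda>x. frechet_derivative f (at x) v)"
  unfolding smooth_on_def by (metis ck_on.simps(2))

section \<open>Second directional derivatives and their symmetry\<close>

definition second_derivative ::
  "('e::euclidean_space \<Rightarrow> 'f::real_normed_vector) \<Rightarrow> 'e \<Rightarrow> 'e \<Rightarrow> 'e \<Rightarrow> 'f" where
  "second_derivative f x u v = frechet_derivative (\<lambda>y. frechet_derivative f (at y) v) (at x) u"

lemma smooth_on_second_derivative:
  "smooth_on S f \<Longrightarrow> smooth_on S (\<lambda>x. second_derivative f x u v)"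
  unfolding second_derivative_def by (intro smooth_on_frechet)

text \<open>Two applications of the mean value theorem to the second difference over a
  parallelogram: first to the increment in direction \<open>v\<close> as a function along
  \<open>u\<close>, then to the derivative in direction \<open>u\<close> as a function along
  \<open>v\<close>. This fixes the order of differentiation.\<close>

lemma second_derivative_mean_value:
  fixes f :: "'e::euclidean_space \<Rightarrow> real"
  assumes f: "smooth_on S f" and h: "0 < h"
    and S: "\<And>s t. 0 \<le> s \<Longrightarrow> s \<le> h \<Longrightarrow> 0 \<le> t \<Longrightarrow> t \<le> h \<Longrightarrow> x + s *\<^sub>R u + t *\<^sub>R v \<in> S"
  shows "\<exists>s t. 0 < s \<and> s < h \<and> 0 < t \<and> t < h \<and>
    f (x + h *\<^sub>R u + h *\<^sub>R v) - f (x + h *\<^sub>R u) - f (x + h *\<^sub>R v) + f x =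
      h * h * second_derivative f (x + s *\<^sub>R u + t *\<^sub>R v) v u"
proof -
  have line: "((\<lambda>s. F (a + s *\<^sub>R w)) has_derivative (\<lambda>r. r * frechet_derivative F (at (a + s *\<^sub>R w)) w)) (at s)"
    if "F differentiable (at (a + s *\<^sub>R w))" for F :: "'e \<Rightarrow> real" and a w s
  proof -
    have "((\<lambda>s. a + s *\<^sub>R w) has_derivative (\<lambda>r. r *\<^sub>R w)) (at s)"
      by (auto intro!: derivative_eq_intros)
    from has_derivative_compose[OF this that[unfolded frechet_derivative_works]]
    show ?thesis by (simp add: linear_cmul[OF linear_frechet_derivative[OF that]])
  qed
  let ?k = "\<lambda>s. f (x + h *\<^sub>R v + s *\<^sub>R u) - f (x + s *\<^sub>R u)"
  let ?k' = "\<lambda>s. frechet_derivative f (at (x + h *\<^sub>R v + s *\<^sub>R u)) u - frechet_derivative f (at (x + s *\<^sub>R u)) u"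
  have "(?k has_derivative (\<lambda>r. r * ?k' s)) (at s)" if "0 \<le> s" "s \<le> h" for s
  proof -
    have "x + h *\<^sub>R v + s *\<^sub>R u \<in> S" "x + s *\<^sub>R u \<in> S"
      using S[of s h] S[of s 0] that h by (simp_all add: algebra_simps)
    from this[THEN smooth_on_differentiable[OF f]] show ?thesis
      by (intro has_derivative_eq_rhs[OF has_derivative_diff[OF line line]]) (auto simp: algebra_simps)
  qed
  then obtain s where s: "0 < s" "s < h" "?k h - ?k 0 = h * ?k' s"
    using mvt_simple[OF h, of ?k "\<lambda>s r. r * ?k' s"] has_derivative_at_withinI
    by (smt (verit) atLeastAtMost_iff greaterThanLessThan_iff)
  let ?l = "\<lambda>t. frechet_derivative f (at (x + s *\<^sub>R u + t *\<^sub>R v)) u"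
  have "(?l has_derivative (\<lambda>r. r * second_derivative f (x + s *\<^sub>R u + t *\<^sub>R v) v u)) (at t)"
    if "0 \<le> t" "t \<le> h" for t
    unfolding second_derivative_def
    using S[of s t] that s(1,2)
    by (auto intro!: line[of "\<lambda>y. frechet_derivative f (at y) u"] smooth_on_differentiable[OF smooth_on_frechet[OF f]])
  then obtain t where t: "0 < t" "t < h"
     "?l h - ?l 0 = h * second_derivative f (x + s *\<^sub>R u + t *\<^sub>R v) v u"
    using mvt_simple[OF h, of ?l "\<lambda>t r. r * second_derivative f (x + s *\<^sub>R u + t *\<^sub>R v) v u"]
      has_derivative_at_withinI by (smt (verit) atLeastAtMost_iff greaterThanLessThan_iff)
  from s(3) t(3) have "f (x + h *\<^sub>R u + h *\<^sub>R v) - f (x + h *\<^sub>R u) - f (x + h *\<^sub>R v) + f x =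
      h * h * second_derivative f (x + s *\<^sub>R u + t *\<^sub>R v) v u"
    by (simp add: algebra_simps)
  with s t show ?thesis by blast
qed

text \<open>The second difference is symmetric in \<open>u\<close> and \<open>v\<close>, so the two
  mixed derivatives take a common value at two points close to \<open>x\<close>. Being continuous,
  they cannot differ at \<open>x\<close>.\<close>

lemma second_derivative_sym_real:
  fixes f :: "'e::euclidean_space \<Rightarrow> real"
  assumes S: "open S" "x \<in> S" and f: "smooth_on S f"
  shows "second_derivative f x u v = second_derivative f x v u"
proof (rule ccontr)
  assume ne: "second_derivative f x u v \<noteq> second_derivative f x v u"
  let ?a = "\<lambda>y. second_derivative f y u v" and ?b = "\<lambda>y. second_derivative f y v u"
  define \<epsilon> where "\<epsilon> = \<bar>?a x - ?b x\<bar> / 2"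
  have \<epsilon>: "\<epsilon> > 0" using ne by (simp add: \<epsilon>_def)
  have "isCont ?a x" "isCont ?b x"
    using smooth_on_differentiable[OF smooth_on_second_derivative[OF f] S(2)]
    by (auto intro: differentiable_imp_continuous_within)
  then obtain d1 d2 where d: "d1 > 0" "\<And>y. dist y x < d1 \<Longrightarrow> dist (?a y) (?a x) < \<epsilon>"
     "d2 > 0" "\<And>y. dist y x < d2 \<Longrightarrow> dist (?b y) (?b x) < \<epsilon>"
    unfolding continuous_at_eps_delta by (metis \<epsilon> )
  obtain e where e: "e > 0" "ball x e \<subseteq> S" using S openE by blast
  define \<delta> where "\<delta> = min e (min d1 d2)"
  \<comment> \<open>The summand 1 keeps the denominator positive even if \<open>u\<close> and
    \<open>v\<close> vanish; the factor 2 keeps the parallelogram strictly within distance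
    \<open>\<delta>\<close> of \<open>x\<close>.\<close>
  define h where "h = \<delta> / (2 * (norm u + norm v + 1))"
  have \<delta>: "\<delta> > 0" using d e by (simp add: \<delta>_def)
  have h: "h > 0" unfolding h_def using \<delta> by (intro divide_pos_pos) (auto intro: add_nonneg_pos)
  have near: "dist (x + s *\<^sub>R u + t *\<^sub>R v) x < \<delta>" if "0 \<le> s" "s \<le> h" "0 \<le> t" "t \<le> h" for s t
  proof -
    have "dist (x + s *\<^sub>R u + t *\<^sub>R v) x \<le> norm (s *\<^sub>R u) + norm (t *\<^sub>R v)"
      using norm_triangle_ineq[of "s *\<^sub>R u" "t *\<^sub>R v"] by (simp add: dist_norm algebra_simps)
    also have "\<dots> \<le> h * norm u + h * norm v"
      using that by (auto intro!: add_mono mult_right_mono)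
    also have "\<dots> \<le> h * (norm u + norm v + 1)" using h by (simp add: algebra_simps)
    also have "\<dots> = \<delta> / 2"
    proof -
      have "norm u + norm v + 1 \<noteq> 0" using norm_ge_zero[of u] norm_ge_zero[of v] by linarith
      then show ?thesis unfolding h_def by (simp add: field_simps)
    qed
    also have "\<dots> < \<delta>" using \<delta> by simp
    finally show ?thesis .
  qed
  have near': "dist (x + t *\<^sub>R v + s *\<^sub>R u) x < \<delta>" if "0 \<le> s" "s \<le> h" "0 \<le> t" "t \<le> h" for s t
    using near[OF that] by (simp add: algebra_simps)
  have inS: "y \<in> S" if "dist y x < \<delta>" for y
    using that e by (auto simp: \<delta>_def dist_commute)
  obtain s t where st: "0 < s" "s < h" "0 < t" "t < h"
    "f (x + h *\<^sub>R u + h *\<^sub>R v) - f (x + h *\<^sub>R u) - f (x + h *\<^sub>R v) + f x = h * h * ?b (x + s *\<^sub>R u + t *\<^sub>R v)"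
    using second_derivative_mean_value[OF f h, of x u v] inS near by blast
  obtain s' t' where st': "0 < s'" "s' < h" "0 < t'" "t' < h"
    "f (x + h *\<^sub>R v + h *\<^sub>R u) - f (x + h *\<^sub>R v) - f (x + h *\<^sub>R u) + f x = h * h * ?a (x + s' *\<^sub>R v + t' *\<^sub>R u)"
    using second_derivative_mean_value[OF f h, of x v u] inS near' by blast
  have "f (x + h *\<^sub>R v + h *\<^sub>R u) = f (x + h *\<^sub>R u + h *\<^sub>R v)" by (simp add: algebra_simps)
  with st(5) st'(5) have "h * h * ?a (x + s' *\<^sub>R v + t' *\<^sub>R u) = h * h * ?b (x + s *\<^sub>R u + t *\<^sub>R v)"
    by linarith
  with h have eq: "?a (x + s' *\<^sub>R v + t' *\<^sub>R u) = ?b (x + s *\<^sub>R u + t *\<^sub>R v)" by simp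
  have "dist (?a (x + s' *\<^sub>R v + t' *\<^sub>R u)) (?a x) < \<epsilon>"
    using near'[of t' s'] st' d(2) by (simp add: \<delta>_def)
  moreover have "dist (?b (x + s *\<^sub>R u + t *\<^sub>R v)) (?b x) < \<epsilon>"
    using near[of s t] st d(4) by (simp add: \<delta>_def)
  moreover have False if "dist A a < \<bar>a - b\<bar> / 2" "dist B b < \<bar>a - b\<bar> / 2" "A = B" for A B a b :: real
    using that by (auto simp: dist_real_def abs_if split: if_splits)
  ultimately show False using eq unfolding \<epsilon>_def by blast
qed

lemma frechet_derivative_inner:
  fixes f :: "'e::euclidean_space \<Rightarrow> 'f::euclidean_space"
  assumes "f differentiable (at x)"
  shows "frechet_derivative (\<lambda>y. f y \<bullet> b) (at x) v = frechet_derivative f (at x) v \<bullet> b"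
  using frechet_derivative_at[OF bounded_linear.has_derivative[OF bounded_linear_inner_left
        assms[unfolded frechet_derivative_works]]]
  by metis

text \<open>The mean value theorem with equality fails for vector values, hence the passage through
  components.\<close>

lemma second_derivative_sym:
  fixes f :: "'e::euclidean_space \<Rightarrow> 'f::euclidean_space"
  assumes S: "open S" "x \<in> S" and f: "smooth_on S f"
  shows "second_derivative f x u v = second_derivative f x v u"
proof (rule euclidean_eqI)
  fix b :: 'f assume "b \<in> Basis"
  have fb: "smooth_on S (\<lambda>y. f y \<bullet> b)"
    by (rule smooth_on_linear[OF S(1) bounded_linear_inner_left f])
  have "second_derivative f x u v \<bullet> b = second_derivative (\<lambda>y. f y \<bullet> b) x u v" for u v
    unfolding second_derivative_def
    using frechet_derivative_cong_open[OF S, of "\<lambda>y. frechet_derivative (\<lambda>y. f y \<bullet> b) (at y) v"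
       "\<lambda>y. frechet_derivative f (at y) v \<bullet> b"]
      frechet_derivative_inner[OF smooth_on_differentiable[OF f]]
      frechet_derivative_inner[OF smooth_on_differentiable[OF smooth_on_frechet[OF f, of v] S(2)]]
    by simp
  then show "second_derivative f x u v \<bullet> b = second_derivative f x v u \<bullet> b"
    using second_derivative_sym_real[OF S fb] by simp
qed

lemma second_derivative_linear1:
  assumes "smooth_on S f" "x \<in> S"
  shows "linear (\<lambda>u. second_derivative f x u v)"
  unfolding second_derivative_def
  using linear_frechet_derivative[OF smooth_on_differentiable[OF smooth_on_frechet[OF assms(1)] assms(2)]] .

text \<open>A basis expansion reduces a moving argument to finitely many fixed ones, so
  differentiability of \<open>B\<close> at each fixed argument suffices. Metrics, Christoffel
  symbols and differentials of transition maps enter later as such families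
  \<open>B\<close>.\<close>

lemma has_derivative_linear_apply:
  fixes B :: "'d::euclidean_space \<Rightarrow> 'e::euclidean_space \<Rightarrow> 'f::real_normed_vector"
  assumes S: "open S" "x \<in> S" and lin: "\<And>y. y \<in> S \<Longrightarrow> linear (B y)"
    and B: "\<And>v. ((\<lambda>y. B y v) has_derivative (\<lambda>h. B' h v)) (at x)"
    and a: "(a has_derivative a') (at x)"
  shows "((\<lambda>y. B y (a y)) has_derivative (\<lambda>h. B' h (a x) + B x (a' h))) (at x)"
proof -
  have rep: "B y w = (\<Sum>b\<in>Basis. (w \<bullet> b) *\<^sub>R B y b)" if "y \<in> S" for y w
    by (rule linear_basis_expansion[OF lin[OF that]])
  \<comment> \<open>Linearity of \<open>B'\<close> in its second argument follows from uniqueness of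
    the derivative.\<close>
  have repB': "B' h w = (\<Sum>b\<in>Basis. (w \<bullet> b) *\<^sub>R B' h b)" for h w
  proof -
    have "((\<lambda>y. \<Sum>b\<in>Basis. (w \<bullet> b) *\<^sub>R B y b) has_derivative (\<lambda>h. \<Sum>b\<in>Basis. (w \<bullet> b) *\<^sub>R B' h b)) (at x)"
      by (auto intro!: derivative_intros B)
    then have "((\<lambda>y. B y w) has_derivative (\<lambda>h. \<Sum>b\<in>Basis. (w \<bullet> b) *\<^sub>R B' h b)) (at x)"
      by (rule has_derivative_transform_within_open[OF _ S]) (rule rep[symmetric])
    from has_derivative_unique[OF this B] show ?thesis by metis
  qed
  have "((\<lambda>y. \<Sum>b\<in>Basis. (a y \<bullet> b) *\<^sub>R B y b) has_derivative
     (\<lambda>h. \<Sum>b\<in>Basis. (a x \<bullet> b) *\<^sub>R B' h b + (a' h \<bullet> b) *\<^sub>R B x b)) (at x)"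
    by (auto intro!: derivative_eq_intros a B)
  then have "((\<lambda>y. B y (a y)) has_derivative
     (\<lambda>h. \<Sum>b\<in>Basis. (a x \<bullet> b) *\<^sub>R B' h b + (a' h \<bullet> b) *\<^sub>R B x b)) (at x)"
    by (rule has_derivative_transform_within_open[OF _ S]) (rule rep[symmetric])
  then show ?thesis
    unfolding sum.distrib repB'[symmetric] rep[OF S(2), symmetric] .
qed

section \<open>Charts and coordinate vector fields\<close>

text \<open>\<open>const_vf\<close>, \<open>chart_coords\<close> and \<open>incl_deriv\<close> are
  all differentials of a transition map between two charts. Written through this one map, every
  change of identification of tangent spaces becomes an instance of
  \<open>chart_deriv_comp\<close>.\<close>

definition chart_deriv ::
  "('a, 'e::euclidean_space) chart \<Rightarrow> ('a, 'f::euclidean_space) chart \<Rightarrow> 'a \<Rightarrow> 'e \<Rightarrow> 'f" where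
  "chart_deriv c d q v = frechet_derivative (snd d \<circ> chart_inv c) (at (snd c q)) v"

definition coord_vf ::
  "('a, 'e::euclidean_space) manifold \<Rightarrow> ('a, 'e) chart \<Rightarrow> 'e \<Rightarrow> 'a \<Rightarrow> 'e" where
  "coord_vf M c v q = chart_deriv c (chart_at M q) q v"

lemma const_vf_eq: "const_vf M p = coord_vf M (chart_at M p)"
  by (simp add: fun_eq_iff const_vf_def coord_vf_def chart_deriv_def)

lemma chart_coords_eq: "chart_coords M c q = chart_deriv (chart_at M q) c q"
  by (simp add: fun_eq_iff chart_coords_def chart_deriv_def)

lemma incl_deriv_eq: "incl_deriv M N q = chart_deriv (chart_at M q) (chart_at N q) q"
  by (simp add: fun_eq_iff incl_deriv_def chart_deriv_def)

text \<open>The two charts may belong to different manifolds, such as a submanifold and its ambient space.\<close>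

definition compat ::
  "('a, 'e::euclidean_space) chart \<Rightarrow> ('a, 'f::euclidean_space) chart \<Rightarrow> bool" where
  "compat c d \<longleftrightarrow> inj_on (snd c) (fst c) \<and> inj_on (snd d) (fst d) \<and>
     open (snd c ` (fst c \<inter> fst d)) \<and> smooth_on (snd c ` (fst c \<inter> fst d)) (snd d \<circ> chart_inv c)"

lemma chart_inv_snd [simp]: "inj_on (snd c) (fst c) \<Longrightarrow> q \<in> fst c \<Longrightarrow> chart_inv c (snd c q) = q"
  by (simp add: chart_inv_def)

lemma compat_has_derivative:
  assumes "compat c d" "q \<in> fst c" "q \<in> fst d"
  shows "((snd d \<circ> chart_inv c) has_derivative chart_deriv c d q) (at (snd c q))"
proof -
  have "(snd d \<circ> chart_inv c) differentiable (at (snd c q))"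
    using assms by (auto simp: compat_def intro: smooth_on_differentiable)
  then show ?thesis
    unfolding chart_deriv_def frechet_derivative_works by simp
qed

lemma linear_chart_deriv:
  "compat c d \<Longrightarrow> q \<in> fst c \<Longrightarrow> q \<in> fst d \<Longrightarrow> linear (chart_deriv c d q)"
  by (rule has_derivative_linear[OF compat_has_derivative])

lemma chart_deriv_comp:
  assumes cd: "compat c d" and de: "compat d e" and q: "q \<in> fst c" "q \<in> fst d" "q \<in> fst e"
  shows "chart_deriv d e q (chart_deriv c d q v) = chart_deriv c e q v"
proof -
  let ?S = "snd c ` (fst c \<inter> fst d)"
  have inv: "chart_inv c (snd c q) = q" using cd q by (simp add: compat_def)
  have "((\<lambda>x. (snd e \<circ> chart_inv d) ((snd d \<circ> chart_inv c) x)) has_derivative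
      (\<lambda>v. chart_deriv d e q (chart_deriv c d q v))) (at (snd c q))"
    using has_derivative_compose[OF compat_has_derivative[OF cd q(1,2)], of "snd e \<circ> chart_inv d"]
      compat_has_derivative[OF de q(2,3)] inv by simp
  then have "((snd e \<circ> chart_inv c) has_derivative
      (\<lambda>v. chart_deriv d e q (chart_deriv c d q v))) (at (snd c q))"
    by (rule has_derivative_transform_within_open[where s = ?S]) (use cd de q in \<open>auto simp: compat_def\<close>)
  from frechet_derivative_at[OF this] show ?thesis by (metis chart_deriv_def)
qed

lemma chart_deriv_self:
  assumes "compat c c" "q \<in> fst c"
  shows "chart_deriv c c q v = v"
proof -
  have "frechet_derivative (snd c \<circ> chart_inv c) (at (snd c q)) = frechet_derivative (\<lambda>x. x) (at (snd c q))"
    by (rule frechet_derivative_cong_open[where S = "snd c ` fst c"]) (use assms in \<open>auto simp: compat_def\<close>)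
  then show ?thesis by (simp add: chart_deriv_def)
qed

context
  fixes M :: "('a, 'e::euclidean_space) manifold"
  assumes sm: "smooth_manifold M"
begin

lemma chart_at:
  assumes "p \<in> points M"
  shows "chart_at M p \<in> atlas M" "p \<in> fst (chart_at M p)"
proof -
  have "\<exists>c. c \<in> atlas M \<and> p \<in> fst c" using sm assms by (auto simp: smooth_manifold_def)
  from someI_ex[OF this] show "chart_at M p \<in> atlas M" "p \<in> fst (chart_at M p)"
    by (simp_all add: chart_at_def)
qed

lemma inj_chart: "c \<in> atlas M \<Longrightarrow> inj_on (snd c) (fst c)"
  and openin_chart: "c \<in> atlas M \<Longrightarrow> openin (mtop M) (fst c)"
proof -
  assume c: "c \<in> atlas M"
  then have h: "homeomorphic_map (subtopology (mtop M) (fst c)) (top_of_set (snd c ` fst c)) (snd c)"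
    and op: "openin (mtop M) (fst c)"
    using sm by (auto simp: smooth_manifold_def)
  show "openin (mtop M) (fst c)" by (fact op)
  from homeomorphic_imp_injective_map[OF h] show "inj_on (snd c) (fst c)"
    using openin_subset[OF op] by (simp add: topspace_subtopology Int_absorb1)
qed

lemma chart_points: "c \<in> atlas M \<Longrightarrow> q \<in> fst c \<Longrightarrow> q \<in> points M"
  using openin_chart openin_subset by blast

lemma open_chart_image:
  assumes c: "c \<in> atlas M" and U: "openin (mtop M) U"
  shows "open (snd c ` (U \<inter> fst c))"
proof -
  have h: "homeomorphic_map (subtopology (mtop M) (fst c)) (top_of_set (snd c ` fst c)) (snd c)"
    and op: "open (snd c ` fst c)"
    using sm c by (auto simp: smooth_manifold_def)
  have "openin (subtopology (mtop M) (fst c)) (U \<inter> fst c)"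
    using U by (auto simp: openin_subtopology)
  with homeomorphic_imp_open_map[OF h] have "openin (top_of_set (snd c ` fst c)) (snd c ` (U \<inter> fst c))"
    by (auto simp: open_map_def)
  with op show ?thesis by (simp add: openin_open_eq)
qed

lemma compat_atlas: "c \<in> atlas M \<Longrightarrow> d \<in> atlas M \<Longrightarrow> compat c d"
  using sm inj_chart open_chart_image[OF _ openin_chart, of c d]
  by (auto simp: compat_def smooth_manifold_def Int_commute)

lemma chart_coords_coord_vf:
  assumes "c \<in> atlas M" "d \<in> atlas M" "q \<in> fst c" "q \<in> fst d"
  shows "chart_coords M d q (coord_vf M c v q) = chart_deriv c d q v"
  unfolding chart_coords_eq coord_vf_def
  using assms chart_at[OF chart_points] chart_points by (intro chart_deriv_comp compat_atlas) auto

lemma chart_coords_coord_vf_self: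
  "c \<in> atlas M \<Longrightarrow> q \<in> fst c \<Longrightarrow> chart_coords M c q (coord_vf M c v q) = v"
  by (simp add: chart_coords_coord_vf chart_deriv_self compat_atlas)

lemma coord_vf_chart_coords:
  assumes "c \<in> atlas M" "q \<in> fst c"
  shows "coord_vf M c (chart_coords M c q v) q = v"
proof -
  have q: "chart_at M q \<in> atlas M" "q \<in> fst (chart_at M q)" using chart_at chart_points assms by blast+
  then have "coord_vf M c (chart_coords M c q v) q = chart_deriv (chart_at M q) (chart_at M q) q v"
    unfolding chart_coords_eq coord_vf_def using assms by (intro chart_deriv_comp compat_atlas) auto
  with q show ?thesis by (simp add: chart_deriv_self compat_atlas)
qed

lemma const_vf_at: "p \<in> points M \<Longrightarrow> const_vf M p v p = v"
  using chart_at[of p] by (simp add: const_vf_eq coord_vf_def chart_deriv_self compat_atlas)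

lemma linear_chart_coords: "c \<in> atlas M \<Longrightarrow> q \<in> fst c \<Longrightarrow> linear (chart_coords M c q)"
  unfolding chart_coords_eq using chart_at chart_points by (intro linear_chart_deriv compat_atlas) auto

lemma linear_coord_vf: "c \<in> atlas M \<Longrightarrow> q \<in> fst c \<Longrightarrow> linear (\<lambda>v. coord_vf M c v q)"
  unfolding coord_vf_def using chart_at chart_points by (intro linear_chart_deriv compat_atlas) auto

text \<open>In another chart \<open>d\<close> the components are a derivative of the transition from
  \<open>c\<close> to \<open>d\<close>, composed with the transition back.\<close>

lemma smooth_coord_vf:
  assumes c: "c \<in> atlas M" and U: "openin (mtop M) U" "U \<subseteq> fst c"
  shows "smooth_vf M U (coord_vf M c v)"
  unfolding smooth_vf_def
proof
  fix d assume d: "d \<in> atlas M"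
  have cd: "compat c d" "compat d c" using c d compat_atlas by auto
  let ?S = "snd d ` (U \<inter> fst d)"
  have "smooth_on ?S (\<lambda>x. frechet_derivative (snd d \<circ> chart_inv c) (at ((snd c \<circ> chart_inv d) x)) v)"
  proof (rule smooth_on_compose[where T = "snd c ` (fst c \<inter> fst d)" and g = "snd c \<circ> chart_inv d"
        and f = "\<lambda>y. frechet_derivative (snd d \<circ> chart_inv c) (at y) v"])
    show "open ?S" by (rule open_chart_image[OF d U(1)])
    show "(snd c \<circ> chart_inv d) ` ?S \<subseteq> snd c ` (fst c \<inter> fst d)"
      using U cd by (auto simp: compat_def)
    show "smooth_on ?S (snd c \<circ> chart_inv d)"
      using cd(2) U(2) by (auto simp: compat_def intro: smooth_on_subset)
    show "smooth_on (snd c ` (fst c \<inter> fst d)) (\<lambda>y. frechet_derivative (snd d \<circ> chart_inv c) (at y) v)"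
      using cd(1) by (auto simp: compat_def intro: smooth_on_frechet)
  qed
  then show "smooth_on ?S (vf_rep M d (coord_vf M c v))"
  proof (rule smooth_on_cong[rotated 2])
    show "open ?S" by (rule open_chart_image[OF d U(1)])
    fix x assume "x \<in> ?S"
    then show "frechet_derivative (snd d \<circ> chart_inv c) (at ((snd c \<circ> chart_inv d) x)) v =
        vf_rep M d (coord_vf M c v) x"
      using U c d cd chart_coords_coord_vf[OF c d]
      by (auto simp: vf_rep_def chart_deriv_def compat_def)
  qed
qed

lemma smooth_const_vf: "p \<in> points M \<Longrightarrow> smooth_vf M (fst (chart_at M p)) (const_vf M p v)"
  unfolding const_vf_eq using chart_at by (intro smooth_coord_vf openin_chart) auto

lemma smooth_fun_chart:
  assumes c: "c \<in> atlas M" and U: "openin (mtop M) U" "U \<subseteq> fst c" and F: "smooth_on (snd c ` U) F"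
  shows "smooth_fun M U (\<lambda>q. F (snd c q))"
  unfolding smooth_fun_def
proof
  fix d assume d: "d \<in> atlas M"
  have cd: "compat c d" "compat d c" using c d compat_atlas by auto
  let ?S = "snd d ` (U \<inter> fst d)"
  have "smooth_on ?S (\<lambda>x. F ((snd c \<circ> chart_inv d) x))"
  proof (rule smooth_on_compose[where T = "snd c ` U" and g = "snd c \<circ> chart_inv d" and f = F])
    show "open ?S" by (rule open_chart_image[OF d U(1)])
    show "(snd c \<circ> chart_inv d) ` ?S \<subseteq> snd c ` U"
      using U cd by (auto simp: compat_def)
    show "smooth_on ?S (snd c \<circ> chart_inv d)"
      using cd(2) U(2) by (auto simp: compat_def intro: smooth_on_subset)
  qed (rule F)
  then show "smooth_on ?S ((\<lambda>q. F (snd c q)) \<circ> chart_inv d)"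
    by (simp add: comp_def)
qed

lemma smooth_vf_chart: "c \<in> atlas M \<Longrightarrow> smooth_vf M U X \<Longrightarrow> smooth_on (snd c ` (U \<inter> fst c)) (vf_rep M c X)"
  by (simp add: smooth_vf_def)

lemma vf_rep_snd: "c \<in> atlas M \<Longrightarrow> q \<in> fst c \<Longrightarrow> vf_rep M c X (snd c q) = chart_coords M c q (X q)"
  by (simp add: vf_rep_def inj_chart)

lemma smooth_vf_subset: "smooth_vf M U X \<Longrightarrow> V \<subseteq> U \<Longrightarrow> smooth_vf M V X"
  unfolding smooth_vf_def by (meson smooth_on_subset image_mono Int_mono order_refl)

lemma smooth_vf_cong:
  assumes "openin (mtop M) U" "smooth_vf M U X" "\<And>q. q \<in> U \<Longrightarrow> X q = Y q"
  shows "smooth_vf M U Y"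
  unfolding smooth_vf_def
proof
  fix c assume c: "c \<in> atlas M"
  show "smooth_on (snd c ` (U \<inter> fst c)) (vf_rep M c Y)"
    by (rule smooth_on_cong[OF open_chart_image[OF c assms(1)] _ smooth_vf_chart[OF c assms(2)]])
      (use assms(3) c in \<open>auto simp: vf_rep_snd\<close>)
qed

lemma smooth_vf_add:
  assumes "openin (mtop M) U" "smooth_vf M U X" "smooth_vf M U Y"
  shows "smooth_vf M U (\<lambda>q. X q + Y q)"
  unfolding smooth_vf_def
proof
  fix c assume c: "c \<in> atlas M"
  show "smooth_on (snd c ` (U \<inter> fst c)) (vf_rep M c (\<lambda>q. X q + Y q))"
    by (rule smooth_on_cong[OF open_chart_image[OF c assms(1)] _ smooth_on_add[OF open_chart_image[OF c assms(1)]
        smooth_vf_chart[OF c assms(2)] smooth_vf_chart[OF c assms(3)]]])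
      (use c linear_add[OF linear_chart_coords[OF c]] in \<open>auto simp: vf_rep_snd\<close>)
qed

lemma smooth_vf_scaleR:
  assumes "openin (mtop M) U" "smooth_fun M U f" "smooth_vf M U X"
  shows "smooth_vf M U (\<lambda>q. f q *\<^sub>R X q)"
  unfolding smooth_vf_def
proof
  fix c assume c: "c \<in> atlas M"
  then have f: "smooth_on (snd c ` (U \<inter> fst c)) (f \<circ> chart_inv c)"
    using assms by (simp add: smooth_fun_def)
  show "smooth_on (snd c ` (U \<inter> fst c)) (vf_rep M c (\<lambda>q. f q *\<^sub>R X q))"
    by (rule smooth_on_cong[OF open_chart_image[OF c assms(1)] _
        smooth_on_bilinear[OF open_chart_image[OF c assms(1)] bounded_bilinear_scaleR f smooth_vf_chart[OF c assms(3)]]])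
      (use c linear_cmul[OF linear_chart_coords[OF c]] inj_chart in \<open>auto simp: vf_rep_snd\<close>)
qed

lemma smooth_fun_const: "smooth_fun M U (\<lambda>q. r)"
  by (simp add: smooth_fun_def comp_def smooth_on_const)

lemma smooth_vf_cmul: "openin (mtop M) U \<Longrightarrow> smooth_vf M U X \<Longrightarrow> smooth_vf M U (\<lambda>q. r *\<^sub>R X q)"
  by (rule smooth_vf_scaleR[OF _ smooth_fun_const])

lemma smooth_vf_zero:
  assumes U: "openin (mtop M) U"
  shows "smooth_vf M U (\<lambda>q. 0)"
  unfolding smooth_vf_def
proof
  fix c assume c: "c \<in> atlas M"
  show "smooth_on (snd c ` (U \<inter> fst c)) (vf_rep M c (\<lambda>q. 0))"
    by (rule smooth_on_cong[OF open_chart_image[OF c U] _ smooth_on_const[of _ 0]])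
      (use c linear_0[OF linear_chart_coords[OF c]] in \<open>auto simp: vf_rep_snd\<close>)
qed

lemma smooth_vf_sum:
  assumes U: "openin (mtop M) U" and "\<And>i. i \<in> I \<Longrightarrow> smooth_vf M U (X i)"
  shows "smooth_vf M U (\<lambda>q. \<Sum>i\<in>I. X i q)"
  using assms(2)
  by (induction I rule: infinite_finite_induct) (auto simp: smooth_vf_zero[OF U] smooth_vf_add[OF U])

text \<open>\<open>dir_deriv\<close> is defined by the preferred chart at \<open>q\<close>; the
  chain rule moves it to the chart in which a field is expanded.\<close>

lemma dir_deriv_chart:
  assumes c: "c \<in> atlas M" "q \<in> fst c" and f: "(f \<circ> chart_inv c) differentiable (at (snd c q))"
  shows "dir_deriv M X f q = frechet_derivative (f \<circ> chart_inv c) (at (snd c q)) (chart_coords M c q (X q))"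
proof -
  let ?d = "chart_at M q"
  have d: "?d \<in> atlas M" "q \<in> fst ?d" using chart_at chart_points c by blast+
  have dc: "compat ?d c" using compat_atlas c d by blast
  have inv: "chart_inv ?d (snd ?d q) = q" using d inj_chart by simp
  have "((\<lambda>x. (f \<circ> chart_inv c) ((snd c \<circ> chart_inv ?d) x)) has_derivative
      (\<lambda>v. frechet_derivative (f \<circ> chart_inv c) (at (snd c q)) (chart_deriv ?d c q v))) (at (snd ?d q))"
    using has_derivative_compose[OF compat_has_derivative[OF dc d(2) c(2)], of "f \<circ> chart_inv c"]
      f inv by (simp add: frechet_derivative_works)
  then have "((f \<circ> chart_inv ?d) has_derivative
      (\<lambda>v. frechet_derivative (f \<circ> chart_inv c) (at (snd c q)) (chart_deriv ?d c q v))) (at (snd ?d q))"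
    by (rule has_derivative_transform_within_open[where s = "snd ?d ` (fst ?d \<inter> fst c)"])
      (use dc c d in \<open>auto simp: compat_def\<close>)
  from frechet_derivative_at[OF this] show ?thesis
    unfolding dir_deriv_def chart_coords_eq by metis
qed

lemma smooth_fun_differentiable:
  assumes "c \<in> atlas M" "smooth_fun M U f" "q \<in> U" "q \<in> fst c"
  shows "(f \<circ> chart_inv c) differentiable (at (snd c q))"
  using assms smooth_on_differentiable[of "snd c ` (U \<inter> fst c)"] by (auto simp: smooth_fun_def)

end

text \<open>The overlap has an open chart image because the domain of \<open>d\<close> is pulled
  back along the continuous inclusion. The topology of \<open>M\<close> may be finer than the
  subspace topology.\<close>

lemma compat_submanifold:
  assumes sub: "submanifold M N" and c: "c \<in> atlas M" and d: "d \<in> atlas N"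
  shows "compat c d"
proof -
  have M: "smooth_manifold M" and N: "smooth_manifold N" and cm: "continuous_map (mtop M) (mtop N) (\<lambda>p. p)"
    and s: "smooth_on (snd c ` (fst c \<inter> fst d)) (snd d \<circ> chart_inv c)"
    using assms by (auto simp: submanifold_def)
  have "openin (mtop M) {p \<in> points M. p \<in> fst d}"
    using openin_continuous_map_preimage[OF cm openin_chart[OF N d]] .
  from open_chart_image[OF M c this] have "open (snd c ` (fst c \<inter> fst d))"
    by (rule back_subst[where P = "open"]) (use chart_points[OF M c] in auto)
  then show ?thesis
    using s inj_chart[OF M c] inj_chart[OF N d] by (simp add: compat_def)
qed

section \<open>Connections in coordinates\<close>

context
  fixes M :: "('a, 'e::euclidean_space) manifold" and U :: "'a set" and c :: "('a, 'e) chart"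
  assumes sm: "smooth_manifold M" and U: "openin (mtop M) U" and c: "c \<in> atlas M" and Uc: "U \<subseteq> fst c"
begin

text \<open>The coefficients are smooth functions by \<open>smooth_component\<close>, so additivity
  and the Leibniz rule of a connection can be applied to the summands.\<close>

lemma vf_expand:
  assumes "q \<in> U"
  shows "X q = (\<Sum>b\<in>Basis. (vf_rep M c X (snd c q) \<bullet> b) *\<^sub>R coord_vf M c b q)"
proof -
  have q: "q \<in> fst c" using assms Uc by blast
  have "X q = coord_vf M c (vf_rep M c X (snd c q)) q"
    by (simp add: vf_rep_snd[OF sm c q] coord_vf_chart_coords[OF sm c q])
  also have "\<dots> = (\<Sum>b\<in>Basis. (vf_rep M c X (snd c q) \<bullet> b) *\<^sub>R coord_vf M c b q)"
    by (rule linear_basis_expansion[OF linear_coord_vf[OF sm c q]])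
  finally show ?thesis .
qed

lemma smooth_component:
  assumes "smooth_vf M U X"
  shows "smooth_fun M U (\<lambda>q. vf_rep M c X (snd c q) \<bullet> b)"
proof (rule smooth_fun_chart[OF sm c U Uc, where F = "\<lambda>x. vf_rep M c X x \<bullet> b"])
  have "open (snd c ` U)" using open_chart_image[OF sm c U] Uc by (simp add: Int_absorb2)
  moreover have "smooth_on (snd c ` U) (vf_rep M c X)"
    using smooth_vf_chart[OF sm c assms] Uc by (simp add: Int_absorb2)
  ultimately show "smooth_on (snd c ` U) (\<lambda>x. vf_rep M c X x \<bullet> b)"
    by (rule smooth_on_linear[OF _ bounded_linear_inner_left])
qed

end

context
  fixes M :: "('a, 'e::euclidean_space) manifold" and D :: "('a, 'e) connection" and U :: "'a set"
  assumes sm: "smooth_manifold M" and aff: "affine_connection M D" and U: "openin (mtop M) U"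
begin

text \<open>\<open>affine_connection\<close> puts one premise on \<open>X\<close>,
  \<open>X'\<close>, \<open>Y\<close>, \<open>Y'\<close> and \<open>f\<close> together. The single
  rules are extracted by repeating fields and, where a rule mentions no function, taking
  \<open>f\<close> to be zero.\<close>

lemma conn_smooth: "smooth_vf M U X \<Longrightarrow> smooth_vf M U Y \<Longrightarrow> smooth_vf M U (D X Y)"
  using aff[unfolded affine_connection_def, rule_format, of U X X Y Y "\<lambda>q. 0"] U smooth_fun_const[OF sm]
  by auto

lemma conn_add1:
  assumes "smooth_vf M U X" "smooth_vf M U X'" "smooth_vf M U Y" "p \<in> U"
  shows "D (\<lambda>q. X q + X' q) Y p = D X Y p + D X' Y p"
  using aff[unfolded affine_connection_def, rule_format, of U X X' Y Y "\<lambda>q. 0"] U smooth_fun_const[OF sm] assms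
  by auto

lemma conn_scaleR1:
  assumes "smooth_vf M U X" "smooth_vf M U Y" "smooth_fun M U f" "p \<in> U"
  shows "D (\<lambda>q. f q *\<^sub>R X q) Y p = f p *\<^sub>R D X Y p"
  using aff[unfolded affine_connection_def, rule_format, of U X X Y Y f] U assms by auto

lemma conn_add2:
  assumes "smooth_vf M U X" "smooth_vf M U Y" "smooth_vf M U Y'" "p \<in> U"
  shows "D X (\<lambda>q. Y q + Y' q) p = D X Y p + D X Y' p"
  using aff[unfolded affine_connection_def, rule_format, of U X X Y Y' "\<lambda>q. 0"] U smooth_fun_const[OF sm] assms
  by auto

lemma conn_scaleR2:
  assumes "smooth_vf M U X" "smooth_vf M U Y" "smooth_fun M U f" "p \<in> U"
  shows "D X (\<lambda>q. f q *\<^sub>R Y q) p = dir_deriv M X f p *\<^sub>R Y p + f p *\<^sub>R D X Y p"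
  using aff[unfolded affine_connection_def, rule_format, of U X X Y Y f] U assms by auto

lemma conn_cong:
  assumes "smooth_vf M U X" "smooth_vf M U Y" "\<And>q. q \<in> U \<Longrightarrow> X q = X' q" "\<And>q. q \<in> U \<Longrightarrow> Y q = Y' q" "p \<in> U"
  shows "D X Y p = D X' Y' p"
  using aff[unfolded affine_connection_def, rule_format, of U X X' Y Y' "\<lambda>q. 0"] U smooth_fun_const[OF sm] assms
    smooth_vf_cong[OF sm U assms(1,3)] smooth_vf_cong[OF sm U assms(2,4)]
  by auto

lemma dir_deriv_const: "dir_deriv M X (\<lambda>q. r) p = 0"
  by (simp add: dir_deriv_def comp_def)

lemma conn_cmul1:
  assumes "smooth_vf M U X" "smooth_vf M U Y" "p \<in> U"
  shows "D (\<lambda>q. r *\<^sub>R X q) Y p = r *\<^sub>R D X Y p"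
  by (rule conn_scaleR1[OF assms(1,2) smooth_fun_const[OF sm] assms(3)])

lemma conn_cmul2:
  assumes "smooth_vf M U X" "smooth_vf M U Y" "p \<in> U"
  shows "D X (\<lambda>q. r *\<^sub>R Y q) p = r *\<^sub>R D X Y p"
  using conn_scaleR2[OF assms(1,2) smooth_fun_const[OF sm] assms(3), of r] by (simp add: dir_deriv_const)

lemma conn_sum1:
  assumes "\<And>i. i \<in> I \<Longrightarrow> smooth_vf M U (E i)" "\<And>i. i \<in> I \<Longrightarrow> smooth_fun M U (f i)" "smooth_vf M U Y" "p \<in> U"
  shows "D (\<lambda>q. \<Sum>i\<in>I. f i q *\<^sub>R E i q) Y p = (\<Sum>i\<in>I. f i p *\<^sub>R D (E i) Y p)"
  using assms(1,2)
proof (induction I rule: infinite_finite_induct)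
  case (insert i I)
  have "smooth_vf M U (\<lambda>q. \<Sum>i\<in>I. f i q *\<^sub>R E i q)"
    using insert.prems by (intro smooth_vf_sum smooth_vf_scaleR sm U) auto
  with insert assms(3,4) show ?case
    by (simp add: conn_add1 conn_scaleR1 smooth_vf_scaleR[OF sm U])
\<comment> \<open>An empty or infinite index set leaves the zero field, treated here as 0 times
  \<open>Y\<close>.\<close>
qed (use conn_cmul1[OF assms(3,3,4), of 0] in auto)

lemma conn_sum2:
  assumes "\<And>i. i \<in> I \<Longrightarrow> smooth_vf M U (E i)" "\<And>i. i \<in> I \<Longrightarrow> smooth_fun M U (f i)" "smooth_vf M U X" "p \<in> U"
  shows "D X (\<lambda>q. \<Sum>i\<in>I. f i q *\<^sub>R E i q) p =
    (\<Sum>i\<in>I. dir_deriv M X (f i) p *\<^sub>R E i p + f i p *\<^sub>R D X (E i) p)"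
  using assms(1,2)
proof (induction I rule: infinite_finite_induct)
  case (insert i I)
  have "smooth_vf M U (\<lambda>q. \<Sum>i\<in>I. f i q *\<^sub>R E i q)"
    using insert.prems by (intro smooth_vf_sum smooth_vf_scaleR sm U) auto
  with insert assms(3,4) show ?case
    by (simp add: conn_add2 conn_scaleR2 smooth_vf_scaleR[OF sm U])
qed (use conn_cmul2[OF assms(3,3,4), of 0] in auto)

context
  fixes c :: "('a, 'e) chart"
  assumes c: "c \<in> atlas M" and Uc: "U \<subseteq> fst c"
begin

lemma linear_conn1:
  assumes "smooth_vf M U Y" "p \<in> U"
  shows "linear (\<lambda>a. D (coord_vf M c a) Y p)"
proof (rule linearI)
  note s = smooth_coord_vf[OF sm c U Uc]
  fix a b :: 'e and r :: real
  have "D (coord_vf M c (a + b)) Y p = D (\<lambda>q. coord_vf M c a q + coord_vf M c b q) Y p"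
    using Uc by (intro conn_cong s assms) (auto intro: linear_add[OF linear_coord_vf[OF sm c]])
  then show "D (coord_vf M c (a + b)) Y p = D (coord_vf M c a) Y p + D (coord_vf M c b) Y p"
    by (simp add: conn_add1[OF s s assms])
  have "D (coord_vf M c (r *\<^sub>R a)) Y p = D (\<lambda>q. r *\<^sub>R coord_vf M c a q) Y p"
    using Uc by (intro conn_cong s assms) (auto intro: linear_cmul[OF linear_coord_vf[OF sm c]])
  then show "D (coord_vf M c (r *\<^sub>R a)) Y p = r *\<^sub>R D (coord_vf M c a) Y p"
    by (simp add: conn_cmul1[OF s assms])
qed

lemma linear_conn2:
  assumes "smooth_vf M U X" "p \<in> U"
  shows "linear (\<lambda>a. D X (coord_vf M c a) p)"
proof (rule linearI)
  note s = smooth_coord_vf[OF sm c U Uc]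
  fix a b :: 'e and r :: real
  have "D X (coord_vf M c (a + b)) p = D X (\<lambda>q. coord_vf M c a q + coord_vf M c b q) p"
    using Uc by (intro conn_cong s assms) (auto intro: linear_add[OF linear_coord_vf[OF sm c]])
  then show "D X (coord_vf M c (a + b)) p = D X (coord_vf M c a) p + D X (coord_vf M c b) p"
    by (simp add: conn_add2[OF assms(1) s s assms(2)])
  have "D X (coord_vf M c (r *\<^sub>R a)) p = D X (\<lambda>q. r *\<^sub>R coord_vf M c a q) p"
    using Uc by (intro conn_cong s assms) (auto intro: linear_cmul[OF linear_coord_vf[OF sm c]])
  then show "D X (coord_vf M c (r *\<^sub>R a)) p = r *\<^sub>R D X (coord_vf M c a) p"
    by (simp add: conn_cmul2[OF assms(1) s assms(2)])
qed

lemma conn_tensorial1: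
  assumes X: "smooth_vf M U X" and Y: "smooth_vf M U Y" and p: "p \<in> U"
  shows "D X Y p = D (coord_vf M c (chart_coords M c p (X p))) Y p"
proof -
  note s = smooth_coord_vf[OF sm c U Uc]
  have "D X Y p = D (\<lambda>q. \<Sum>b\<in>Basis. (vf_rep M c X (snd c q) \<bullet> b) *\<^sub>R coord_vf M c b q) Y p"
    by (rule conn_cong[OF X Y vf_expand[OF sm U c Uc, of _ X] refl p])
  also have "\<dots> = (\<Sum>b\<in>Basis. (vf_rep M c X (snd c p) \<bullet> b) *\<^sub>R D (coord_vf M c b) Y p)"
    by (rule conn_sum1[OF s smooth_component[OF sm U c Uc X] Y p])
  also have "\<dots> = D (coord_vf M c (vf_rep M c X (snd c p))) Y p"
    by (rule linear_basis_expansion[OF linear_conn1[OF Y p], symmetric])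
  finally show ?thesis using p Uc by (simp add: vf_rep_snd[OF sm c] subsetD)
qed

end

end

context
  fixes M :: "('a, 'e::euclidean_space) manifold" and D :: "('a, 'e) connection" and U :: "'a set"
    and c :: "('a, 'e) chart" and p :: 'a and X Y :: "'a \<Rightarrow> 'e"
  assumes sm: "smooth_manifold M" and aff: "affine_connection M D" and U: "openin (mtop M) U"
    and X: "smooth_vf M U X" and Y: "smooth_vf M U Y" and c: "c \<in> atlas M" and p: "p \<in> U" "p \<in> fst c"
begin

text \<open>The Leibniz rule applied to the expansion of \<open>Y\<close> in coordinate fields:
  derivative of the components plus Christoffel symbols. As \<open>c\<close> is any chart around
  \<open>p\<close>, this also contains the transformation law of the Christoffel symbols.\<close>

lemma conn_chart:
  "D X Y p = coord_vf M c (frechet_derivative (vf_rep M c Y) (at (snd c p)) (chart_coords M c p (X p))) p +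
     D (coord_vf M c (chart_coords M c p (X p))) (coord_vf M c (chart_coords M c p (Y p))) p"
proof -
  define V where "V = U \<inter> fst c"
  have V: "openin (mtop M) V" "V \<subseteq> fst c" "p \<in> V"
    using U p openin_chart[OF sm c] by (auto simp: V_def)
  have XV: "smooth_vf M V X" and YV: "smooth_vf M V Y"
    using X Y smooth_vf_subset[OF sm] unfolding V_def by blast+
  note s = smooth_coord_vf[OF sm c V(1,2)]
  note sc = smooth_component[OF sm V(1) c V(2) YV]
  let ?y = "\<lambda>b q. vf_rep M c Y (snd c q) \<bullet> b"
  have dY: "vf_rep M c Y differentiable (at (snd c p))"
    using smooth_on_differentiable[OF smooth_vf_chart[OF sm c Y]] p by blast
  have dir: "dir_deriv M X (?y b) p =
      frechet_derivative (vf_rep M c Y) (at (snd c p)) (chart_coords M c p (X p)) \<bullet> b" for b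
  proof -
    have "frechet_derivative (?y b \<circ> chart_inv c) (at (snd c p)) =
        frechet_derivative (\<lambda>x. vf_rep M c Y x \<bullet> b) (at (snd c p))"
      by (rule frechet_derivative_cong_open[where S = "snd c ` V"])
        (use open_chart_image[OF sm c V(1)] V inj_chart[OF sm c] in \<open>auto simp: Int_absorb2 subset_iff\<close>)
    then show ?thesis
      using dir_deriv_chart[OF sm c p(2), of "?y b" X] smooth_fun_differentiable[OF sm c sc V(3) p(2), of b]
        frechet_derivative_inner[OF dY] by simp
  qed
  have "D X Y p = D X (\<lambda>q. \<Sum>b\<in>Basis. ?y b q *\<^sub>R coord_vf M c b q) p"
    by (rule conn_cong[OF sm aff V(1) XV YV refl vf_expand[OF sm V(1) c V(2), of _ Y] V(3)])
  also have "\<dots> = (\<Sum>b\<in>Basis. dir_deriv M X (?y b) p *\<^sub>R coord_vf M c b p + ?y b p *\<^sub>R D X (coord_vf M c b) p)"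
    by (rule conn_sum2[OF sm aff V(1) s sc XV V(3)])
  also have "\<dots> = (\<Sum>b\<in>Basis. dir_deriv M X (?y b) p *\<^sub>R coord_vf M c b p) +
      (\<Sum>b\<in>Basis. ?y b p *\<^sub>R D X (coord_vf M c b) p)"
    by (simp add: sum.distrib)
  also have "(\<Sum>b\<in>Basis. dir_deriv M X (?y b) p *\<^sub>R coord_vf M c b p) =
      coord_vf M c (frechet_derivative (vf_rep M c Y) (at (snd c p)) (chart_coords M c p (X p))) p"
    unfolding dir by (rule linear_basis_expansion[OF linear_coord_vf[OF sm c p(2)], symmetric])
  also have "(\<Sum>b\<in>Basis. ?y b p *\<^sub>R D X (coord_vf M c b) p) = D X (coord_vf M c (vf_rep M c Y (snd c p))) p"
    by (rule linear_basis_expansion[OF linear_conn2[OF sm aff V(1) c V(2) XV V(3)], symmetric])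
  also have "\<dots> = D (coord_vf M c (chart_coords M c p (X p))) (coord_vf M c (vf_rep M c Y (snd c p))) p"
    by (rule conn_tensorial1[OF sm aff V(1) c V(2) XV s V(3)])
  finally show ?thesis by (simp add: vf_rep_snd[OF sm c p(2)])
qed

end

section \<open>Curvature and the Levi-Civita connection\<close>

text \<open>In the preferred chart at \<open>p\<close> both fields have constant components. At
  other points the bracket is taken in other charts, so the claim concerns \<open>p\<close>
  alone.\<close>

lemma lie_bracket_const_vf:
  assumes sm: "smooth_manifold M" and p: "p \<in> points M"
  shows "lie_bracket M (const_vf M p u) (const_vf M p v) p = 0"
proof -
  let ?c = "chart_at M p"
  have c: "?c \<in> atlas M" "p \<in> fst ?c" using chart_at[OF sm p] by auto
  have "frechet_derivative (vf_rep M ?c (const_vf M p v)) (at (snd ?c p)) = frechet_derivative (\<lambda>x. v) (at (snd ?c p))" for v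
    by (rule frechet_derivative_cong_open[where S = "snd ?c ` fst ?c"])
      (use open_chart_image[OF sm c(1) openin_chart[OF sm c(1)]] c in
        \<open>auto simp: vf_rep_snd[OF sm] const_vf_eq chart_coords_coord_vf_self[OF sm]\<close>)
  then show ?thesis by (simp add: lie_bracket_def Let_def)
qed

lemma conn_const_vf_sym:
  assumes sm: "smooth_manifold M" and p: "p \<in> points M" and tf: "torsion_free M D"
  shows "D (const_vf M p u) (const_vf M p v) p = D (const_vf M p v) (const_vf M p u) p"
proof -
  have "openin (mtop M) (fst (chart_at M p))" "p \<in> fst (chart_at M p)"
    using openin_chart[OF sm] chart_at[OF sm p] by auto
  with tf smooth_const_vf[OF sm p] lie_bracket_const_vf[OF sm p, of u v] show ?thesis
    unfolding torsion_free_def by (metis eq_iff_diff_eq_0)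
qed

text \<open>The bracket is known to vanish at \<open>p\<close> only, so tensoriality in the first
  argument is used. That requires the bracket to be a smooth field, which is seen from its
  expression as \<open>D X Y - D Y X\<close> by torsion-freeness.\<close>

lemma conn_lie_bracket_const_vf:
  assumes sm: "smooth_manifold M" and p: "p \<in> points M" and aff: "affine_connection M D" and tf: "torsion_free M D"
  shows "D (lie_bracket M (const_vf M p u) (const_vf M p v)) (const_vf M p w) p = 0"
proof -
  let ?c = "chart_at M p" and ?B = "lie_bracket M (const_vf M p u) (const_vf M p v)"
  let ?U = "fst ?c"
  have c: "?c \<in> atlas M" "p \<in> ?U" and U: "openin (mtop M) ?U"
    using chart_at[OF sm p] openin_chart[OF sm] by auto
  note s = smooth_const_vf[OF sm p]
  have "smooth_vf M ?U (\<lambda>q. D (const_vf M p u) (const_vf M p v) q + (-1) *\<^sub>R D (const_vf M p v) (const_vf M p u) q)"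
    by (intro smooth_vf_add[OF sm U] smooth_vf_cmul[OF sm U] conn_smooth[OF sm aff U] s)
  then have B: "smooth_vf M ?U ?B"
    by (rule smooth_vf_cong[OF sm U]) (use tf U s in \<open>auto simp: torsion_free_def\<close>)
  have "D ?B (const_vf M p w) p = D (coord_vf M ?c (chart_coords M ?c p (?B p))) (const_vf M p w) p"
    by (rule conn_tensorial1[OF sm aff U c(1) order_refl B s c(2)])
  also have "chart_coords M ?c p (?B p) = 0"
    by (simp add: lie_bracket_const_vf[OF sm p] linear_0[OF linear_chart_coords[OF sm c]])
  also have "D (coord_vf M ?c 0) (const_vf M p w) p = 0"
    by (rule linear_0[OF linear_conn1[OF sm aff U c(1) order_refl s c(2)]])
  finally show ?thesis .
qed

lemma metric_bilinear:
  assumes "riemannian_metric M g" "p \<in> points M"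
  shows "bilinear (g p)" "g p u v = g p v u" "v \<noteq> 0 \<Longrightarrow> 0 < g p v v"
  using assms by (auto simp: riemannian_metric_def)

lemma dual_connectionsD:
  assumes "dual_connections M g D D'" "openin (mtop M) U"
    "smooth_vf M U X" "smooth_vf M U Y" "smooth_vf M U Z" "p \<in> U"
  shows "dir_deriv M X (\<lambda>q. g q (Y q) (Z q)) p = g p (D X Y p) (Z p) + g p (Y p) (D' X Z p)"
  using assms unfolding dual_connections_def by auto

text \<open>Moving the outer derivative to the dual connection leaves only first covariant derivatives.\<close>

lemma curvature_dual:
  assumes sm: "smooth_manifold M" and p: "p \<in> points M" and g: "riemannian_metric M g"
    and aff: "affine_connection M D" and tf: "torsion_free M D" and dual: "dual_connections M g D D'"
  shows "g p (curvature M D p u v w) z =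
     (dir_deriv M (const_vf M p u) (\<lambda>q. g q (D (const_vf M p v) (const_vf M p w) q) (const_vf M p z q)) p -
       g p (D (const_vf M p v) (const_vf M p w) p) (D' (const_vf M p u) (const_vf M p z) p)) -
     (dir_deriv M (const_vf M p v) (\<lambda>q. g q (D (const_vf M p u) (const_vf M p w) q) (const_vf M p z q)) p -
       g p (D (const_vf M p u) (const_vf M p w) p) (D' (const_vf M p v) (const_vf M p z) p))"
proof -
  let ?X = "const_vf M p" and ?U = "fst (chart_at M p)"
  have U: "p \<in> ?U" "openin (mtop M) ?U"
    using chart_at[OF sm p] openin_chart[OF sm] by auto
  note s = smooth_const_vf[OF sm p]
  have *: "g p (D (?X u) (D (?X v) (?X w)) p) z =
    dir_deriv M (?X u) (\<lambda>q. g q (D (?X v) (?X w) q) (?X z q)) p - g p (D (?X v) (?X w) p) (D' (?X u) (?X z) p)" for u v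
    using dual_connectionsD[OF dual U(2) s conn_smooth[OF sm aff U(2) s s] s U(1)] const_vf_at[OF sm p] by simp
  have "g p (curvature M D p u v w) z = g p (D (?X u) (D (?X v) (?X w)) p) z - g p (D (?X v) (D (?X u) (?X w)) p) z"
    using conn_lie_bracket_const_vf[OF sm p aff tf]
    by (simp add: curvature_def Let_def bilinear_lsub[OF metric_bilinear(1)[OF g p]])
  then show ?thesis unfolding * by simp
qed

text \<open>Symmetry of \<open>g\<close> exchanges the two summands of the duality identity. It
  holds at points of \<open>M\<close>, hence the comparison of derivatives on a chart
  domain.\<close>

lemma dual_connections_sym:
  assumes sm: "smooth_manifold M" and g: "riemannian_metric M g" and d: "dual_connections M g D D'"
  shows "dual_connections M g D' D"
  unfolding dual_connections_def
proof (intro allI impI ballI, elim conjE)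
  fix U X Y Z p assume U: "openin (mtop M) U" "smooth_vf M U X" "smooth_vf M U Y" "smooth_vf M U Z" "p \<in> U"
  then have inp: "p \<in> points M" using openin_subset by blast
  let ?c = "chart_at M p"
  have c: "?c \<in> atlas M" "p \<in> fst ?c" using chart_at[OF sm inp] by auto
  have eq: "frechet_derivative ((\<lambda>q. g q (Y q) (Z q)) \<circ> chart_inv ?c) (at (snd ?c p)) =
     frechet_derivative ((\<lambda>q. g q (Z q) (Y q)) \<circ> chart_inv ?c) (at (snd ?c p))"
    by (rule frechet_derivative_cong_open[where S = "snd ?c ` fst ?c"])
      (use open_chart_image[OF sm c(1) openin_chart[OF sm c(1)]] c in
        \<open>auto simp: inj_chart[OF sm] intro!: metric_bilinear(2)[OF g] chart_points[OF sm]\<close>)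
  have "dir_deriv M X (\<lambda>q. g q (Y q) (Z q)) p = dir_deriv M X (\<lambda>q. g q (Z q) (Y q)) p"
    unfolding dir_deriv_def using eq by simp
  also have "\<dots> = g p (D X Z p) (Y p) + g p (Z p) (D' X Y p)"
    using d U by (auto simp: dual_connections_def)
  finally show "dir_deriv M X (\<lambda>q. g q (Y q) (Z q)) p = g p (D' X Y p) (Z p) + g p (Y p) (D X Z p)"
    by (simp add: metric_bilinear(2)[OF g inp, of "Z p"] metric_bilinear(2)[OF g inp, of _ "Y p"])
qed

section \<open>The Levi-Civita connection as the mean of dual connections\<close>

definition mean_conn :: "('a, 'e::euclidean_space) connection \<Rightarrow> ('a, 'e) connection \<Rightarrow> ('a, 'e) connection" where
  "mean_conn D D' X Y p = (1 / 2) *\<^sub>R (D X Y p + D' X Y p)"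

lemma affine_mean_conn:
  assumes sm: "smooth_manifold M" and D: "affine_connection M D" and D': "affine_connection M D'"
  shows "affine_connection M (mean_conn D D')"
  unfolding affine_connection_def
proof (intro allI impI, elim conjE)
  fix U X X' Y Y' f
  assume U: "openin (mtop M) U" and X: "smooth_vf M U X" "smooth_vf M U X'"
    and Y: "smooth_vf M U Y" "smooth_vf M U Y'" and f: "smooth_fun M U f"
  note d = conn_smooth[OF sm D U] conn_smooth[OF sm D' U]
  have 1: "smooth_vf M U (mean_conn D D' X Y)"
    unfolding mean_conn_def[abs_def] using d X Y by (intro smooth_vf_cmul smooth_vf_add sm U) auto
  show "smooth_vf M U (mean_conn D D' X Y) \<and>
       (\<forall>p\<in>U. mean_conn D D' (\<lambda>q. X q + X' q) Y p = mean_conn D D' X Y p + mean_conn D D' X' Y p) \<and>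
       (\<forall>p\<in>U. mean_conn D D' (\<lambda>q. f q *\<^sub>R X q) Y p = f p *\<^sub>R mean_conn D D' X Y p) \<and>
       (\<forall>p\<in>U. mean_conn D D' X (\<lambda>q. Y q + Y' q) p = mean_conn D D' X Y p + mean_conn D D' X Y' p) \<and>
       (\<forall>p\<in>U. mean_conn D D' X (\<lambda>q. f q *\<^sub>R Y q) p = dir_deriv M X f p *\<^sub>R Y p + f p *\<^sub>R mean_conn D D' X Y p) \<and>
       ((\<forall>q\<in>U. X q = X' q \<and> Y q = Y' q) \<longrightarrow> (\<forall>p\<in>U. mean_conn D D' X Y p = mean_conn D D' X' Y' p))"
  proof (intro conjI 1 ballI impI)
    fix p assume p: "p \<in> U"
    show "mean_conn D D' (\<lambda>q. X q + X' q) Y p = mean_conn D D' X Y p + mean_conn D D' X' Y p"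
      using conn_add1[OF sm D U X Y(1) p] conn_add1[OF sm D' U X Y(1) p]
      by (simp add: mean_conn_def scaleR_add_right)
    show "mean_conn D D' (\<lambda>q. f q *\<^sub>R X q) Y p = f p *\<^sub>R mean_conn D D' X Y p"
      using conn_scaleR1[OF sm D U X(1) Y(1) f p] conn_scaleR1[OF sm D' U X(1) Y(1) f p]
      by (simp add: mean_conn_def scaleR_add_right)
    show "mean_conn D D' X (\<lambda>q. Y q + Y' q) p = mean_conn D D' X Y p + mean_conn D D' X Y' p"
      using conn_add2[OF sm D U X(1) Y p] conn_add2[OF sm D' U X(1) Y p]
      by (simp add: mean_conn_def scaleR_add_right)
    show "mean_conn D D' X (\<lambda>q. f q *\<^sub>R Y q) p = dir_deriv M X f p *\<^sub>R Y p + f p *\<^sub>R mean_conn D D' X Y p"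
      using conn_scaleR2[OF sm D U X(1) Y(1) f p] conn_scaleR2[OF sm D' U X(1) Y(1) f p]
      by (simp add: mean_conn_def algebra_simps flip: scaleR_add_left)
  next
    fix p assume p: "p \<in> U" and eq: "\<forall>q\<in>U. X q = X' q \<and> Y q = Y' q"
    then show "mean_conn D D' X Y p = mean_conn D D' X' Y' p"
      using conn_cong[OF sm D U X(1) Y(1), of X' Y' p] conn_cong[OF sm D' U X(1) Y(1), of X' Y' p]
      by (simp add: mean_conn_def)
  qed
qed

text \<open>Averaging the duality identities of the pair and of the swapped pair makes the mean
  metric. This provides the existence behind the choice in \<open>LC\<close>.\<close>

lemma levi_civita_mean_conn:
  assumes "statistical_manifold M g D D'"
  shows "levi_civita M g (mean_conn D D')"
proof -
  have sm: "smooth_manifold M" and g: "riemannian_metric M g" and D: "affine_connection M D" "torsion_free M D"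
    and D': "affine_connection M D'" "torsion_free M D'" and dual: "dual_connections M g D D'"
    using assms by (auto simp: statistical_manifold_def)
  note dual' = dual_connections_sym[OF sm g dual]
  have "torsion_free M (mean_conn D D')"
    unfolding torsion_free_def
  proof (intro allI impI ballI, elim conjE)
    fix U X Y p assume U: "openin (mtop M) U" "smooth_vf M U X" "smooth_vf M U Y" "p \<in> U"
    have "D X Y p - D Y X p = lie_bracket M X Y p" "D' X Y p - D' Y X p = lie_bracket M X Y p"
      using U D(2) D'(2) by (auto simp: torsion_free_def)
    then show "mean_conn D D' X Y p - mean_conn D D' Y X p = lie_bracket M X Y p"
      by (simp add: mean_conn_def flip: scaleR_diff_right) (simp add: algebra_simps scaleR_half_double flip: scaleR_add_left)
  qed
  moreover have "dual_connections M g (mean_conn D D') (mean_conn D D')"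
    unfolding dual_connections_def
  proof (intro allI impI ballI, elim conjE)
    fix U X Y Z p assume U: "openin (mtop M) U" "smooth_vf M U X" "smooth_vf M U Y" "smooth_vf M U Z" "p \<in> U"
    then have b: "bilinear (g p)" using openin_subset metric_bilinear(1)[OF g] by blast
    have "dir_deriv M X (\<lambda>q. g q (Y q) (Z q)) p = g p (D X Y p) (Z p) + g p (Y p) (D' X Z p)"
      "dir_deriv M X (\<lambda>q. g q (Y q) (Z q)) p = g p (D' X Y p) (Z p) + g p (Y p) (D X Z p)"
      using U dual dual' by (auto simp: dual_connections_def)
    then show "dir_deriv M X (\<lambda>q. g q (Y q) (Z q)) p =
        g p (mean_conn D D' X Y p) (Z p) + g p (Y p) (mean_conn D D' X Z p)"
      by (simp add: mean_conn_def bilinear_lmul[OF b] bilinear_rmul[OF b] bilinear_ladd[OF b] bilinear_radd[OF b] field_simps)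
  qed
  ultimately show ?thesis
    using affine_mean_conn[OF sm D(1) D'(1)] by (simp add: levi_civita_def)
qed

text \<open>The difference \<open>A\<close> of the two connections is symmetric by torsion-freeness,
  and \<open>g p (A X Y) (Z p)\<close> is skew in \<open>Y\<close> and \<open>Z\<close> by
  metricity. Three swaps of each kind, in alternation, restore the expression with the opposite
  sign.\<close>

lemma levi_civita_unique:
  assumes sm: "smooth_manifold M" and g: "riemannian_metric M g"
    and D: "levi_civita M g D" and D': "levi_civita M g D'"
    and U: "openin (mtop M) U" and X: "smooth_vf M U X" and Y: "smooth_vf M U Y" and p: "p \<in> U"
  shows "D X Y p = D' X Y p"
proof -
  have inp: "p \<in> points M" using U p openin_subset by blast
  let ?c = "chart_at M p"
  define V where "V = U \<inter> fst ?c"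
  have V: "openin (mtop M) V" "p \<in> V" "V \<subseteq> fst ?c" "V \<subseteq> U"
    using U p openin_chart[OF sm chart_at(1)[OF sm inp]] chart_at[OF sm inp] by (auto simp: V_def)
  note b = metric_bilinear[OF g inp]
  define A where "A X Y = D X Y p - D' X Y p" for X Y
  have sym: "A X Y = A Y X" if "smooth_vf M V X" "smooth_vf M V Y" for X Y
  proof -
    have "D X Y p - D Y X p = lie_bracket M X Y p" "D' X Y p - D' Y X p = lie_bracket M X Y p"
      using D D' V that unfolding levi_civita_def torsion_free_def by blast+
    then show ?thesis unfolding A_def by (simp add: algebra_simps)
  qed
  have skew: "g p (A X Y) (Z p) = - g p (A X Z) (Y p)"
    if s: "smooth_vf M V X" "smooth_vf M V Y" "smooth_vf M V Z" for X Y Z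
  proof -
    have "dir_deriv M X (\<lambda>q. g q (Y q) (Z q)) p = g p (D X Y p) (Z p) + g p (Y p) (D X Z p)"
      "dir_deriv M X (\<lambda>q. g q (Y q) (Z q)) p = g p (D' X Y p) (Z p) + g p (Y p) (D' X Z p)"
      using D D' by (auto simp: levi_civita_def intro!: dual_connectionsD[OF _ V(1) s V(2)])
    then show ?thesis
      unfolding A_def bilinear_lsub[OF b(1)] by (simp add: b(2)[of "Y p"])
  qed
  have s: "smooth_vf M V X" "smooth_vf M V Y" using X Y V(4) smooth_vf_subset[OF sm] by auto
  \<comment> \<open>Testing against an extension of \<open>A X Y\<close> itself turns the conclusion
    into one about its squared length. Since the argument is carried out with fields, tensoriality
    of \<open>A\<close> never has to be proved.\<close>
  let ?Z = "const_vf M p (A X Y)"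
  have z: "smooth_vf M V ?Z" using smooth_vf_subset[OF sm smooth_const_vf[OF sm inp] V(3)] .
  have "g p (A X Y) (A X Y) = g p (A X Y) (?Z p)" by (simp add: const_vf_at[OF sm inp])
  also have "\<dots> = - g p (A X ?Z) (Y p)" by (rule skew[OF s z])
  also have "\<dots> = - g p (A ?Z X) (Y p)" by (simp only: sym[OF s(1) z])
  also have "\<dots> = g p (A ?Z Y) (X p)" by (simp only: skew[OF z s] minus_minus)
  also have "\<dots> = g p (A Y ?Z) (X p)" by (simp only: sym[OF z s(2)])
  also have "\<dots> = - g p (A Y X) (?Z p)" by (rule skew[OF s(2) z s(1)])
  also have "\<dots> = - g p (A X Y) (A X Y)" by (simp only: sym[OF s] const_vf_at[OF sm inp])
  finally have "g p (A X Y) (A X Y) = 0" by simp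
  then have "A X Y = 0" using b(3)[of "A X Y"] by fastforce
  then show ?thesis by (simp add: A_def)
qed

lemma LC_mean_conn:
  assumes st: "statistical_manifold M g D D'"
  shows "levi_civita M g (LC M g)"
    and "openin (mtop M) U \<Longrightarrow> smooth_vf M U X \<Longrightarrow> smooth_vf M U Y \<Longrightarrow> p \<in> U \<Longrightarrow> LC M g X Y p = mean_conn D D' X Y p"
proof -
  note lc = levi_civita_mean_conn[OF st]
  show LC: "levi_civita M g (LC M g)" unfolding LC_def by (rule someI[where P = "levi_civita M g", OF lc])
  show "openin (mtop M) U \<Longrightarrow> smooth_vf M U X \<Longrightarrow> smooth_vf M U Y \<Longrightarrow> p \<in> U \<Longrightarrow> LC M g X Y p = mean_conn D D' X Y p"
    using levi_civita_unique[OF _ _ LC lc] st by (auto simp: statistical_manifold_def)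
qed

section \<open>Second fundamental form in coordinates\<close>

definition inner_product :: "('e::real_vector \<Rightarrow> 'e \<Rightarrow> real) \<Rightarrow> bool" where
  "inner_product h \<longleftrightarrow> bilinear h \<and> (\<forall>u v. h u v = h v u) \<and> (\<forall>v. v \<noteq> 0 \<longrightarrow> 0 < h v v)"

lemma inner_product_metric: "riemannian_metric M g \<Longrightarrow> p \<in> points M \<Longrightarrow> inner_product (g p)"
  by (auto simp: inner_product_def riemannian_metric_def)

lemma
  assumes "inner_product h"
  shows inner_product_bilinear: "bilinear h" and inner_product_sym: "h u v = h v u"
    and inner_product_eq_0: "h v v = 0 \<longleftrightarrow> v = 0" and inner_product_nonneg: "0 \<le> h v v"
proof -
  show b: "bilinear h" and "h u v = h v u" using assms by (auto simp: inner_product_def)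
  show "h v v = 0 \<longleftrightarrow> v = 0" "0 \<le> h v v"
    using assms bilinear_lzero[OF b, of 0] unfolding inner_product_def
    by (cases "v = 0"; fastforce intro: less_imp_le)+
qed

text \<open>Riesz representation for \<open>h\<close>. The map \<open>T\<close> collects the values
  of \<open>h u\<close> on \<open>Basis\<close>; definiteness makes it injective, hence surjective
  in finite dimension.\<close>

lemma inner_product_represents:
  fixes h :: "'e::euclidean_space \<Rightarrow> 'e \<Rightarrow> real"
  assumes h: "inner_product h" and f: "linear f"
  shows "\<exists>u. \<forall>v. h u v = f v"
proof -
  note b = inner_product_bilinear[OF h]
  define T where "T u = (\<Sum>b\<in>Basis. h u b *\<^sub>R b)" for u
  have comp: "T u \<bullet> b = h u b" if "b \<in> Basis" for u b
    unfolding T_def using that by (simp add: inner_sum_left inner_Basis if_distrib cong: if_cong)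
  have lin: "linear T"
    by (rule linearI) (simp_all add: T_def bilinear_ladd[OF b] bilinear_lmul[OF b] scaleR_add_left sum.distrib scaleR_sum_right)
  have l2: "linear (h u)" for u using b by (simp add: bilinear_def)
  have "u = 0" if "T u = 0" for u
  proof -
    have "h u b = 0" if "b \<in> Basis" for b using comp[OF that, of u] \<open>T u = 0\<close> by simp
    then have "h u u = 0" unfolding linear_basis_expansion[OF l2, of u u] by simp
    then show ?thesis by (simp add: inner_product_eq_0[OF h])
  qed
  then have "inj T" using lin linear_injective_0 by blast
  then have "surj T" using linear_injective_imp_surjective[OF lin] by blast
  then obtain u where u: "T u = (\<Sum>b\<in>Basis. f b *\<^sub>R b)" by (metis surjD)
  have "h u b = f b" if "b \<in> Basis" for b
    using comp[OF that, of u] that unfolding u by (simp add: inner_sum_left inner_Basis if_distrib cong: if_cong)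
  then have "h u v = f v" for v
    unfolding linear_basis_expansion[OF l2, of u v] linear_basis_expansion[OF f, of v] by (simp cong: sum.cong)
  then show ?thesis by blast
qed

text \<open>Representing the functional that sends \<open>X\<close> to \<open>- h (A X) Y\<close>
  gives existence, and definiteness of \<open>h\<close> gives uniqueness, so the definite
  description is justified.\<close>

lemma conj_endo:
  fixes h :: "'e::euclidean_space \<Rightarrow> 'e \<Rightarrow> real"
  assumes h: "inner_product h" and A: "linear A"
  shows "h (A X) Y + h X (conj_endo h A Y) = 0"
proof -
  note b = inner_product_bilinear[OF h]
  have "\<exists>Z. \<forall>X. h Z X = - h (A X) Y" for Y
  proof (rule inner_product_represents[OF h])
    show "linear (\<lambda>X. - h (A X) Y)"
      by (rule linearI) (simp_all add: linear_add[OF A] linear_cmul[OF A] bilinear_ladd[OF b] bilinear_lmul[OF b])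
  qed
  then obtain B where B: "\<And>X Y. h (B Y) X = - h (A X) Y" by metis
  have B': "\<forall>X Y. h (A X) Y + h X (B Y) = 0"
    by (simp add: B inner_product_sym[OF h, of _ "B _"])
  have "C = B" if C: "\<forall>X Y. h (A X) Y + h X (C Y) = 0" for C
  proof
    fix Y
    have "h X (C Y - B Y) = 0" for X
      using C B' by (simp add: bilinear_rsub[OF b]) (metis add_left_cancel)
    then show "C Y = B Y" using inner_product_eq_0[OF h] by (metis eq_iff_diff_eq_0)
  qed
  then show ?thesis
    unfolding conj_endo_def
    using theI[where P = "\<lambda>B. \<forall>X Y. h (A X) Y + h X (B Y) = 0", OF B'] by blast
qed

section \<open>Product rules and second-order transformation laws\<close>

lemma has_derivative_bilinear_apply:
  fixes B :: "'d::euclidean_space \<Rightarrow> 'e::euclidean_space \<Rightarrow> 'f::euclidean_space \<Rightarrow> 'g::real_normed_vector"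
  assumes S: "open S" "x \<in> S" and lin: "\<And>y. y \<in> S \<Longrightarrow> bilinear (B y)"
    and B: "\<And>v w. ((\<lambda>y. B y v w) has_derivative (\<lambda>h. B' h v w)) (at x)"
    and a: "(a has_derivative a') (at x)" and b: "(b has_derivative b') (at x)"
  shows "((\<lambda>y. B y (a y) (b y)) has_derivative
     (\<lambda>h. B' h (a x) (b x) + B x (a x) (b' h) + B x (a' h) (b x))) (at x)"
proof -
  have 1: "((\<lambda>y. B y v (b y)) has_derivative (\<lambda>h. B' h v (b x) + B x v (b' h))) (at x)" for v
    using lin by (intro has_derivative_linear_apply[OF S _ B b]) (auto simp: bilinear_def)
  show ?thesis
    using lin by (intro has_derivative_linear_apply[OF S _ 1 a]) (auto simp: bilinear_def)
qed

lemma has_derivative_trilinear_apply: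
  fixes B :: "'d::euclidean_space \<Rightarrow> 'e::euclidean_space \<Rightarrow> 'f::euclidean_space \<Rightarrow> 'k::euclidean_space \<Rightarrow> 'g::real_normed_vector"
  assumes S: "open S" "x \<in> S" and lin: "\<And>y v. y \<in> S \<Longrightarrow> bilinear (B y v)"
    and lin1: "\<And>y v w. y \<in> S \<Longrightarrow> linear (\<lambda>u. B y u v w)"
    and B: "\<And>u v w. ((\<lambda>y. B y u v w) has_derivative (\<lambda>h. B' h u v w)) (at x)"
    and a: "(a has_derivative a') (at x)" and b: "(b has_derivative b') (at x)" and c: "(c has_derivative c') (at x)"
  shows "((\<lambda>y. B y (a y) (b y) (c y)) has_derivative
     (\<lambda>h. B' h (a x) (b x) (c x) + B x (a x) (b x) (c' h) + B x (a x) (b' h) (c x) + B x (a' h) (b x) (c x))) (at x)"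
  by (intro has_derivative_linear_apply[OF S lin1 has_derivative_bilinear_apply[OF S lin B b c] a])

lemma open_submanifold_chart_image:
  assumes sub: "submanifold M N" and c: "c \<in> atlas M" and V: "openin (mtop N) V"
  shows "open (snd c ` (fst c \<inter> V))"
proof -
  have M: "smooth_manifold M" and cm: "continuous_map (mtop M) (mtop N) (\<lambda>p. p)"
    using sub by (auto simp: submanifold_def)
  have "openin (mtop M) {p \<in> points M. p \<in> V}"
    using openin_continuous_map_preimage[OF cm V] .
  from open_chart_image[OF M c this] show ?thesis
    by (rule back_subst[where P = "open"]) (use chart_points[OF M c] in auto)
qed

text \<open>Second-order chain rule. The summand with the second derivative of the transition from
  \<open>d\<close> to \<open>e\<close> measures the failure of a Hessian to be a tensor.\<close>

lemma second_derivative_transition: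
  assumes cd: "compat c d" and de: "compat d e" and op: "open (snd c ` (fst c \<inter> (fst d \<inter> fst e)))"
    and ce: "compat c e" and r: "r \<in> fst c" "r \<in> fst d" "r \<in> fst e"
  shows "second_derivative (snd e \<circ> chart_inv c) (snd c r) v w =
    second_derivative (snd e \<circ> chart_inv d) (snd d r) (chart_deriv c d r v) (chart_deriv c d r w) +
    chart_deriv d e r (second_derivative (snd d \<circ> chart_inv c) (snd c r) v w)"
proof -
  let ?S = "snd c ` (fst c \<inter> (fst d \<inter> fst e))"
  let ?cd = "snd d \<circ> chart_inv c" and ?de = "snd e \<circ> chart_inv d" and ?x = "snd c r"
  have S: "open ?S" "?x \<in> ?S" using op r by auto
  have inj: "inj_on (snd c) (fst c)" "inj_on (snd d) (fst d)" using cd by (auto simp: compat_def)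
  have x: "?cd ?x = snd d r" using inj r by simp
  have s_cd: "smooth_on (snd c ` (fst c \<inter> fst d)) ?cd" and s_de: "smooth_on (snd d ` (fst d \<inter> fst e)) ?de"
    using cd de by (auto simp: compat_def)
  have "((\<lambda>y. frechet_derivative ?de (at (?cd y)) (frechet_derivative ?cd (at y) w)) has_derivative
    (\<lambda>h. second_derivative ?de (snd d r) (chart_deriv c d r h) (frechet_derivative ?cd (at ?x) w) +
       frechet_derivative ?de (at (?cd ?x)) (second_derivative ?cd ?x h w))) (at ?x)"
  proof (rule has_derivative_linear_apply[where B = "\<lambda>y. frechet_derivative ?de (at (?cd y))"
        and B' = "\<lambda>h. second_derivative ?de (snd d r) (chart_deriv c d r h)"
        and a = "\<lambda>y. frechet_derivative ?cd (at y) w" and a' = "\<lambda>h. second_derivative ?cd ?x h w", OF S])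
    show "linear (frechet_derivative ?de (at (?cd y)))" if "y \<in> ?S" for y
      using that inj by (auto intro!: linear_frechet_derivative smooth_on_differentiable[OF s_de])
    show "((\<lambda>y. frechet_derivative ?de (at (?cd y)) v) has_derivative
        (\<lambda>h. second_derivative ?de (snd d r) (chart_deriv c d r h) v)) (at ?x)" for v
    proof -
      have "(\<lambda>z. frechet_derivative ?de (at z) v) differentiable (at (snd d r))"
        using r by (auto intro!: smooth_on_differentiable[OF smooth_on_frechet[OF s_de]])
      then have "((\<lambda>z. frechet_derivative ?de (at z) v) has_derivative
         frechet_derivative (\<lambda>y. frechet_derivative ?de (at y) v) (at (snd d r))) (at (?cd ?x))"
        unfolding x frechet_derivative_works .
      from has_derivative_compose[OF compat_has_derivative[OF cd r(1,2)] this] show ?thesis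
        unfolding second_derivative_def .
    qed
    have "(\<lambda>z. frechet_derivative ?cd (at z) w) differentiable (at ?x)"
      using r by (auto intro!: smooth_on_differentiable[OF smooth_on_frechet[OF s_cd]])
    then show "((\<lambda>y. frechet_derivative ?cd (at y) w) has_derivative (\<lambda>h. second_derivative ?cd ?x h w)) (at ?x)"
      unfolding second_derivative_def frechet_derivative_works .
  qed
  then have "((\<lambda>y. frechet_derivative (snd e \<circ> chart_inv c) (at y) w) has_derivative
    (\<lambda>h. second_derivative ?de (snd d r) (chart_deriv c d r h) (chart_deriv c d r w) +
       chart_deriv d e r (second_derivative ?cd ?x h w))) (at ?x)"
    unfolding chart_deriv_def[symmetric] x
  proof (rule has_derivative_transform_within_open[OF _ S])
    fix y assume "y \<in> ?S"
    then obtain q where q: "y = snd c q" "q \<in> fst c" "q \<in> fst d" "q \<in> fst e" by auto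
    then show "frechet_derivative ?de (at (?cd y)) (frechet_derivative ?cd (at y) w) =
        frechet_derivative (snd e \<circ> chart_inv c) (at y) w"
      using chart_deriv_comp[OF cd de q(2-4), of w] inj by (simp add: chart_deriv_def)
  qed
  from fun_cong[OF frechet_derivative_at[OF this], of v] show ?thesis
    by (simp only: second_derivative_def[of "snd e \<circ> chart_inv c"])
qed

text \<open>A field with constant components in \<open>d\<close> has varying components in
  \<open>e\<close>; their derivative is the inhomogeneous term in the transformation law of
  Christoffel symbols.\<close>

lemma frechet_derivative_vf_rep_coord_vf:
  assumes sm: "smooth_manifold N" and d: "d \<in> atlas N" "r \<in> fst d" and e: "e \<in> atlas N" "r \<in> fst e"
  shows "frechet_derivative (vf_rep N e (coord_vf N d b)) (at (snd e r)) (chart_deriv d e r a) =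
    second_derivative (snd e \<circ> chart_inv d) (snd d r) a b"
proof -
  let ?S = "snd e ` (fst e \<inter> fst d)"
  let ?G = "\<lambda>z. frechet_derivative (snd e \<circ> chart_inv d) (at z) b"
  have de: "compat d e" and ed: "compat e d" and dd: "compat d d" using compat_atlas[OF sm] d e by auto
  have S: "open ?S" "snd e r \<in> ?S" using ed d e by (auto simp: compat_def)
  have inj: "inj_on (snd d) (fst d)" "inj_on (snd e) (fst e)" using de by (auto simp: compat_def)
  have "?G differentiable (at (snd d r))"
    using d e de by (auto simp: compat_def intro!: smooth_on_differentiable smooth_on_frechet)
  then have G: "(?G has_derivative frechet_derivative ?G (at (snd d r))) (at ((snd d \<circ> chart_inv e) (snd e r)))"
    using inj e by (simp add: frechet_derivative_works)
  have "((\<lambda>y. ?G ((snd d \<circ> chart_inv e) y)) has_derivative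
      (\<lambda>h. second_derivative (snd e \<circ> chart_inv d) (snd d r) (chart_deriv e d r h) b)) (at (snd e r))"
    unfolding second_derivative_def
    by (rule has_derivative_compose[OF compat_has_derivative[OF ed e(2) d(2)] G])
  then have "(vf_rep N e (coord_vf N d b) has_derivative
      (\<lambda>h. second_derivative (snd e \<circ> chart_inv d) (snd d r) (chart_deriv e d r h) b)) (at (snd e r))"
  proof (rule has_derivative_transform_within_open[OF _ S])
    fix y assume "y \<in> ?S"
    then obtain q where q: "y = snd e q" "q \<in> fst e" "q \<in> fst d" by auto
    then show "?G ((snd d \<circ> chart_inv e) y) = vf_rep N e (coord_vf N d b) y"
      using chart_coords_coord_vf[OF sm d(1) e(1) q(3,2)] inj by (simp add: vf_rep_def chart_deriv_def)
  qed
  from frechet_derivative_at[OF this]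
  have "frechet_derivative (vf_rep N e (coord_vf N d b)) (at (snd e r)) (chart_deriv d e r a) =
     second_derivative (snd e \<circ> chart_inv d) (snd d r) (chart_deriv e d r (chart_deriv d e r a)) b" by metis
  then show ?thesis
    using chart_deriv_comp[OF de ed d(2) e(2) d(2)] chart_deriv_self[OF dd d(2)] by simp
qed

lemma incl_deriv_coord_vf:
  assumes sub: "submanifold M N" and c: "c \<in> atlas M" "r \<in> fst c"
  shows "incl_deriv M N r (coord_vf M c w r) = chart_deriv c (chart_at N r) r w"
    and "e \<in> atlas N \<Longrightarrow> r \<in> fst e \<Longrightarrow> coord_vf N e (chart_deriv c e r w) r = chart_deriv c (chart_at N r) r w"
proof -
  have M: "smooth_manifold M" and N: "smooth_manifold N" and "points M \<subseteq> points N"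
    using sub by (auto simp: submanifold_def)
  then have r: "r \<in> points M" "r \<in> points N" using chart_points[OF M c] by auto
  show "incl_deriv M N r (coord_vf M c w r) = chart_deriv c (chart_at N r) r w"
    unfolding incl_deriv_eq coord_vf_def
    using c chart_at[OF M r(1)] chart_at[OF N r(2)]
    by (intro chart_deriv_comp compat_atlas[OF M] compat_submanifold[OF sub]) auto
  show "e \<in> atlas N \<Longrightarrow> r \<in> fst e \<Longrightarrow> coord_vf N e (chart_deriv c e r w) r = chart_deriv c (chart_at N r) r w"
    unfolding coord_vf_def
    using c chart_at[OF N r(2)]
    by (intro chart_deriv_comp compat_atlas[OF N] compat_submanifold[OF sub]) auto
qed

text \<open>\<open>cov_along\<close> refers to the preferred charts at \<open>r\<close>, which jump
  with \<open>r\<close>. To differentiate it along \<open>M\<close>, an expression in charts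
  \<open>c\<close> and \<open>e\<close> that stay fixed is required.\<close>

lemma cov_along_chart:
  assumes sub: "submanifold M N" and aff: "affine_connection N D" and c: "c \<in> atlas M" "r \<in> fst c"
    and e: "e \<in> atlas N" "r \<in> fst e"
  shows "cov_along M N D r (coord_vf M c v r) (\<lambda>q. incl_deriv M N q (coord_vf M c w q)) =
     coord_vf N e (second_derivative (snd e \<circ> chart_inv c) (snd c r) v w) r +
     D (coord_vf N e (chart_deriv c e r v)) (coord_vf N e (chart_deriv c e r w)) r"
proof -
  have M: "smooth_manifold M" and N: "smooth_manifold N" and sub': "points M \<subseteq> points N"
    using sub by (auto simp: submanifold_def)
  have r: "r \<in> points M" "r \<in> points N" using chart_points[OF M c] sub' by auto
  define b where "b = chart_at M r"
  define d where "d = chart_at N r"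
  have b: "b \<in> atlas M" "r \<in> fst b" and d: "d \<in> atlas N" "r \<in> fst d"
    using chart_at[OF M r(1)] chart_at[OF N r(2)] by (auto simp: b_def d_def)
  note cM = compat_atlas[OF M] and cN = compat_atlas[OF N] and cMN = compat_submanifold[OF sub]
  have inj: "inj_on (snd b) (fst b)" "inj_on (snd c) (fst c)"
    using inj_chart[OF M] b c by auto
  let ?u = "coord_vf M c v r" and ?G = "\<lambda>y. frechet_derivative (snd d \<circ> chart_inv c) (at y) w"
  let ?f = "\<lambda>x. let q = chart_inv b x in chart_coords N d q (incl_deriv M N q (coord_vf M c w q))"
  have first: "frechet_derivative ?f (at (snd b r)) ?u = second_derivative (snd d \<circ> chart_inv c) (snd c r) v w"
  proof -
    let ?S = "snd b ` (fst b \<inter> (fst c \<inter> fst d))"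
    have "openin (mtop M) (fst c \<inter> {p \<in> points M. p \<in> fst d})"
      using openin_chart[OF M c(1)] openin_continuous_map_preimage[OF _ openin_chart[OF N d(1)]] sub
      by (auto simp: submanifold_def)
    from open_chart_image[OF M b(1) this] have "open ?S"
      by (rule back_subst[where P = "open"]) (use chart_points[OF M b(1)] in auto)
    then have S: "open ?S" "snd b r \<in> ?S" using b c d by auto
    have "?G differentiable (at (snd c r))"
      using c d cMN[OF c(1) d(1)] by (auto simp: compat_def intro!: smooth_on_differentiable smooth_on_frechet)
    then have G: "(?G has_derivative frechet_derivative ?G (at (snd c r))) (at ((snd c \<circ> chart_inv b) (snd b r)))"
      using inj b by (simp add: frechet_derivative_works)
    have "((\<lambda>y. ?G ((snd c \<circ> chart_inv b) y)) has_derivative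
        (\<lambda>h. second_derivative (snd d \<circ> chart_inv c) (snd c r) (chart_deriv b c r h) w)) (at (snd b r))"
      unfolding second_derivative_def
      by (rule has_derivative_compose[OF compat_has_derivative[OF cM[OF b(1) c(1)] b(2) c(2)] G])
    then have "(?f has_derivative
        (\<lambda>h. second_derivative (snd d \<circ> chart_inv c) (snd c r) (chart_deriv b c r h) w)) (at (snd b r))"
    proof (rule has_derivative_transform_within_open[OF _ S])
      fix y assume "y \<in> ?S"
      then obtain q where q: "y = snd b q" "q \<in> fst b" "q \<in> fst c" "q \<in> fst d" by auto
      then have qN: "q \<in> points N" using chart_points[OF M b(1)] sub' by blast
      note q' = chart_at[OF N qN]
      have "chart_coords N d q (incl_deriv M N q (coord_vf M c w q)) = chart_deriv c d q w"
        unfolding incl_deriv_coord_vf(1)[OF sub c(1) q(3)] chart_coords_eq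
        by (rule chart_deriv_comp[OF cMN[OF c(1) q'(1)] cN[OF q'(1) d(1)] q(3) q'(2) q(4)])
      then show "?G ((snd c \<circ> chart_inv b) y) = ?f y"
        using q inj by (simp add: chart_deriv_def)
    qed
    from frechet_derivative_at[OF this]
    have "frechet_derivative ?f (at (snd b r)) ?u =
       second_derivative (snd d \<circ> chart_inv c) (snd c r) (chart_deriv b c r ?u) w" by metis
    also have "chart_deriv b c r ?u = v"
      using chart_deriv_comp[OF cM[OF c(1) b(1)] cM[OF b(1) c(1)] c(2) b(2) c(2)]
        chart_deriv_self[OF cM[OF c(1) c(1)] c(2)] by (simp add: coord_vf_def b_def)
    finally show ?thesis .
  qed
  let ?a = "chart_deriv c d r v" and ?b = "chart_deriv c d r w"
  let ?S2 = "second_derivative (snd d \<circ> chart_inv c) (snd c r) v w"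
  note comp = chart_deriv_comp[OF cMN[OF c(1) d(1)] cN[OF d(1) e(1)] c(2) d(2) e(2)]
  have "cov_along M N D r ?u (\<lambda>q. incl_deriv M N q (coord_vf M c w q)) =
     ?S2 + D (coord_vf N d ?a) (coord_vf N d ?b) r"
    unfolding cov_along_def b_def[symmetric] d_def[symmetric] first const_vf_eq
      incl_deriv_coord_vf(1)[OF sub c, folded d_def] ..
  also have "?S2 = coord_vf N e (chart_deriv d e r ?S2) r"
    using coord_vf_chart_coords[OF N e, of ?S2] by (simp add: chart_coords_eq d_def)
  also have "D (coord_vf N d ?a) (coord_vf N d ?b) r =
      coord_vf N e (second_derivative (snd e \<circ> chart_inv d) (snd d r) ?a ?b) r +
      D (coord_vf N e (chart_deriv c e r v)) (coord_vf N e (chart_deriv c e r w)) r"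
    using conn_chart[OF N aff openin_chart[OF N d(1)] smooth_coord_vf[OF N d(1) openin_chart[OF N d(1)] order_refl]
        smooth_coord_vf[OF N d(1) openin_chart[OF N d(1)] order_refl] e(1) d(2) e(2), of ?a ?b]
    by (simp add: chart_coords_coord_vf[OF N d(1) e(1) d(2) e(2)] comp
        frechet_derivative_vf_rep_coord_vf[OF N d e, of ?b ?a, unfolded comp])
  finally have eq: "cov_along M N D r ?u (\<lambda>q. incl_deriv M N q (coord_vf M c w q)) =
    coord_vf N e (chart_deriv d e r ?S2) r +
    (coord_vf N e (second_derivative (snd e \<circ> chart_inv d) (snd d r) ?a ?b) r +
      D (coord_vf N e (chart_deriv c e r v)) (coord_vf N e (chart_deriv c e r w)) r)" .
  have "openin (mtop N) (fst d \<inter> fst e)"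
    using openin_chart[OF N d(1)] openin_chart[OF N e(1)] by blast
  \<comment> \<open>The Hessian of the transition from \<open>d\<close> to \<open>e\<close>,
    contributed by the change of Christoffel symbols, is exactly what completes the Hessian of the
    inclusion in \<open>d\<close> to the one in \<open>e\<close>.\<close>
  from second_derivative_transition[OF cMN[OF c(1) d(1)] cN[OF d(1) e(1)]
        open_submanifold_chart_image[OF sub c(1) this] cMN[OF c(1) e(1)] c(2) d(2) e(2), of v w]
  show ?thesis
    unfolding eq linear_add[OF linear_coord_vf[OF N e]] by (simp only: linear_add[OF linear_coord_vf[OF N e]] add_ac)
qed

section \<open>The Gauss equation\<close>

text \<open>The point is a parameter because differentiation along \<open>M\<close> uses the
  tangential projection at all points near a given one; the locale is interpreted again
  there.\<close>

locale submanifold_point =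
  fixes M :: "('a, 'f::euclidean_space) manifold" and N :: "('a, 'e::euclidean_space) manifold"
    and g :: "('a, 'e) metric" and p :: 'a
  assumes sub: "submanifold M N" and gM: "riemannian_metric M (induced_metric M N g)"
    and gN: "riemannian_metric N g" and p: "p \<in> points M"
begin

abbreviation (input) "\<iota> \<equiv> incl_deriv M N p"
abbreviation (input) "cM \<equiv> chart_at M p"
abbreviation (input) "cN \<equiv> chart_at N p"
abbreviation (input) "\<phi> \<equiv> snd cN \<circ> chart_inv cM"

lemma submanifold_basics:
  shows smooth_M: "smooth_manifold M" and smooth_N: "smooth_manifold N" and pN: "p \<in> points N"
    and chart_M: "cM \<in> atlas M" "p \<in> fst cM" and chart_N: "cN \<in> atlas N" "p \<in> fst cN"
    and compat_MN: "compat cM cN"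
proof -
  show MN: "smooth_manifold M" "smooth_manifold N" and pN: "p \<in> points N"
    using sub p by (auto simp: submanifold_def)
  show c: "cM \<in> atlas M" "p \<in> fst cM" "cN \<in> atlas N" "p \<in> fst cN"
    using chart_at[OF MN(1) p] chart_at[OF MN(2) pN] by auto
  show "compat cM cN" by (rule compat_submanifold[OF sub c(1,3)])
qed

lemma linear_incl: "linear \<iota>"
  unfolding incl_deriv_eq by (rule linear_chart_deriv[OF compat_MN chart_M(2) chart_N(2)])

lemma ip_N: "inner_product (g p)" and ip_M: "inner_product (induced_metric M N g p)"
  using inner_product_metric[OF gN pN] inner_product_metric[OF gM p] by auto

lemmas bil_N = inner_product_bilinear[OF ip_N] and bil_M = inner_product_bilinear[OF ip_M]

text \<open>Existence comes from representing the functional \<open>g p w (\<iota> v)\<close> of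
  \<open>v\<close> in the induced metric, uniqueness from definiteness of that metric. So
  \<open>tangential\<close> is the orthogonal projection.\<close>

lemma tangential_normal: "g p (w - \<iota> (tangential M N g p w)) (\<iota> v) = 0"
  and tangential_unique: "(\<And>v. g p (w - \<iota> u) (\<iota> v) = 0) \<Longrightarrow> tangential M N g p w = u"
proof -
  have "linear (\<lambda>v. g p w (\<iota> v))"
    by (rule linearI) (simp_all add: linear_add[OF linear_incl] linear_cmul[OF linear_incl]
        bilinear_radd[OF bil_N] bilinear_rmul[OF bil_N])
  from inner_product_represents[OF ip_M this] obtain u0 where
    u0: "\<And>v. g p (\<iota> u0) (\<iota> v) = g p w (\<iota> v)" by (auto simp: induced_metric_def)
  have ex: "\<forall>v. g p (w - \<iota> u0) (\<iota> v) = 0" by (simp add: bilinear_lsub[OF bil_N] u0)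
  have uniq: "u = u'" if "\<forall>v. g p (w - \<iota> u) (\<iota> v) = 0" "\<forall>v. g p (w - \<iota> u') (\<iota> v) = 0" for u u'
  proof -
    have "induced_metric M N g p (u - u') (u - u') = 0"
    proof -
      have "g p (\<iota> u - \<iota> u') (\<iota> (u - u')) = 0"
        using that[THEN spec, of "u - u'"] by (simp add: bilinear_lsub[OF bil_N])
      then show ?thesis by (simp only: induced_metric_def linear_diff[OF linear_incl])
    qed
    then show ?thesis by (simp add: inner_product_eq_0[OF ip_M])
  qed
  have t: "tangential M N g p w = u" if "\<forall>v. g p (w - \<iota> u) (\<iota> v) = 0" for u
    unfolding tangential_def using that uniq by (intro the_equality) auto
  show "g p (w - \<iota> (tangential M N g p w)) (\<iota> v) = 0" using t[OF ex] ex by simp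
  show "(\<And>v. g p (w - \<iota> u) (\<iota> v) = 0) \<Longrightarrow> tangential M N g p w = u" using t by blast
qed

lemma linear_tangential: "linear (tangential M N g p)"
proof (rule linearI)
  fix a b :: 'e and r :: real
  show "tangential M N g p (a + b) = tangential M N g p a + tangential M N g p b"
  proof (rule tangential_unique)
    fix v
    have "a + b - \<iota> (tangential M N g p a + tangential M N g p b) =
      (a - \<iota> (tangential M N g p a)) + (b - \<iota> (tangential M N g p b))"
      by (simp add: linear_add[OF linear_incl])
    then show "g p (a + b - \<iota> (tangential M N g p a + tangential M N g p b)) (\<iota> v) = 0"
      by (simp only: bilinear_ladd[OF bil_N] tangential_normal)
  qed
  show "tangential M N g p (r *\<^sub>R a) = r *\<^sub>R tangential M N g p a"
  proof (rule tangential_unique)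
    fix v
    have "r *\<^sub>R a - \<iota> (r *\<^sub>R tangential M N g p a) = r *\<^sub>R (a - \<iota> (tangential M N g p a))"
      by (simp add: linear_cmul[OF linear_incl] scaleR_diff_right)
    then show "g p (r *\<^sub>R a - \<iota> (r *\<^sub>R tangential M N g p a)) (\<iota> v) = 0"
      by (simp only: bilinear_lmul[OF bil_N] tangential_normal scaleR_zero_right)
  qed
qed

lemma metric_tangential: "g p (\<iota> (tangential M N g p w)) (\<iota> v) = g p w (\<iota> v)"
  using tangential_normal[of w v] by (simp add: bilinear_lsub[OF bil_N])

lemma second_ff_normal: "g p (second_ff M N g D p u v) (\<iota> w) = 0"
  by (simp add: second_ff_def Let_def tangential_normal)

lemma cov_along_const:
  assumes "affine_connection N D"
  shows "cov_along M N D p u (\<lambda>q. incl_deriv M N q (const_vf M p v q)) =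
    second_derivative \<phi> (snd cM p) u v + D (const_vf N p (\<iota> u)) (const_vf N p (\<iota> v)) p"
  using cov_along_chart[OF sub assms chart_M chart_N, of u v] const_vf_at[OF smooth_M p] const_vf_at[OF smooth_N pN]
  by (simp add: const_vf_eq incl_deriv_eq)

lemma smooth_\<phi>: "smooth_on (snd cM ` (fst cM \<inter> fst cN)) \<phi>"
  and open_\<phi>: "open (snd cM ` (fst cM \<inter> fst cN))"
  and mem_\<phi>: "snd cM p \<in> snd cM ` (fst cM \<inter> fst cN)"
  using compat_MN chart_M chart_N by (auto simp: compat_def)

lemma bilinear_second_derivative: "bilinear (second_derivative \<phi> (snd cM p))"
  unfolding bilinear_def
  using second_derivative_linear1[OF smooth_\<phi> mem_\<phi>] second_derivative_sym[OF open_\<phi> mem_\<phi> smooth_\<phi>]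
  by simp

lemma bilinear_conn_const_vf:
  assumes "affine_connection N D"
  shows "bilinear (\<lambda>a b. D (const_vf N p a) (const_vf N p b) p)"
  unfolding bilinear_def const_vf_eq
  using smooth_const_vf[OF smooth_N pN] openin_chart[OF smooth_N chart_N(1)] chart_N(2)
  by (auto intro!: linear_conn1[OF smooth_N assms _ chart_N(1) order_refl] linear_conn2[OF smooth_N assms _ chart_N(1) order_refl] simp: const_vf_eq)

lemma bilinear_cov_along_const:
  assumes "affine_connection N D"
  shows "bilinear (\<lambda>u v. cov_along M N D p u (\<lambda>q. incl_deriv M N q (const_vf M p v q)))"
proof -
  note b = bilinear_second_derivative bilinear_conn_const_vf[OF assms]
  show ?thesis
    unfolding cov_along_const[OF assms] bilinear_def
    by (auto intro!: linearI simp: linear_add[OF linear_incl] linear_cmul[OF linear_incl] scaleR_add_right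
        bilinear_ladd[OF b(1)] bilinear_radd[OF b(1)] bilinear_lmul[OF b(1)] bilinear_rmul[OF b(1)]
        bilinear_ladd[OF b(2)] bilinear_radd[OF b(2)] bilinear_lmul[OF b(2)] bilinear_rmul[OF b(2)])
qed

lemma bilinear_second_ff:
  assumes "affine_connection N D"
  shows "bilinear (second_ff M N g D p)"
proof -
  note b = bilinear_cov_along_const[OF assms] and t = linear_tangential and i = linear_incl
  have *: "second_ff M N g D p = (\<lambda>u v. cov_along M N D p u (\<lambda>q. incl_deriv M N q (const_vf M p v q)) -
      \<iota> (tangential M N g p (cov_along M N D p u (\<lambda>q. incl_deriv M N q (const_vf M p v q)))))"
    by (simp add: fun_eq_iff second_ff_def Let_def)
  show ?thesis
    unfolding * bilinear_def
    by (auto intro!: linearI simp: linear_add[OF i] linear_cmul[OF i] linear_add[OF t] linear_cmul[OF t]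
        bilinear_ladd[OF b] bilinear_radd[OF b] bilinear_lmul[OF b] bilinear_rmul[OF b] scaleR_diff_right)
qed

lemma second_ff_sym:
  assumes "affine_connection N D" "torsion_free N D"
  shows "second_ff M N g D p u v = second_ff M N g D p v u"
  using cov_along_const[OF assms(1)] second_derivative_sym[OF open_\<phi> mem_\<phi> smooth_\<phi>, of u v]
    conn_const_vf_sym[OF smooth_N pN assms(2), of "\<iota> u" "\<iota> v"]
  by (simp add: second_ff_def Let_def)

text \<open>\<open>E\<close> and \<open>E'\<close> are abstract so that the Gauss equation also
  covers the Levi-Civita connection of \<open>M\<close>, which is obtained by a choice and compared
  with an induced connection only on smooth fields.\<close>

context
  fixes D D' :: "('a, 'e) connection" and E E' :: "('a, 'f) connection"
  assumes D: "affine_connection N D" "torsion_free N D"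
    and D': "affine_connection N D'" 
    and dual: "dual_connections N g D D'"
    and E: "affine_connection M E" "torsion_free M E"
    and dualM: "dual_connections M (induced_metric M N g) E E'"
    and E_ind: "\<And>U X Y q. openin (mtop M) U \<Longrightarrow> smooth_vf M U X \<Longrightarrow> smooth_vf M U Y \<Longrightarrow> q \<in> U \<Longrightarrow>
        E X Y q = induced_conn M N g D X Y q"
    and E'_ind: "\<And>U X Y q. openin (mtop M) U \<Longrightarrow> smooth_vf M U X \<Longrightarrow> smooth_vf M U Y \<Longrightarrow> q \<in> U \<Longrightarrow>
        E' X Y q = induced_conn M N g D' X Y q"
begin

text \<open>Near \<open>p\<close> the differentiated function is built from the metric and the
  lowered Christoffel symbols of \<open>N\<close>, both composed with \<open>\<phi>\<close> and
  applied to derivatives of \<open>\<phi>\<close>. The product rule gives one term per factor, and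
  duality in \<open>N\<close> resolves the derivative of the metric into terms with \<open>D\<close>
  and \<open>D'\<close>.\<close>

lemma dir_deriv_induced:
  fixes u v w z
  defines "T \<equiv> second_derivative \<phi> (snd cM p)" and "C \<equiv> const_vf N p"
  shows "dir_deriv M (const_vf M p u)
      (\<lambda>q. induced_metric M N g q (E (const_vf M p v) (const_vf M p w) q) (const_vf M p z q)) p =
    g p (D (C (\<iota> u)) (C (T v w)) p) (\<iota> z) + g p (T v w) (D' (C (\<iota> u)) (C (\<iota> z)) p) + g p (T v w) (T u z) +
    g p (frechet_derivative (\<lambda>x. second_derivative \<phi> x v w) (at (snd cM p)) u) (\<iota> z) +
    dir_deriv N (C (\<iota> u)) (\<lambda>q. g q (D (C (\<iota> v)) (C (\<iota> w)) q) (C (\<iota> z) q)) p +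
    g p (D (C (\<iota> v)) (C (\<iota> w)) p) (T u z) + g p (D (C (\<iota> v)) (C (T u w)) p) (\<iota> z) +
    g p (D (C (T u v)) (C (\<iota> w)) p) (\<iota> z)"
proof -
  let ?S = "snd cM ` (fst cM \<inter> fst cN)" and ?x = "snd cM p"
  let ?d = "\<lambda>x v. frechet_derivative \<phi> (at x) v"
  note U = openin_chart[OF smooth_N chart_N(1)] 
  note s = smooth_const_vf[OF smooth_N pN, folded C_def]
  have injM: "inj_on (snd cM) (fst cM)" and injN: "inj_on (snd cN) (fst cN)"
    using compat_MN by (auto simp: compat_def)
  have inv: "chart_inv cN (\<phi> (snd cM q)) = q" if "q \<in> fst cM" "q \<in> fst cN" for q
    using that injM injN by simp
  have \<iota>: "?d ?x v = \<iota> v" for v by (simp add: incl_deriv_def fun_eq_iff)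
  have CN: "C = coord_vf N cN" by (simp add: C_def const_vf_eq)
  have Cp: "C a p = a" for a unfolding C_def by (rule const_vf_at[OF smooth_N pN])
  define h where "h y a b = g (chart_inv cN y) (C a (chart_inv cN y)) (C b (chart_inv cN y))" for y a b
  define k where "k y a b d = g (chart_inv cN y) (D (C a) (C b) (chart_inv cN y)) (C d (chart_inv cN y))" for y a b d
  have der_\<phi>: "(\<phi> has_derivative \<iota>) (at ?x)"
    unfolding incl_deriv_eq by (rule compat_has_derivative[OF compat_MN chart_M(2) chart_N(2)])
  have der_N: "((\<lambda>x. (f \<circ> chart_inv cN) (\<phi> x)) has_derivative (\<lambda>t. dir_deriv N (C (\<iota> t)) f p)) (at ?x)"
    if "smooth_fun N (fst cN) f" for f
  proof -
    have "(f \<circ> chart_inv cN) differentiable (at (\<phi> ?x))"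
      using smooth_fun_differentiable[OF smooth_N chart_N(1) that chart_N(2) chart_N(2)] injM chart_M by simp
    from has_derivative_compose[OF der_\<phi> this[unfolded frechet_derivative_works]]
    show ?thesis using injM chart_M by (simp add: dir_deriv_def Cp)
  qed
  have smh: "smooth_fun N (fst cN) (\<lambda>q. g q (C a q) (C b q))"
    and smk: "smooth_fun N (fst cN) (\<lambda>q. g q (D (C a) (C b) q) (C d q))" for a b d
    using gN[unfolded riemannian_metric_def] U s conn_smooth[OF smooth_N D(1) U s s] by blast+
  have h': "((\<lambda>x. h (\<phi> x) a b) has_derivative
      (\<lambda>t. g p (D (C (\<iota> t)) (C a) p) b + g p a (D' (C (\<iota> t)) (C b) p))) (at ?x)" for a b
    using der_N[OF smh, of a b] dual_connectionsD[OF dual U s s s chart_N(2), of _ a b]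
    by (simp add: h_def comp_def Cp)
  have k': "((\<lambda>x. k (\<phi> x) a b d) has_derivative
      (\<lambda>t. dir_deriv N (C (\<iota> t)) (\<lambda>q. g q (D (C a) (C b) q) (C d q)) p)) (at ?x)" for a b d
    using der_N[OF smk, of a b d] by (simp add: k_def comp_def)
  have bq: "bilinear (g q)" if "q \<in> fst cN" for q
    using metric_bilinear(1)[OF gN chart_points[OF smooth_N chart_N(1) that]] .
  have bilh: "bilinear (h (\<phi> x))" if x: "x \<in> ?S" for x
  proof -
    obtain q where q: "x = snd cM q" "q \<in> fst cM" "q \<in> fst cN" using x by auto
    note l = linear_coord_vf[OF smooth_N chart_N(1) q(3), folded CN] and b = bq[OF q(3)]
    show ?thesis
      unfolding h_def[abs_def] bilinear_def q(1) inv[OF q(2,3)]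
      by (auto intro!: linearI simp: linear_add[OF l] linear_cmul[OF l]
          bilinear_ladd[OF b] bilinear_radd[OF b] bilinear_lmul[OF b] bilinear_rmul[OF b])
  qed
  have bilk: "bilinear (k (\<phi> x) a)" and link: "linear (\<lambda>a. k (\<phi> x) a b d)" if x: "x \<in> ?S" for x a b d
  proof -
    obtain q where q: "x = snd cM q" "q \<in> fst cM" "q \<in> fst cN" using x by auto
    note l = linear_coord_vf[OF smooth_N chart_N(1) q(3), folded CN] and b = bq[OF q(3)]
      and D1 = linear_conn1[OF smooth_N D(1) U chart_N(1) order_refl s q(3), folded CN]
      and D2 = linear_conn2[OF smooth_N D(1) U chart_N(1) order_refl s q(3), folded CN]
    show "bilinear (k (\<phi> x) a)"
      unfolding k_def[abs_def] bilinear_def q(1) inv[OF q(2,3)]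
      by (auto intro!: linearI simp: linear_add[OF l] linear_cmul[OF l] linear_add[OF D2] linear_cmul[OF D2]
          bilinear_ladd[OF b] bilinear_radd[OF b] bilinear_lmul[OF b] bilinear_rmul[OF b])
    show "linear (\<lambda>a. k (\<phi> x) a b d)"
      unfolding k_def q(1) inv[OF q(2,3)]
      by (auto intro!: linearI simp: linear_add[OF D1] linear_cmul[OF D1]
          bilinear_ladd[OF b] bilinear_lmul[OF b])
  qed
  have hx: "h (\<phi> ?x) a b = g p a b" and kx: "k (\<phi> ?x) a b d = g p (D (C a) (C b) p) d" for a b d
    by (simp_all only: h_def k_def inv[OF chart_M(2) chart_N(2)] Cp)
  have d1: "((\<lambda>x. ?d x a) has_derivative (\<lambda>t. T t a)) (at ?x)" for a
    using smooth_on_differentiable[OF smooth_on_frechet[OF smooth_\<phi>] mem_\<phi>]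
    unfolding T_def second_derivative_def frechet_derivative_works .
  have d2: "((\<lambda>x. second_derivative \<phi> x v w) has_derivative
      (\<lambda>t. frechet_derivative (\<lambda>x. second_derivative \<phi> x v w) (at ?x) t)) (at ?x)"
    using smooth_on_differentiable[OF smooth_on_second_derivative[OF smooth_\<phi>] mem_\<phi>]
    unfolding frechet_derivative_works .
  let ?F = "\<lambda>x. h (\<phi> x) (second_derivative \<phi> x v w) (?d x z) + k (\<phi> x) (?d x v) (?d x w) (?d x z)"
  have F: "(?F has_derivative (\<lambda>t.
      (g p (D (C (\<iota> t)) (C (T v w)) p) (\<iota> z) + g p (T v w) (D' (C (\<iota> t)) (C (\<iota> z)) p) +
       g p (T v w) (T t z) + g p (frechet_derivative (\<lambda>x. second_derivative \<phi> x v w) (at ?x) t) (\<iota> z)) +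
      (dir_deriv N (C (\<iota> t)) (\<lambda>q. g q (D (C (\<iota> v)) (C (\<iota> w)) q) (C (\<iota> z) q)) p +
       g p (D (C (\<iota> v)) (C (\<iota> w)) p) (T t z) + g p (D (C (\<iota> v)) (C (T t w)) p) (\<iota> z) +
       g p (D (C (T t v)) (C (\<iota> w)) p) (\<iota> z)))) (at ?x)"
    using has_derivative_add[OF
      has_derivative_bilinear_apply[where B = "\<lambda>x. h (\<phi> x)", OF open_\<phi> mem_\<phi> bilh h' d2 d1[of z]]
      has_derivative_trilinear_apply[where B = "\<lambda>x. k (\<phi> x)", OF open_\<phi> mem_\<phi> bilk link k' d1[of v] d1[of w] d1[of z]]]
    unfolding hx kx \<iota> T_def[symmetric] .
  let ?G = "\<lambda>q. induced_metric M N g q (E (const_vf M p v) (const_vf M p w) q) (const_vf M p z q)"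
  have "((?G \<circ> chart_inv cM) has_derivative (\<lambda>t.
      (g p (D (C (\<iota> t)) (C (T v w)) p) (\<iota> z) + g p (T v w) (D' (C (\<iota> t)) (C (\<iota> z)) p) +
       g p (T v w) (T t z) + g p (frechet_derivative (\<lambda>x. second_derivative \<phi> x v w) (at ?x) t) (\<iota> z)) +
      (dir_deriv N (C (\<iota> t)) (\<lambda>q. g q (D (C (\<iota> v)) (C (\<iota> w)) q) (C (\<iota> z) q)) p +
       g p (D (C (\<iota> v)) (C (\<iota> w)) p) (T t z) + g p (D (C (\<iota> v)) (C (T t w)) p) (\<iota> z) +
       g p (D (C (T t v)) (C (\<iota> w)) p) (\<iota> z)))) (at ?x)"
  proof (rule has_derivative_transform_within_open[OF F open_\<phi> mem_\<phi>])
    fix x assume "x \<in> ?S"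
    then obtain q where q: "x = snd cM q" "q \<in> fst cM" "q \<in> fst cN" by auto
    then have qM: "q \<in> points M" using chart_points[OF smooth_M chart_M(1)] by blast
    \<comment> \<open>The induced connection projects at each \<open>q\<close> near
      \<open>p\<close>; the projection disappears because the result is paired with a tangent
      vector.\<close>
    interpret q: submanifold_point M N g q by unfold_locales (fact sub gM gN qM)+
    have Z: "incl_deriv M N q (const_vf M p a q) = C (chart_deriv cM cN q a) q" for a
      unfolding const_vf_eq CN incl_deriv_coord_vf(1)[OF sub chart_M(1) q(2)] incl_deriv_coord_vf(2)[OF sub chart_M(1) q(2) chart_N(1) q(3)] ..
    have "E (const_vf M p v) (const_vf M p w) q = induced_conn M N g D (const_vf M p v) (const_vf M p w) q"
      by (rule E_ind[OF openin_chart[OF smooth_M chart_M(1)] smooth_const_vf[OF smooth_M p] smooth_const_vf[OF smooth_M p] q(2)])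
    then have "?G q = g q (cov_along M N D q (const_vf M p v q) (\<lambda>q. incl_deriv M N q (const_vf M p w q)))
        (incl_deriv M N q (const_vf M p z q))"
      by (simp add: induced_metric_def induced_conn_def q.metric_tangential)
    also have "\<dots> = g q (C (second_derivative \<phi> x v w) q +
        D (C (chart_deriv cM cN q v)) (C (chart_deriv cM cN q w)) q) (C (chart_deriv cM cN q z) q)"
      unfolding Z using cov_along_chart[OF sub D(1) chart_M(1) q(2) chart_N(1) q(3), of v w] 
      by (simp only: const_vf_eq[symmetric] CN q(1) Z[unfolded CN])
    also have "\<dots> = ?F x"
      using bilinear_ladd[OF bq[OF q(3)]] inv[OF q(2,3)] by (simp only: h_def k_def chart_deriv_def q(1))
    finally show "?F x = (?G \<circ> chart_inv cM) x" using q injM by simp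
  qed
  from fun_cong[OF frechet_derivative_at[OF this], of u] show ?thesis
    unfolding dir_deriv_def const_vf_at[OF smooth_M p] by (simp only: add.assoc)
qed

text \<open>Both curvatures are expanded by \<open>curvature_dual\<close>. The products of full
  covariant derivatives absorb the terms in which \<open>T v w\<close> or \<open>T u z\<close> is
  itself an argument of the metric. The other terms with second or third derivatives of the
  inclusion are symmetric in \<open>u\<close> and \<open>v\<close> and drop out of the
  antisymmetrised expression.\<close>

theorem gauss_equation:
  "induced_metric M N g p (curvature M E p u v w) z =
     g p (curvature N D p (\<iota> u) (\<iota> v) (\<iota> w)) (\<iota> z) +
     g p (second_ff M N g D p v w) (second_ff M N g D' p u z) -
     g p (second_ff M N g D p u w) (second_ff M N g D' p v z)"
proof -
  define T where "T = second_derivative \<phi> (snd cM p)"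
  define C where "C = const_vf N p"
  let ?gM = "induced_metric M N g p" and ?X = "const_vf M p"
  define A where "A D u v = cov_along M N D p u (\<lambda>q. incl_deriv M N q (?X v q))" for D u v
  have A: "A D u v = T u v + D (C (\<iota> u)) (C (\<iota> v)) p" if "affine_connection N D" for D u v
    unfolding A_def T_def C_def by (rule cov_along_const[OF that])
  note sX = smooth_const_vf[OF smooth_M p] and U = openin_chart[OF smooth_M chart_M(1)]
  have EA: "E (?X u) (?X v) p = tangential M N g p (A D u v)" 
    and EA': "E' (?X u) (?X v) p = tangential M N g p (A D' u v)" for u v
    using E_ind[OF U sX sX chart_M(2)] E'_ind[OF U sX sX chart_M(2)]
    by (simp_all add: induced_conn_def const_vf_at[OF smooth_M p] A_def)
  \<comment> \<open>Tangential and normal parts are orthogonal, so the product of the tangential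
    parts is the full product minus the product of the second fundamental forms. This is the source
    of the quadratic terms.\<close>
  have split: "?gM (E (?X v) (?X w) p) (E' (?X u) (?X z) p) =
     g p (A D v w) (A D' u z) - g p (second_ff M N g D p v w) (second_ff M N g D' p u z)" for u v w z
  proof -
    have sff: "second_ff M N g D p v w = A D v w - \<iota> (tangential M N g p (A D v w))" for D v w
      by (simp add: second_ff_def Let_def A_def)
    have "g p (\<iota> (tangential M N g p (A D v w))) (A D' u z - \<iota> (tangential M N g p (A D' u z))) = 0"
      using tangential_normal inner_product_sym[OF ip_N] by metis
    moreover have "g p (A D v w - \<iota> (tangential M N g p (A D v w))) (\<iota> (tangential M N g p (A D' u z))) = 0"
      by (rule tangential_normal)
    ultimately show ?thesis
      unfolding EA EA' sff induced_metric_def bilinear_lsub[OF bil_N] bilinear_rsub[OF bil_N] by linarith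
  qed
  have T3: "frechet_derivative (\<lambda>x. second_derivative \<phi> x v w) (at (snd cM p)) u =
      frechet_derivative (\<lambda>x. second_derivative \<phi> x u w) (at (snd cM p)) v"
    using second_derivative_sym[OF open_\<phi> mem_\<phi> smooth_on_frechet[OF smooth_\<phi>], of w u v]
    by (simp only: second_derivative_def)
  have T2: "T u v = T v u"
    unfolding T_def by (rule second_derivative_sym[OF open_\<phi> mem_\<phi> smooth_\<phi>])
  show ?thesis
    unfolding curvature_dual[OF smooth_M p gM E dualM] curvature_dual[OF smooth_N pN gN D dual] dir_deriv_induced
      T_def[symmetric] C_def[symmetric] split
      A[OF D(1)] A[OF D'] bilinear_ladd[OF bil_N] bilinear_radd[OF bil_N] T3 T2 by linarith
qed

end

end

section \<open>Orthonormal bases and Chen's algebraic inequality\<close>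

definition orthonormal_upto :: "('f \<Rightarrow> 'f \<Rightarrow> real) \<Rightarrow> (nat \<Rightarrow> 'f) \<Rightarrow> nat \<Rightarrow> bool" where
  "orthonormal_upto h e k \<longleftrightarrow> (\<forall>i\<in>{1..k}. \<forall>j\<in>{1..k}. h (e i) (e j) = (if i = j then 1 else 0))"

lemma orthonormal_basis_iff: "orthonormal_basis h (e :: nat \<Rightarrow> 'f::euclidean_space) \<longleftrightarrow> orthonormal_upto h e DIM('f)"
  by (simp add: orthonormal_basis_def orthonormal_upto_def)

context
  fixes h :: "'f::euclidean_space \<Rightarrow> 'f \<Rightarrow> real"
  assumes h: "inner_product h"
begin

lemma linear_coefficients: "linear (\<lambda>x. \<Sum>i\<in>I. h x (e i) *\<^sub>R (b i :: 'f))"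
  by (rule linearI) (simp_all add: bilinear_ladd[OF inner_product_bilinear[OF h]] bilinear_lmul[OF inner_product_bilinear[OF h]] scaleR_add_left sum.distrib scaleR_sum_right)

text \<open>The coefficient map \<open>A\<close> is onto, since the combination \<open>L c\<close>
  has the prescribed coefficients \<open>c\<close>; by dimension it is injective, so a vector is
  determined by its coefficients.\<close>

lemma orthonormal_basis_expansion:
  assumes e: "orthonormal_basis h e"
  shows "x = (\<Sum>i\<in>{1..DIM('f)}. h x (e i) *\<^sub>R e i)"
proof -
  obtain b :: "nat \<Rightarrow> 'f" where b: "bij_betw b {1..DIM('f)} Basis"
    using ex_bij_betw_nat_finite_1[of "Basis :: 'f set"] by auto
  define A where "A x = (\<Sum>i\<in>{1..DIM('f)}. h x (e i) *\<^sub>R b i)" for x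
  have lA: "linear A" unfolding A_def[abs_def] by (rule linear_coefficients)
  define L where "L c = (\<Sum>i\<in>{1..DIM('f)}. c i *\<^sub>R e i)" for c :: "nat \<Rightarrow> real"
  have hL: "h (L c) (e j) = c j" if "j \<in> {1..DIM('f)}" for c j
  proof -
    have l: "linear (\<lambda>y. h y (e j))" using inner_product_bilinear[OF h] by (simp add: bilinear_def)
    have "h (L c) (e j) = (\<Sum>i\<in>{1..DIM('f)}. c i *\<^sub>R h (e i) (e j))"
      unfolding L_def by (simp add: linear_sum[OF l] linear_cmul[OF l])
    also have "\<dots> = (\<Sum>i\<in>{1..DIM('f)}. if i = j then c i else 0)"
      using e that by (intro sum.cong) (auto simp: orthonormal_basis_def)
    finally show ?thesis using that by simp
  qed
  have "surj A"
  proof (rule surjI)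
    fix y
    have "A (L (\<lambda>i. y \<bullet> b i)) = (\<Sum>i\<in>{1..DIM('f)}. (y \<bullet> b i) *\<^sub>R b i)"
      unfolding A_def by (intro sum.cong refl) (simp only: hL)
    also have "\<dots> = (\<Sum>i\<in>Basis. (y \<bullet> i) *\<^sub>R i)" by (rule sum.reindex_bij_betw[OF b])
    finally show "A (L (\<lambda>i. y \<bullet> b i)) = y" by (simp add: euclidean_representation)
  qed
  then have "inj A" by (rule linear_surjective_imp_injective[OF lA]) simp
  moreover have "A x = A (L (\<lambda>i. h x (e i)))"
    unfolding A_def by (intro sum.cong refl) (simp only: hL)
  ultimately have "x = L (\<lambda>i. h x (e i))" by (rule injD)
  then show ?thesis unfolding L_def .
qed

text \<open>Below full dimension the coefficient map misses \<open>b (Suc k)\<close>, so it has a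
  nonzero kernel vector, which only needs normalising.\<close>

lemma orthonormal_extend:
  assumes e: "orthonormal_upto h e k" and k: "k < DIM('f)"
  shows "\<exists>x. h x x = 1 \<and> (\<forall>i\<in>{1..k}. h x (e i) = 0)"
proof -
  obtain b :: "nat \<Rightarrow> 'f" where b: "bij_betw b {1..DIM('f)} Basis"
    using ex_bij_betw_nat_finite_1[of "Basis :: 'f set"] by auto
  have bb: "b i \<bullet> b j = (if i = j then 1 else 0)" if "i \<in> {1..DIM('f)}" "j \<in> {1..DIM('f)}" for i j
  proof -
    have "b i \<in> Basis" "b j \<in> Basis" using bij_betwE[OF b] that by blast+
    moreover have "b i = b j \<longleftrightarrow> i = j" using bij_betw_imp_inj_on[OF b] that by (auto dest: inj_onD)
    ultimately show ?thesis by (simp add: inner_Basis)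
  qed
  define A where "A x = (\<Sum>i\<in>{1..k}. h x (e i) *\<^sub>R b i)" for x
  have lA: "linear A" unfolding A_def[abs_def] by (rule linear_coefficients)
  have comp: "A x \<bullet> b j = (if j \<in> {1..k} then h x (e j) else 0)" if "j \<in> {1..DIM('f)}" for x j
  proof -
    have "A x \<bullet> b j = (\<Sum>i\<in>{1..k}. if i = j then h x (e i) else 0)"
      unfolding A_def inner_sum_left using k that by (intro sum.cong) (auto simp: bb)
    then show ?thesis by simp
  qed
  have "b (Suc k) \<notin> range A"
  proof
    assume "b (Suc k) \<in> range A"
    then obtain x where "b (Suc k) = A x" by auto
    then show False using comp[of "Suc k" x] bb[of "Suc k" "Suc k"] k by auto
  qed
  then have "\<not> inj A" using linear_injective_imp_surjective[OF lA] by blast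
  then obtain y where y: "y \<noteq> 0" "A y = 0" using linear_injective_0[OF lA] by blast
  have pos: "0 < h y y" using h y by (auto simp: inner_product_def)
  have "h y (e i) = 0" if "i \<in> {1..k}" for i using comp[of i y] y that k by auto
  then have "h ((1 / sqrt (h y y)) *\<^sub>R y) (e i) = 0" if "i \<in> {1..k}" for i
    using that by (simp add: bilinear_lmul[OF inner_product_bilinear[OF h]])
  moreover have "h ((1 / sqrt (h y y)) *\<^sub>R y) ((1 / sqrt (h y y)) *\<^sub>R y) = 1"
  proof -
    have "sqrt (h y y) * sqrt (h y y) = h y y" using pos by simp
    then show ?thesis using pos by (simp add: bilinear_lmul[OF inner_product_bilinear[OF h]] bilinear_rmul[OF inner_product_bilinear[OF h]] field_simps)
  qed
  ultimately show ?thesis by blast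
qed

lemma orthonormal_basis_extends:
  assumes "orthonormal_upto h e k" "k \<le> DIM('f)"
  shows "\<exists>e'. orthonormal_basis h e' \<and> (\<forall>i\<in>{1..k}. e' i = e i)"
  using assms(2,1)
proof (induction k arbitrary: e rule: inc_induct)
  case base
  then show ?case by (auto simp: orthonormal_basis_iff)
next
  case (step k)
  obtain x where x: "h x x = 1" "\<forall>i\<in>{1..k}. h x (e i) = 0"
    using orthonormal_extend[OF step.prems step.hyps(2)] by blast
  have "\<forall>i\<in>{1..k}. h (e i) x = 0" using x(2) inner_product_sym[OF h] by metis
  with step.prems x have "orthonormal_upto h (e(Suc k := x)) (Suc k)"
    by (auto simp: orthonormal_upto_def le_Suc_eq)
  from step.IH[OF this] show ?case by fastforce
qed

lemma orthonormal_basis_onb: "orthonormal_basis h (onb h)"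
proof -
  have "\<exists>e. orthonormal_basis h e"
    using orthonormal_basis_extends[of _ 0] by (auto simp: orthonormal_upto_def)
  then show ?thesis unfolding onb_def by (rule someI_ex)
qed

text \<open>The invariants are defined by the basis that \<open>onb\<close> chooses, whereas the
  algebra needs a basis adapted to the plane. This lemma and the next one bridge the gap.\<close>

lemma trace_independent:
  fixes \<beta> :: "'f \<Rightarrow> 'f \<Rightarrow> 'v::real_vector"
  assumes \<beta>: "bilinear \<beta>" and e: "orthonormal_basis h e" and f: "orthonormal_basis h f"
  shows "(\<Sum>i\<in>{1..DIM('f)}. \<beta> (e i) (e i)) = (\<Sum>i\<in>{1..DIM('f)}. \<beta> (f i) (f i))"
proof -
  let ?I = "{1..DIM('f)}"
  have l: "linear (\<lambda>x. \<beta> x y)" "linear (\<beta> y)" for y using \<beta> by (auto simp: bilinear_def)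
  have "\<beta> (e i) (e i) = (\<Sum>k\<in>?I. h (e i) (f k) *\<^sub>R \<beta> (f k) (e i))" for i
    by (subst (1) orthonormal_basis_expansion[OF f, of "e i"]) (simp add: linear_sum[OF l(1)] linear_cmul[OF l(1)])
  then have "(\<Sum>i\<in>?I. \<beta> (e i) (e i)) = (\<Sum>k\<in>?I. \<Sum>i\<in>?I. h (f k) (e i) *\<^sub>R \<beta> (f k) (e i))"
    by (simp add: inner_product_sym[OF h, of "e _"]) (rule sum.swap)
  also have "\<dots> = (\<Sum>k\<in>?I. \<beta> (f k) (\<Sum>i\<in>?I. h (f k) (e i) *\<^sub>R e i))"
    by (simp add: linear_sum[OF l(2)] linear_cmul[OF l(2)])
  finally show ?thesis by (simp only: orthonormal_basis_expansion[OF e, symmetric])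
qed

lemma hilbert_schmidt_independent:
  fixes k :: "'e::real_vector \<Rightarrow> 'e \<Rightarrow> real"
  assumes k: "bilinear k" and s: "bilinear s" and e: "orthonormal_basis h e" and f: "orthonormal_basis h f"
  shows "(\<Sum>i\<in>{1..DIM('f)}. \<Sum>j\<in>{1..DIM('f)}. k (s (e i) (e j)) (s (e i) (e j))) =
    (\<Sum>i\<in>{1..DIM('f)}. \<Sum>j\<in>{1..DIM('f)}. k (s (f i) (f j)) (s (f i) (f j)))"
proof -
  note sk = bilinear_ladd[OF s] bilinear_radd[OF s] bilinear_lmul[OF s] bilinear_rmul[OF s]
      bilinear_ladd[OF k] bilinear_radd[OF k] bilinear_lmul[OF k] bilinear_rmul[OF k]
  \<comment> \<open>One index is changed at a time, each change being an invariance of a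
    trace.\<close>
  have 1: "bilinear (\<lambda>x y. k (s a x) (s a y))" for a
    unfolding bilinear_def by (auto intro!: linearI simp: sk)
  have 2: "bilinear (\<lambda>x y. \<Sum>j\<in>{1..DIM('f)}. k (s x (f j)) (s y (f j)))"
    unfolding bilinear_def by (auto intro!: linearI simp: sk sum.distrib sum_distrib_left)
  show ?thesis
    using trace_independent[OF 1 e f] trace_independent[OF 2 e f] by simp
qed

end

section \<open>Sums over pairs and the identity behind Chen's inequality\<close>

lemma sum_pairs_sym:
  fixes k :: "nat \<Rightarrow> nat \<Rightarrow> real"
  assumes "\<And>i j. k i j = k j i"
  shows "2 * (\<Sum>i\<in>{1..n}. \<Sum>j\<in>{i<..n}. k i j) = (\<Sum>i\<in>{1..n}. \<Sum>j\<in>{1..n}. k i j) - (\<Sum>i\<in>{1..n}. k i i)"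
proof (induction n)
  case (Suc n)
  have "(\<Sum>i\<in>{1..Suc n}. \<Sum>j\<in>{i<..Suc n}. k i j) = (\<Sum>i\<in>{1..n}. \<Sum>j\<in>{i<..Suc n}. k i j)" by simp
  also have "\<dots> = (\<Sum>i\<in>{1..n}. k i (Suc n) + (\<Sum>j\<in>{i<..n}. k i j))"
  proof (rule sum.cong[OF refl])
    fix i assume "i \<in> {1..n}"
    then have "{i<..Suc n} = insert (Suc n) {i<..n}" by auto
    then show "(\<Sum>j\<in>{i<..Suc n}. k i j) = k i (Suc n) + (\<Sum>j\<in>{i<..n}. k i j)" by simp
  qed
  finally have "(\<Sum>i\<in>{1..Suc n}. \<Sum>j\<in>{i<..Suc n}. k i j) =
    (\<Sum>i\<in>{1..n}. k i (Suc n)) + (\<Sum>i\<in>{1..n}. \<Sum>j\<in>{i<..n}. k i j)" by (simp add: sum.distrib)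
  moreover have "(\<Sum>i\<in>{1..n}. k (Suc n) i) = (\<Sum>i\<in>{1..n}. k i (Suc n))"
    by (rule sum.cong[OF refl assms])
  ultimately show ?case
    using Suc.IH by (simp add: sum.distrib)
qed simp

lemma sum_pairs_const: "(\<Sum>i\<in>{1..n}. \<Sum>j\<in>{i<..n}. (r::real)) = r * (real n * (real n - 1) / 2)"
  using sum_pairs_sym[of "\<lambda>i j. r" n] by (simp add: algebra_simps)

text \<open>The number of summands left after merging the first two of \<open>n\<close> is \<open>n - 1\<close>; this is where the
  factor of Chen's inequality comes from.\<close>

lemma chen_sum_of_squares:
  fixes k :: "'e::real_vector \<Rightarrow> 'e \<Rightarrow> real" and a :: "nat \<Rightarrow> nat \<Rightarrow> 'e"
  assumes k: "bilinear k" and sym: "\<And>x y. k x y = k y x" and n: "2 < n"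
  defines "b \<equiv> \<lambda>i. if i = 2 then a 1 1 + a 2 2 else a i i"
    and "t \<equiv> (\<Sum>i\<in>{1..n}. a i i)"
  shows "(\<Sum>i\<in>{1..n}. \<Sum>j\<in>{i<..n}. k (a i j) (a i j) - k (a i i) (a j j)) - (k (a 1 2) (a 1 2) - k (a 1 1) (a 2 2)) +
      (real n - 2) / (2 * (real n - 1)) * k t t =
    (\<Sum>i\<in>{1..n}. \<Sum>j\<in>{i<..n}. if i = 1 \<and> j = 2 then 0 else k (a i j) (a i j)) +
    (\<Sum>i\<in>{2..n}. k (b i - (1 / (real n - 1)) *\<^sub>R t) (b i - (1 / (real n - 1)) *\<^sub>R t)) / 2"
proof -
  have l: "linear (\<lambda>x. k x y)" "linear (k y)" for y using k by (auto simp: bilinear_def)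
  have n1: "real n - 1 \<noteq> 0" using n by simp
  let ?P = "\<lambda>f. (\<Sum>i\<in>{1..n}. \<Sum>j\<in>{i<..n}. f i j) :: real"
  have split: "{1..n} = insert 1 (insert 2 {3..n})" "{2..n} = insert 2 {3..n}" using n by auto
  have "2 * ?P (\<lambda>i j. k (a i i) (a j j)) = (\<Sum>i\<in>{1..n}. \<Sum>j\<in>{1..n}. k (a i i) (a j j)) - (\<Sum>i\<in>{1..n}. k (a i i) (a i i))"
    by (rule sum_pairs_sym) (rule sym)
  moreover have "(\<Sum>i\<in>{1..n}. \<Sum>j\<in>{1..n}. k (a i i) (a j j)) = k t t"
    unfolding t_def linear_sum[OF l(2)] linear_sum[OF l(1)] by (rule sum.swap)
  ultimately have A: "2 * ?P (\<lambda>i j. k (a i i) (a j j)) = k t t - (\<Sum>i\<in>{1..n}. k (a i i) (a i i))" by simp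
  have B: "?P (\<lambda>i j. if i = 1 \<and> j = 2 then 0 else k (a i j) (a i j)) = ?P (\<lambda>i j. k (a i j) (a i j)) - k (a 1 2) (a 1 2)"
  proof -
    have *: "(if i = 1 \<and> j = 2 then 0 else k (a i j) (a i j)) =
       k (a i j) (a i j) - (if i = 1 then if j = 2 then k (a 1 2) (a 1 2) else 0 else 0)" for i j by simp
    have "?P (\<lambda>i j. if i = 1 then if j = 2 then k (a 1 2) (a 1 2) else 0 else 0) =
      (\<Sum>i\<in>{1..n}. if i = 1 then k (a 1 2) (a 1 2) else 0)"
      by (intro sum.cong refl) (use n in auto)
    then show ?thesis unfolding * sum_subtractf using n by simp
  qed
  \<comment> \<open>Merging the first two diagonal entries keeps the sum \<open>t\<close>, while in
    the sum of squared lengths it creates the product of \<open>a 1 1\<close> and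
    \<open>a 2 2\<close> that belongs to the omitted plane.\<close>
  have t: "t = (\<Sum>i\<in>{2..n}. b i)"
    unfolding t_def split by (simp add: b_def add.assoc)
  have C: "(\<Sum>i\<in>{2..n}. k (b i) (b i)) = (\<Sum>i\<in>{1..n}. k (a i i) (a i i)) + 2 * k (a 1 1) (a 2 2)"
    unfolding split by (simp add: b_def bilinear_ladd[OF k] bilinear_radd[OF k] sym[of "a 2 2" "a (Suc 0) (Suc 0)"])
  let ?r = "1 / (real n - 1)"
  have "k (b i - r *\<^sub>R t) (b i - r *\<^sub>R t) = k (b i) (b i) - 2 * r * k (b i) t + r * r * k t t" for i r
    by (simp add: bilinear_lsub[OF k] bilinear_rsub[OF k] bilinear_lmul[OF k] bilinear_rmul[OF k] sym[of t "b i"]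
        algebra_simps)
  from this[of _ ?r] have "(\<Sum>i\<in>{2..n}. k (b i - ?r *\<^sub>R t) (b i - ?r *\<^sub>R t)) =
      (\<Sum>i\<in>{2..n}. k (b i) (b i)) - 2 * ?r * (\<Sum>i\<in>{2..n}. k (b i) t) + (real n - 1) * (?r * ?r * k t t)"
    using n by (simp add: sum.distrib sum_subtractf sum_distrib_left of_nat_diff)
  also have "(\<Sum>i\<in>{2..n}. k (b i) t) = k t t"
    by (simp only: linear_sum[OF l(1), symmetric] t[symmetric])
  also have "(real n - 1) * (?r * ?r * k t t) = ?r * k t t" using n1 by simp
  finally have D: "(\<Sum>i\<in>{2..n}. k (b i - ?r *\<^sub>R t) (b i - ?r *\<^sub>R t)) = (\<Sum>i\<in>{2..n}. k (b i) (b i)) - ?r * k t t"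
    by simp
  have E: "(real n - 2) / (2 * (real n - 1)) * k t t = k t t / 2 - ?r * k t t / 2"
    using n1 by (simp add: field_simps)
  show ?thesis
    unfolding sum_subtractf B D C E using A by (simp add: diff_divide_distrib add_divide_distrib)
qed

section \<open>Lagrangian submanifolds\<close>

text \<open>All summands of the identity are nonnegative, so \<open>Q a \<le> 0\<close> kills each
  of them. The entry of the plane is masked and index 2 carries the merged vector, hence the bounds
  by 3. The hypothesis is an inequality so that it can be applied to two forms of which only the sum
  of the \<open>Q\<close> is known to vanish.\<close>

lemma chen_equality_shape:
  fixes k :: "'e::real_vector \<Rightarrow> 'e \<Rightarrow> real" and a a' :: "nat \<Rightarrow> nat \<Rightarrow> 'e"
  assumes k: "inner_product k" and n: "2 < n"
  defines "Q \<equiv> \<lambda>a. (\<Sum>i\<in>{1..n}. \<Sum>j\<in>{i<..n}. k (a i j) (a i j) - k (a i i) (a j j)) -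
      (k (a 1 2) (a 1 2) - k (a 1 1) (a 2 2)) +
      (real n - 2) / (2 * (real n - 1)) * k (\<Sum>i\<in>{1..n}. a i i) (\<Sum>i\<in>{1..n}. a i i)"
  shows "0 \<le> Q a"
    and "Q a \<le> 0 \<Longrightarrow> 1 \<le> i \<Longrightarrow> i < j \<Longrightarrow> j \<le> n \<Longrightarrow> 3 \<le> j \<Longrightarrow> a i j = 0"
    and "Q a \<le> 0 \<Longrightarrow> 3 \<le> i \<Longrightarrow> i \<le> n \<Longrightarrow> a i i = (1 / (real n - 1)) *\<^sub>R (\<Sum>i\<in>{1..n}. a i i)"
proof -
  define f where "f = (\<lambda>i j. if i = 1 \<and> j = 2 then 0 else k (a i j) (a i j))"
  define r where "r i = (if i = 2 then a 1 1 + a 2 2 else a i i) - (1 / (real n - 1)) *\<^sub>R (\<Sum>i\<in>{1..n}. a i i)" for i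
  define q where "q i = k (r i) (r i)" for i
  have Q: "Q a = (\<Sum>i\<in>{1..n}. \<Sum>j\<in>{i<..n}. f i j) + (\<Sum>i\<in>{2..n}. q i) / 2"
    unfolding Q_def f_def q_def r_def
    by (rule chen_sum_of_squares[OF inner_product_bilinear[OF k] inner_product_sym[OF k] n])
  have f: "0 \<le> f i j" and g: "0 \<le> q i" for i j
    using inner_product_nonneg[OF k] by (auto simp: f_def q_def)
  have F: "0 \<le> (\<Sum>j\<in>{i<..n}. f i j)" for i by (rule sum_nonneg) (rule f)
  have sf: "0 \<le> (\<Sum>i\<in>{1..n}. \<Sum>j\<in>{i<..n}. f i j)" by (rule sum_nonneg) (rule F)
  have sg: "0 \<le> (\<Sum>i\<in>{2..n}. q i)" by (rule sum_nonneg) (rule g)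
  show "0 \<le> Q a" using Q sf sg by simp
  show "a i j = 0" if "Q a \<le> 0" "1 \<le> i" "i < j" "j \<le> n" "3 \<le> j" for i j
  proof -
    have "(\<Sum>i\<in>{1..n}. \<Sum>j\<in>{i<..n}. f i j) = 0" using Q sf sg that(1) by linarith
    then have "(\<Sum>j\<in>{i<..n}. f i j) = 0"
      using sum_nonneg_eq_0_iff[of "{1..n}" "\<lambda>i. \<Sum>j\<in>{i<..n}. f i j"] F that by simp
    then have "f i j = 0"
      using sum_nonneg_eq_0_iff[of "{i<..n}" "f i"] f[of i] that by simp
    then show ?thesis using that by (simp add: f_def inner_product_eq_0[OF k])
  qed
  show "a i i = (1 / (real n - 1)) *\<^sub>R (\<Sum>i\<in>{1..n}. a i i)" if "Q a \<le> 0" "3 \<le> i" "i \<le> n" for i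
  proof -
    have "(\<Sum>i\<in>{2..n}. q i) = 0" using Q sf sg that(1) by linarith
    then have "q i = 0" using sum_nonneg_eq_0_iff[of "{2..n}" q] g that by simp
    then show ?thesis using that by (simp add: q_def r_def inner_product_eq_0[OF k])
  qed
qed

text \<open>In dimension at least 4 every index \<open>k\<close> leaves an index \<open>i \<ge> 3\<close> different from \<open>k\<close>, and
  total symmetry turns the entry \<open>(i,i,k)\<close> of the cubic form into the vanishing entry \<open>(i,k,i)\<close>.\<close>

lemma trace_vanishes:
  fixes s :: "'f::euclidean_space \<Rightarrow> 'f \<Rightarrow> 'e::real_vector" and L :: "'e \<Rightarrow> 'f \<Rightarrow> real"
  assumes h: "inner_product h" and e: "orthonormal_basis h e" and n: "n = DIM('f)" "4 \<le> n"
    and L: "bilinear L" and cubic: "\<And>x y z. L (s x y) z = L (s x z) y"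
    and ssym: "\<And>x y. s x y = s y x"
    and off: "\<And>i j. 1 \<le> i \<Longrightarrow> i < j \<Longrightarrow> j \<le> n \<Longrightarrow> 3 \<le> j \<Longrightarrow> s (e i) (e j) = 0"
    and diag: "\<And>i. 3 \<le> i \<Longrightarrow> i \<le> n \<Longrightarrow> s (e i) (e i) = (1 / (real n - 1)) *\<^sub>R t"
  shows "L t z = 0"
proof -
  have "L t (e k) = 0" if k: "k \<in> {1..DIM('f)}" for k
  proof -
    obtain i where i: "3 \<le> i" "i \<le> n" "i \<noteq> k"
      using that[of 3] that[of 4] n(2) by (cases "k = 3") auto
    have "s (e i) (e k) = 0"
      using off[of i k] off[of k i] ssym[of "e i" "e k"] i k n by (cases "i < k") auto
    then have "L (s (e i) (e i)) (e k) = 0"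
      using cubic[of "e i" "e i" "e k"] bilinear_lzero[OF L] by simp
    then show ?thesis using diag[OF i(1,2)] n by (simp add: bilinear_lmul[OF L])
  qed
  moreover have l: "linear (L t)" using L by (simp add: bilinear_def)
  ultimately have "L t (\<Sum>i\<in>{1..DIM('f)}. h z (e i) *\<^sub>R e i) = 0"
    by (simp add: linear_sum[OF l] linear_cmul[OF l])
  then show ?thesis using orthonormal_basis_expansion[OF h e, of z] by simp
qed

lemma sum_cyclic_3:
  fixes f :: "3 \<Rightarrow> 'v::comm_monoid_add"
  shows "(\<Sum>\<alpha>\<in>UNIV. f \<alpha>) = f \<beta> + f (\<beta> + 1) + f (\<beta> + 2)"
proof -
  \<comment> \<open>In the type \<open>3\<close> the numerals 4 and 5 are 1 and 2; they arise from
    \<open>\<beta> + 1\<close> and \<open>\<beta> + 2\<close>.\<close>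
  have "f 4 = f 1" "f 5 = f 2" by (rule arg_cong[of _ _ f], simp)+
  then show ?thesis using exhaust_3[of \<beta>] by (auto simp: sum_3 add_ac)
qed

lemma cyclic_3: "(\<beta>::3) + 2 + 1 = \<beta>" "(\<beta>::3) + 2 + 2 = \<beta> + 1"
  using exhaust_3[of \<beta>] by auto

text \<open>After pairing with \<open>X\<close>, every summand with a \<open>J \<alpha>\<close>
  contains a factor \<open>h (J \<alpha> X) X\<close> or \<open>h (J \<alpha> Y) X\<close>. Only
  these values are assumed to vanish, so the lemma serves the conjugates as well.\<close>

lemma model_curvature_tangent:
  assumes h: "bilinear h" and J: "\<And>\<alpha>. h (J \<alpha> X) X = 0" "\<And>\<alpha>. h (J \<alpha> Y) X = 0"
  shows "h (model_curvature c h J X Y Y) X = c / 4 * (h Y Y * h X X - h X Y * h Y X)"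
proof -
  have l: "linear (\<lambda>x. h x X)" using h by (simp add: bilinear_def)
  show ?thesis
    unfolding model_curvature_def
    by (simp add: linear_sum[OF l] linear_add[OF l] linear_diff[OF l] linear_cmul[OF l] J)
qed

lemma quaternionic_frameD:
  assumes "quaternionic_frame N \<Lambda> U J"
  shows "openin (mtop N) U"
    and "p \<in> U \<Longrightarrow> linear (J \<alpha> p)"
    and "p \<in> U \<Longrightarrow> J \<alpha> p (J \<alpha> p v) = - v"
    and "p \<in> U \<Longrightarrow> J \<alpha> p (J (\<alpha> + 1) p v) = J (\<alpha> + 2) p v"
    and "p \<in> U \<Longrightarrow> J (\<alpha> + 1) p (J \<alpha> p v) = - J (\<alpha> + 2) p v"
    and "openin (mtop N) V \<Longrightarrow> V \<subseteq> U \<Longrightarrow> smooth_vf N V X \<Longrightarrow> smooth_vf N V (\<lambda>p. J \<alpha> p (X p))"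
  using assms unfolding quaternionic_frame_def by blast+

locale lagrangian_point = submanifold_point M N g p
  for M :: "('a, 'f::euclidean_space) manifold" and N :: "('a, 'e::euclidean_space) manifold"
    and g :: "('a, 'e) metric" and p :: 'a +
  fixes \<Lambda> :: "'a \<Rightarrow> ('e \<Rightarrow> 'e) set" and U :: "'a set" and J :: "3 \<Rightarrow> 'a \<Rightarrow> 'e \<Rightarrow> 'e"
  assumes frame: "quaternionic_frame N \<Lambda> U J" and pU: "p \<in> U" and lag: "lagrangian M N g \<Lambda>"
begin

lemmas openU = quaternionic_frameD(1)[OF frame]
lemmas linear_J = quaternionic_frameD(2)[OF frame pU]

lemma totally_real: "q \<in> U \<Longrightarrow> q \<in> points M \<Longrightarrow> g q (J \<alpha> q (incl_deriv M N q u)) (incl_deriv M N q v) = 0"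
  using lag frame unfolding lagrangian_def totally_real_def by blast

lemma totally_real': "g p (\<iota> u) (J \<alpha> p (\<iota> v)) = 0"
  using totally_real[OF pU p] inner_product_sym[OF ip_N] by metis

lemma J_sum:
  "J \<beta> p (\<Sum>\<alpha>\<in>UNIV. J \<alpha> p (X \<alpha>)) = - X \<beta> + J (\<beta> + 2) p (X (\<beta> + 1)) - J (\<beta> + 1) p (X (\<beta> + 2))"
proof -
  \<comment> \<open>The anticommuted relation at index \<open>\<beta> + 2\<close>, read modulo
    3.\<close>
  have "J \<beta> p (J (\<beta> + 2) p v) = - J (\<beta> + 1) p v" for v
    using quaternionic_frameD(5)[OF frame pU, of "\<beta> + 2" v] unfolding cyclic_3 .
  then show ?thesis
    unfolding sum_cyclic_3[of _ \<beta>]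
    by (simp add: linear_add[OF linear_J] quaternionic_frameD(3,4)[OF frame pU])
qed

lemma metric_J_sum: "g p (J \<beta> p (\<Sum>\<alpha>\<in>UNIV. J \<alpha> p (\<iota> (X \<alpha>)))) (\<iota> v) = - g p (\<iota> (X \<beta>)) (\<iota> v)"
  unfolding J_sum
  by (simp add: bilinear_ladd[OF bil_N] bilinear_lsub[OF bil_N] bilinear_lneg[OF bil_N] totally_real[OF pU p])

lemma metric_sum_J: "g p (\<Sum>\<alpha>\<in>UNIV. J \<alpha> p (\<iota> (X \<alpha>))) (\<iota> v) = 0"
  by (simp add: sum_3 bilinear_ladd[OF bil_N] totally_real[OF pU p])

text \<open>A dimension count. The map \<open>\<Phi>\<close> is injective: pairing with tangent
  vectors isolates \<open>X0\<close>, and applying \<open>J \<beta>\<close> first isolates the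
  component \<open>X \<beta>\<close> up to sign. Triples are encoded in \<open>'f ^ 3\<close> so
  that the domain is Euclidean of dimension \<open>4 * DIM('f)\<close>.\<close>

lemma tangent_decomposition: "\<exists>X0 X. w = \<iota> X0 + (\<Sum>\<alpha>\<in>UNIV. J \<alpha> p (\<iota> (X \<alpha>)))"
proof -
  define \<Phi> :: "'f \<times> ('f ^ 3) \<Rightarrow> 'e" where
    "\<Phi> = (\<lambda>(X0, X). \<iota> X0 + (\<Sum>\<alpha>\<in>UNIV. J \<alpha> p (\<iota> (X $ \<alpha>))))"
  have lin: "linear \<Phi>"
    by (rule linearI) (auto simp: \<Phi>_def sum_3 linear_add[OF linear_incl] linear_add[OF linear_J]
        linear_cmul[OF linear_incl] linear_cmul[OF linear_J] scaleR_add_right)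
  have "x = 0" if x: "\<Phi> x = 0" for x
  proof -
    obtain X0 X where X: "x = (X0, X)" by (cases x)
    have z: "\<iota> X0 + (\<Sum>\<alpha>\<in>UNIV. J \<alpha> p (\<iota> (X $ \<alpha>))) = 0" using x by (simp add: \<Phi>_def X)
    have "g p (\<iota> X0) (\<iota> X0) = g p (\<iota> X0 + (\<Sum>\<alpha>\<in>UNIV. J \<alpha> p (\<iota> (X $ \<alpha>)))) (\<iota> X0)"
      by (simp add: bilinear_ladd[OF bil_N] metric_sum_J)
    then have "induced_metric M N g p X0 X0 = 0"
      unfolding z by (simp add: induced_metric_def bilinear_lzero[OF bil_N])
    then have X0: "X0 = 0" by (simp add: inner_product_eq_0[OF ip_M])
    then have s0: "(\<Sum>\<alpha>\<in>UNIV. J \<alpha> p (\<iota> (X $ \<alpha>))) = 0" using z by (simp add: linear_0[OF linear_incl])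
    have "X $ \<beta> = 0" for \<beta>
    proof -
      have "induced_metric M N g p (X $ \<beta>) (X $ \<beta>) = 0"
        using metric_J_sum[of \<beta> "\<lambda>\<alpha>. X $ \<alpha>" "X $ \<beta>"] unfolding s0
        by (simp add: induced_metric_def linear_0[OF linear_J] bilinear_lzero[OF bil_N])
      then show ?thesis by (simp add: inner_product_eq_0[OF ip_M])
    qed
    then have "X = 0" by (simp add: vec_eq_iff)
    with X0 show "x = 0" by (simp add: X zero_prod_def)
  qed
  then have "inj \<Phi>" using linear_injective_0[OF lin] by blast
  moreover have "DIM('e) = DIM('f \<times> ('f ^ 3))" using lag by (simp add: lagrangian_def)
  ultimately have "surj \<Phi>" by (intro linear_injective_imp_surjective[OF lin]) (auto simp: dim_UNIV)
  then obtain x where "w = \<Phi> x" by (metis surjD)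
  then show ?thesis by (cases x) (auto simp: \<Phi>_def)
qed

lemma normal_eq_0_if_metric_J:
  assumes w: "\<And>v. g p w (\<iota> v) = 0" and J: "\<And>\<alpha> v. g p w (J \<alpha> p (\<iota> v)) = 0"
  shows "w = 0"
proof -
  obtain X0 X where d: "w = \<iota> X0 + (\<Sum>\<alpha>\<in>UNIV. J \<alpha> p (\<iota> (X \<alpha>)))" using tangent_decomposition by blast
  have "g p w w = 0"
    by (subst (2) d) (simp add: sum_3 bilinear_radd[OF bil_N] w J)
  then show ?thesis by (simp add: inner_product_eq_0[OF ip_N])
qed

text \<open>Normality removes the tangential summand of the decomposition, and the tangential part
  of \<open>J \<beta> p w\<close> is then the component \<open>X \<beta>\<close> up to sign. As
  \<open>J \<beta>\<close> need not be skew for the metric, this criterion is not a restatement of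
  the previous one.\<close>

lemma normal_eq_0_if_J_normal:
  assumes w: "\<And>v. g p w (\<iota> v) = 0" and J: "\<And>\<alpha> v. g p (J \<alpha> p w) (\<iota> v) = 0"
  shows "w = 0"
proof -
  obtain X0 X where d: "w = \<iota> X0 + (\<Sum>\<alpha>\<in>UNIV. J \<alpha> p (\<iota> (X \<alpha>)))" using tangent_decomposition by blast
  have "induced_metric M N g p X0 X0 = 0"
    using w[of X0] by (simp add: d induced_metric_def bilinear_ladd[OF bil_N] metric_sum_J)
  then have "X0 = 0" by (simp add: inner_product_eq_0[OF ip_M])
  then have d': "w = (\<Sum>\<alpha>\<in>UNIV. J \<alpha> p (\<iota> (X \<alpha>)))" using d by (simp add: linear_0[OF linear_incl])
  have "X \<beta> = 0" for \<beta>
  proof -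
    have "induced_metric M N g p (X \<beta>) (X \<beta>) = 0"
      using J[of \<beta> "X \<beta>"] metric_J_sum[of \<beta> X "X \<beta>"] by (simp add: d' induced_metric_def)
    then show ?thesis by (simp add: inner_product_eq_0[OF ip_M])
  qed
  then show ?thesis using d' by (simp add: linear_0[OF linear_incl] linear_0[OF linear_J])
qed

text \<open>Differentiate \<open>g(Y, J\<^sub>\<alpha> Z) = 0\<close> along \<open>M\<close>; the forms \<open>\<omega>\<^sub>\<alpha>\<close> contribute only terms \<open>g(Y, J\<^sub>\<beta> Z) = 0\<close>.\<close>

lemma second_ff_J:
  assumes D: "affine_connection N D" and D': "affine_connection N D'" and dual: "dual_connections N g D D'"
    and kaehler: "\<And>V X Y \<alpha> q. openin (mtop N) V \<Longrightarrow> V \<subseteq> U \<Longrightarrow> smooth_vf N V X \<Longrightarrow> smooth_vf N V Y \<Longrightarrow> q \<in> V \<Longrightarrow>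
      D X (\<lambda>r. J \<alpha> r (Y r)) q - J \<alpha> q (D X Y q) =
        \<omega> (\<alpha> + 2) q (X q) *\<^sub>R J (\<alpha> + 1) q (Y q) - \<omega> (\<alpha> + 1) q (X q) *\<^sub>R J (\<alpha> + 2) q (Y q)"
  shows "g p (second_ff M N g D' p u v) (J \<alpha> p (\<iota> w)) = - g p (\<iota> v) (J \<alpha> p (second_ff M N g D p u w))"
proof -
  define V where "V = fst cN \<inter> U"
  have V: "openin (mtop N) V" "V \<subseteq> U" "p \<in> V" "V \<subseteq> fst cN"
    using openin_chart[OF smooth_N chart_N(1)] openU pU chart_N(2) by (auto simp: V_def)
  let ?S = "snd cM ` (fst cM \<inter> V)" and ?x = "snd cM p"
  have S: "open ?S" "?x \<in> ?S"
    using open_submanifold_chart_image[OF sub chart_M(1) V(1)] chart_M(2) V(3) by auto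
  let ?C = "const_vf N p" and ?T = "second_derivative \<phi> ?x" and ?d = "\<lambda>x v. frechet_derivative \<phi> (at x) v"
  have sC: "smooth_vf N V (?C a)" for a
    using smooth_vf_subset[OF smooth_N smooth_const_vf[OF smooth_N pN] V(4)] .
  note sJ = quaternionic_frameD(6)[OF frame V(1,2) sC]
  have Cp: "?C a p = a" for a by (rule const_vf_at[OF smooth_N pN])
  have CN: "?C = coord_vf N cN" by (simp add: const_vf_eq)
  have injM: "inj_on (snd cM) (fst cM)" and injN: "inj_on (snd cN) (fst cN)"
    using compat_MN by (auto simp: compat_def)
  have inv: "chart_inv cN (\<phi> (snd cM q)) = q" if "q \<in> fst cM" "q \<in> V" for q
    using that V(4) injM injN by auto
  have \<iota>: "?d ?x v = \<iota> v" for v by (simp add: incl_deriv_def fun_eq_iff)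
  define f where "f y a b = g (chart_inv cN y) (?C a (chart_inv cN y)) (J \<alpha> (chart_inv cN y) (?C b (chart_inv cN y)))"
    for y a b
  have smf: "smooth_fun N V (\<lambda>q. g q (?C a q) (J \<alpha> q (?C b q)))" for a b
    using gN V(1) sC[of a] sJ[of \<alpha> b] unfolding riemannian_metric_def by blast
  \<comment> \<open>Duality is used in the swapped order, so that \<open>D\<close> falls on the
    field containing \<open>J\<close>, for which the Kaehler-like equation is given.\<close>
  have dirf: "dir_deriv N (?C t) (\<lambda>q. g q (?C a q) (J \<alpha> q (?C b q))) p =
     g p (D' (?C t) (?C a) p) (J \<alpha> p b) + g p a (J \<alpha> p (D (?C t) (?C b) p) +
      (\<omega> (\<alpha> + 2) p t *\<^sub>R J (\<alpha> + 1) p b - \<omega> (\<alpha> + 1) p t *\<^sub>R J (\<alpha> + 2) p b))" for t a b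
  proof -
    have "A = B + C" if "A - B = C" for A B C :: 'e using that by (simp add: algebra_simps)
    from this[OF kaehler[OF V(1,2) sC sC V(3), of t \<alpha> b]]
    show ?thesis
      using dual_connectionsD[OF dual_connections_sym[OF smooth_N gN dual] V(1) sC sC sJ V(3)]
      by (simp only: Cp)
  qed
  have der_\<phi>: "(\<phi> has_derivative \<iota>) (at ?x)"
    unfolding incl_deriv_eq by (rule compat_has_derivative[OF compat_MN chart_M(2) chart_N(2)])
  have f': "((\<lambda>x. f (\<phi> x) a b) has_derivative
      (\<lambda>t. dir_deriv N (?C (\<iota> t)) (\<lambda>q. g q (?C a q) (J \<alpha> q (?C b q))) p)) (at ?x)" for a b
  proof -
    let ?h = "\<lambda>q. g q (?C a q) (J \<alpha> q (?C b q))"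
    have "(?h \<circ> chart_inv cN) differentiable (at (\<phi> ?x))"
      using smooth_fun_differentiable[OF smooth_N chart_N(1) smf V(3) chart_N(2)] injM chart_M by simp
    from has_derivative_compose[OF der_\<phi> this[unfolded frechet_derivative_works]]
    show ?thesis using injM chart_M by (simp add: dir_deriv_def Cp f_def comp_def)
  qed
  have bilf: "bilinear (f (\<phi> x))" if x: "x \<in> ?S" for x
  proof -
    obtain q where q: "x = snd cM q" "q \<in> fst cM" "q \<in> V" using x by auto
    have qN: "q \<in> fst cN" using q V by auto
    note l = linear_coord_vf[OF smooth_N chart_N(1) qN, folded CN]
      and b = metric_bilinear(1)[OF gN chart_points[OF smooth_N chart_N(1) qN]]
    have j: "linear (J \<alpha> q)" using quaternionic_frameD(2)[OF frame] q V by blast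
    show ?thesis
      unfolding f_def[abs_def] bilinear_def q(1) inv[OF q(2,3)]
      by (auto intro!: linearI simp: linear_add[OF l] linear_cmul[OF l] linear_add[OF j] linear_cmul[OF j]
          bilinear_ladd[OF b] bilinear_radd[OF b] bilinear_lmul[OF b] bilinear_rmul[OF b])
  qed
  have fx: "f (\<phi> ?x) a b = g p a (J \<alpha> p b)" for a b
    by (simp only: f_def inv[OF chart_M(2) V(3)] Cp)
  have d1: "((\<lambda>x. ?d x a) has_derivative (\<lambda>t. ?T t a)) (at ?x)" for a
    using smooth_on_differentiable[OF smooth_on_frechet[OF smooth_\<phi>] mem_\<phi>]
    unfolding second_derivative_def frechet_derivative_works .
  have "((\<lambda>x. f (\<phi> x) (?d x v) (?d x w)) has_derivative
     (\<lambda>t. dir_deriv N (?C (\<iota> t)) (\<lambda>q. g q (?C (\<iota> v) q) (J \<alpha> q (?C (\<iota> w) q))) p +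
        g p (\<iota> v) (J \<alpha> p (?T t w)) + g p (?T t v) (J \<alpha> p (\<iota> w)))) (at ?x)"
    using has_derivative_bilinear_apply[where B = "\<lambda>x. f (\<phi> x)", OF S bilf f' d1[of v] d1[of w]]
    unfolding fx \<iota> .
  moreover have "((\<lambda>x. f (\<phi> x) (?d x v) (?d x w)) has_derivative (\<lambda>t. 0)) (at ?x)"
  proof (rule has_derivative_transform_within_open[OF has_derivative_const[of 0] S])
    fix x assume "x \<in> ?S"
    then obtain q where q: "x = snd cM q" "q \<in> fst cM" "q \<in> V" by auto
    then have qM: "q \<in> points M" and qN: "q \<in> fst cN" and qU: "q \<in> U"
      using chart_points[OF smooth_M chart_M(1)] V by auto
    have C: "?C (?d x a) q = incl_deriv M N q (coord_vf M cM a q)" for a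
      unfolding CN incl_deriv_coord_vf(1)[OF sub chart_M(1) q(2)]
        incl_deriv_coord_vf(2)[OF sub chart_M(1) q(2) chart_N(1) qN, symmetric] by (simp add: chart_deriv_def q(1))
    have "f (\<phi> x) (?d x v) (?d x w) = g q (?C (?d x v) q) (J \<alpha> q (?C (?d x w) q))"
      by (simp only: f_def q(1) inv[OF q(2,3)])
    also have "\<dots> = 0"
      unfolding C metric_bilinear(2)[OF gN chart_points[OF smooth_N chart_N(1) qN], of "incl_deriv M N q (coord_vf M cM v q)"]
      by (rule totally_real[OF qU qM])
    finally show "0 = f (\<phi> x) (?d x v) (?d x w)" by simp
  qed
  ultimately have "dir_deriv N (?C (\<iota> u)) (\<lambda>q. g q (?C (\<iota> v) q) (J \<alpha> q (?C (\<iota> w) q))) p +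
        g p (\<iota> v) (J \<alpha> p (?T u w)) + g p (?T u v) (J \<alpha> p (\<iota> w)) = 0"
    using has_derivative_unique by (metis (no_types, lifting))
  then have main: "g p (cov_along M N D' p u (\<lambda>q. incl_deriv M N q (const_vf M p v q))) (J \<alpha> p (\<iota> w)) +
      g p (\<iota> v) (J \<alpha> p (cov_along M N D p u (\<lambda>q. incl_deriv M N q (const_vf M p w q)))) = 0"
    unfolding dirf cov_along_const[OF D] cov_along_const[OF D']
    by (simp add: bilinear_ladd[OF bil_N] bilinear_radd[OF bil_N] bilinear_rsub[OF bil_N] bilinear_rmul[OF bil_N]
        linear_add[OF linear_J] totally_real')
  then show ?thesis
    by (simp add: second_ff_def Let_def linear_diff[OF linear_J] bilinear_lsub[OF bil_N] bilinear_rsub[OF bil_N]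
        totally_real')
qed

end

section \<open>The equality case\<close>

text \<open>In \<open>cov_along\<close> the derivative of components does not involve the
  connection, and the other summand uses it on smooth coordinate fields only, where
  \<open>LC\<close> is the mean.\<close>

lemma cov_along_LC:
  assumes st: "statistical_manifold N g D D'" and q: "q \<in> points N"
  shows "cov_along M N (LC N g) q u V = (1 / 2) *\<^sub>R (cov_along M N D q u V + cov_along M N D' q u V)"
proof -
  have sm: "smooth_manifold N" using st by (simp add: statistical_manifold_def)
  have "LC N g (const_vf N q a) (const_vf N q b) q = mean_conn D D' (const_vf N q a) (const_vf N q b) q" for a b
    by (rule LC_mean_conn(2)[OF st openin_chart[OF sm chart_at(1)[OF sm q]] smooth_const_vf[OF sm q]
          smooth_const_vf[OF sm q] chart_at(2)[OF sm q]])
  then show ?thesis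
    by (simp add: cov_along_def mean_conn_def scaleR_add_right) (simp add: algebra_simps scaleR_half_double flip: scaleR_add_left)
qed

context lagrangian_point
begin

context
  fixes D D' :: "('a, 'e) connection" and c :: real
  assumes st: "statistical_manifold N g D D'"
    and stM: "statistical_manifold M (induced_metric M N g) (induced_conn M N g D) (induced_conn M N g D')"
    and sf: "quaternionic_space_form_like c N g D D' \<Lambda>"
begin

abbreviation (input) "gM \<equiv> induced_metric M N g"
abbreviation (input) "s \<equiv> second_ff M N g D p"
abbreviation (input) "s' \<equiv> second_ff M N g D' p"

lemma connN: "affine_connection N D" "torsion_free N D" "affine_connection N D'" "torsion_free N D'"
    "dual_connections N g D D'" "dual_connections N g D' D"
  and connM: "affine_connection M (induced_conn M N g D)" "torsion_free M (induced_conn M N g D)"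
    "affine_connection M (induced_conn M N g D')" "torsion_free M (induced_conn M N g D')"
    "dual_connections M gM (induced_conn M N g D) (induced_conn M N g D')"
    "dual_connections M gM (induced_conn M N g D') (induced_conn M N g D)"
  using st stM dual_connections_sym[OF smooth_N gN] dual_connections_sym[OF smooth_M gM]
  by (auto simp: statistical_manifold_def)

lemma LC_N: "affine_connection N (LC N g)" "torsion_free N (LC N g)" "dual_connections N g (LC N g) (LC N g)"
  and LC_M: "affine_connection M (LC M gM)" "torsion_free M (LC M gM)" "dual_connections M gM (LC M gM) (LC M gM)"
  using LC_mean_conn(1)[OF st] LC_mean_conn(1)[OF stM] by (auto simp: levi_civita_def)

text \<open>Both sides are means over the dual pair and the tangential projection is linear, so the
  classical fact needs no separate verification.\<close>

lemma LC_induced: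
  assumes "openin (mtop M) W" "smooth_vf M W X" "smooth_vf M W Y" "q \<in> W"
  shows "LC M gM X Y q = induced_conn M N g (LC N g) X Y q"
proof -
  have qM: "q \<in> points M" using assms openin_subset by blast
  interpret q: submanifold_point M N g q by unfold_locales (fact sub gM gN qM)+
  note l = q.linear_tangential
  show ?thesis
    unfolding LC_mean_conn(2)[OF stM assms] mean_conn_def induced_conn_def cov_along_LC[OF st q.pN]
      linear_cmul[OF l] linear_add[OF l] ..
qed

lemma second_ff_LC: "second_ff M N g (LC N g) p u v = (1 / 2) *\<^sub>R (s u v + s' u v)"
  unfolding second_ff_def Let_def cov_along_LC[OF st pN]
  by (simp add: linear_cmul[OF linear_tangential] linear_add[OF linear_tangential]
      linear_cmul[OF linear_incl] linear_add[OF linear_incl] algebra_simps)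

lemma ambient_curvature:
  assumes "orthonormal_pair (gM p) x y"
  shows "g p (curvature N D p (\<iota> x) (\<iota> y) (\<iota> y)) (\<iota> x) = c / 4"
    and "g p (curvature N D' p (\<iota> x) (\<iota> y) (\<iota> y)) (\<iota> x) = c / 4"
proof -
  have xy: "g p (\<iota> x) (\<iota> x) = 1" "g p (\<iota> y) (\<iota> y) = 1" "g p (\<iota> x) (\<iota> y) = 0"
    using assms by (auto simp: orthonormal_pair_def induced_metric_def)
  \<comment> \<open>Moving the conjugate to the other argument turns it into \<open>J\<close> up to
    sign, so the conjugates map tangent vectors to normal ones too.\<close>
  have conj: "g p (conj_endo (g p) (J \<alpha> p) (\<iota> u)) (\<iota> v) = 0" for \<alpha> u v
    using conj_endo[OF ip_N linear_J[of \<alpha>], of "\<iota> v" "\<iota> u"] totally_real[OF pU p]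
    by (simp add: inner_product_sym[OF ip_N, of "conj_endo (g p) (J \<alpha> p) (\<iota> u)"])
  have R: "curvature N D p X Y Z = model_curvature c (g p) (\<lambda>\<alpha>. J \<alpha> p) X Y Z"
    "curvature N D' p X Y Z = model_curvature c (g p) (\<lambda>\<alpha>. conj_endo (g p) (J \<alpha> p)) X Y Z" for X Y Z
    using sf frame pU unfolding quaternionic_space_form_like_def by blast+
  show "g p (curvature N D p (\<iota> x) (\<iota> y) (\<iota> y)) (\<iota> x) = c / 4"
    unfolding R by (subst model_curvature_tangent[OF bil_N]) (simp_all add: totally_real[OF pU p] xy)
  show "g p (curvature N D' p (\<iota> x) (\<iota> y) (\<iota> y)) (\<iota> x) = c / 4"
    unfolding R by (subst model_curvature_tangent[OF bil_N]) (simp_all add: conj xy)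
qed

text \<open>The mean of the two dual curvatures contributes the mixed products of \<open>s\<close>
  and \<open>s'\<close> with weight 1/2. Twice the Levi-Civita curvature of \<open>M\<close>
  contains the same mixed products with the same weight, besides the pure ones and twice the ambient
  sectional curvature. In the difference only pure products and \<open>c / 4\<close>
  survive.\<close>

lemma chen_integrand:
  assumes "orthonormal_pair (gM p) x y"
  shows "K_curv M gM (induced_conn M N g D) (induced_conn M N g D') p x y - sec_curv M gM p x y +
      2 * sec_curv N g p (\<iota> x) (\<iota> y) =
    c / 4 + (g p (s x y) (s x y) - g p (s x x) (s y y)) / 2 + (g p (s' x y) (s' x y) - g p (s' x x) (s' y y)) / 2"
proof -
  have 1: "gM p (curvature M (induced_conn M N g D) p x y y) x = c / 4 + g p (s y y) (s' x x) - g p (s x y) (s' y x)"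
    using gauss_equation[OF connN(1,2,3,5) connM(1,2,5) refl refl] ambient_curvature(1)[OF assms] by simp
  have 2: "gM p (curvature M (induced_conn M N g D') p x y y) x = c / 4 + g p (s' y y) (s x x) - g p (s' x y) (s y x)"
    using gauss_equation[OF connN(3,4,1,6) connM(3,4,6) refl refl] ambient_curvature(2)[OF assms] by simp
  have 3: "gM p (curvature M (LC M gM) p x y y) x = sec_curv N g p (\<iota> x) (\<iota> y) +
      g p (s y y + s' y y) (s x x + s' x x) / 4 - g p (s x y + s' x y) (s y x + s' y x) / 4"
    using gauss_equation[OF LC_N(1,2,1,3) LC_M LC_induced LC_induced, where u = x and v = y and w = y and z = x]
    by (simp add: second_ff_LC sec_curv_def bilinear_lmul[OF bil_N] bilinear_rmul[OF bil_N])
  have sym: "s y x = s x y" "s' y x = s' x y"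
    using second_ff_sym[OF connN(1,2)] second_ff_sym[OF connN(3,4)] by auto
  show ?thesis
    unfolding K_curv_def sec_curv_def[of M] 1 2 3 sym
    by (simp add: bilinear_ladd[OF bil_N] bilinear_radd[OF bil_N] inner_product_sym[OF ip_N, of "s y y" "s x x"]
        inner_product_sym[OF ip_N, of "s y y" "s' x x"] inner_product_sym[OF ip_N, of "s' y y" "s x x"]
        inner_product_sym[OF ip_N, of "s' y y" "s' x x"] inner_product_sym[OF ip_N, of "s' x y" "s x y"] field_simps)
qed

text \<open>Twice the sum is the Hilbert-Schmidt norm of \<open>t\<close> squared minus the squared
  length of its trace, and each of these is independent of the basis.\<close>

lemma sum_pairs_independent:
  assumes b: "bilinear t" and sym: "\<And>x y. t x y = t y x" and e: "orthonormal_basis (gM p) e" and f: "orthonormal_basis (gM p) f"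
  shows "(\<Sum>i\<in>{1..DIM('f)}. \<Sum>j\<in>{i<..DIM('f)}. g p (t (e i) (e j)) (t (e i) (e j)) - g p (t (e i) (e i)) (t (e j) (e j))) =
    (\<Sum>i\<in>{1..DIM('f)}. \<Sum>j\<in>{i<..DIM('f)}. g p (t (f i) (f j)) (t (f i) (f j)) - g p (t (f i) (f i)) (t (f j) (f j)))"
proof -
  let ?I = "{1..DIM('f)}"
  let ?k = "\<lambda>e i j. g p (t (e i) (e j)) (t (e i) (e j)) - g p (t (e i) (e i)) (t (e j) (e j))"
  have l: "linear (\<lambda>x. g p x y)" "linear (g p y)" for y using bil_N by (auto simp: bilinear_def)
  have "2 * (\<Sum>i\<in>?I. \<Sum>j\<in>{i<..DIM('f)}. ?k e i j) = (\<Sum>i\<in>?I. \<Sum>j\<in>?I. g p (t (e i) (e j)) (t (e i) (e j))) -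
     g p (\<Sum>i\<in>?I. t (e i) (e i)) (\<Sum>i\<in>?I. t (e i) (e i))" for e :: "nat \<Rightarrow> 'f"
  proof -
    have "?k e i j = ?k e j i" for i j
      using sym[of "e i" "e j"] inner_product_sym[OF ip_N, of "t (e i) (e i)" "t (e j) (e j)"] by simp
    then have "2 * (\<Sum>i\<in>?I. \<Sum>j\<in>{i<..DIM('f)}. ?k e i j) = (\<Sum>i\<in>?I. \<Sum>j\<in>?I. ?k e i j) - (\<Sum>i\<in>?I. ?k e i i)"
      by (rule sum_pairs_sym)
    also have "(\<Sum>i\<in>?I. ?k e i i) = 0" by simp
    also have "(\<Sum>i\<in>?I. \<Sum>j\<in>?I. ?k e i j) = (\<Sum>i\<in>?I. \<Sum>j\<in>?I. g p (t (e i) (e j)) (t (e i) (e j))) -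
        (\<Sum>i\<in>?I. \<Sum>j\<in>?I. g p (t (e i) (e i)) (t (e j) (e j)))"
      by (simp only: sum_subtractf)
    also have "(\<Sum>i\<in>?I. \<Sum>j\<in>?I. g p (t (e i) (e i)) (t (e j) (e j))) =
        g p (\<Sum>i\<in>?I. t (e i) (e i)) (\<Sum>i\<in>?I. t (e i) (e i))"
      unfolding linear_sum[OF l(2)] linear_sum[OF l(1)] by (rule sum.swap)
    finally show ?thesis by simp
  qed
  from this[of e] this[of f] show ?thesis
    using hilbert_schmidt_independent[OF ip_M bil_N b e f] trace_independent[OF ip_M b e f] by simp
qed

lemma sum_planes_integrand:
  assumes e: "orthonormal_basis (gM p) e"
  shows "sum_planes (gM p) (K_curv M gM (induced_conn M N g D) (induced_conn M N g D') p) -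
      sum_planes (gM p) (sec_curv M gM p) + 2 * sum_planes (gM p) (\<lambda>x y. sec_curv N g p (\<iota> x) (\<iota> y)) =
    c / 4 * (real DIM('f) * (real DIM('f) - 1) / 2) +
    (\<Sum>i\<in>{1..DIM('f)}. \<Sum>j\<in>{i<..DIM('f)}. g p (s (e i) (e j)) (s (e i) (e j)) - g p (s (e i) (e i)) (s (e j) (e j))) / 2 +
    (\<Sum>i\<in>{1..DIM('f)}. \<Sum>j\<in>{i<..DIM('f)}. g p (s' (e i) (e j)) (s' (e i) (e j)) - g p (s' (e i) (e i)) (s' (e j) (e j))) / 2"
proof -
  let ?o = "onb (gM p)" and ?n = "DIM('f)"
  note o = orthonormal_basis_onb[OF ip_M]
  let ?K = "K_curv M gM (induced_conn M N g D) (induced_conn M N g D') p"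
  let ?P = "\<lambda>s e i j. g p (s (e i) (e j)) (s (e i) (e j)) - g p (s (e i) (e i)) (s (e j) (e j))"
  have "sum_planes (gM p) ?K - sum_planes (gM p) (sec_curv M gM p) + 2 * sum_planes (gM p) (\<lambda>x y. sec_curv N g p (\<iota> x) (\<iota> y)) =
    (\<Sum>i\<in>{1..?n}. \<Sum>j\<in>{i<..?n}. ?K (?o i) (?o j) - sec_curv M gM p (?o i) (?o j) + 2 * sec_curv N g p (\<iota> (?o i)) (\<iota> (?o j)))"
    by (simp add: sum_planes_def sum.distrib sum_subtractf sum_distrib_left)
  also have "\<dots> = (\<Sum>i\<in>{1..?n}. \<Sum>j\<in>{i<..?n}. c / 4 + ?P s ?o i j / 2 + ?P s' ?o i j / 2)"
  proof (intro sum.cong refl chen_integrand)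
    fix i j assume "i \<in> {1..?n}" "j \<in> {i<..?n}"
    then show "orthonormal_pair (gM p) (?o i) (?o j)"
      using o by (auto simp: orthonormal_pair_def orthonormal_basis_def)
  qed
  also have "\<dots> = c / 4 * (real ?n * (real ?n - 1) / 2) + (\<Sum>i\<in>{1..?n}. \<Sum>j\<in>{i<..?n}. ?P s ?o i j) / 2 +
      (\<Sum>i\<in>{1..?n}. \<Sum>j\<in>{i<..?n}. ?P s' ?o i j) / 2"
    unfolding sum.distrib sum_pairs_const by (simp only: sum_divide_distrib)
  finally show ?thesis
    unfolding sum_pairs_independent[OF bilinear_second_ff[OF connN(1)] second_ff_sym[OF connN(1,2)] o e]
      sum_pairs_independent[OF bilinear_second_ff[OF connN(3)] second_ff_sym[OF connN(3,4)] o e] .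
qed

lemma mean_curv_trace:
  assumes e: "orthonormal_basis (gM p) e" and D: "affine_connection N D0"
  shows "mean_curv M N g D0 p = (1 / real DIM('f)) *\<^sub>R (\<Sum>i\<in>{1..DIM('f)}. second_ff M N g D0 p (e i) (e i))"
  unfolding mean_curv_def
  using trace_independent[OF ip_M bilinear_second_ff[OF D] orthonormal_basis_onb[OF ip_M] e] by simp

context
  fixes u v
  assumes n: "4 \<le> DIM('f)" and uv: "orthonormal_pair (gM p) u v" and eq: "chen_equality c M N g D D' p u v"
begin

lemma chen_shape:
  obtains e where "orthonormal_basis (gM p) e"
    "\<And>i j. 1 \<le> i \<Longrightarrow> i < j \<Longrightarrow> j \<le> DIM('f) \<Longrightarrow> 3 \<le> j \<Longrightarrow> s (e i) (e j) = 0"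
    "\<And>i j. 1 \<le> i \<Longrightarrow> i < j \<Longrightarrow> j \<le> DIM('f) \<Longrightarrow> 3 \<le> j \<Longrightarrow> s' (e i) (e j) = 0"
    "\<And>i. 3 \<le> i \<Longrightarrow> i \<le> DIM('f) \<Longrightarrow> s (e i) (e i) = (1 / (real DIM('f) - 1)) *\<^sub>R (\<Sum>i\<in>{1..DIM('f)}. s (e i) (e i))"
    "\<And>i. 3 \<le> i \<Longrightarrow> i \<le> DIM('f) \<Longrightarrow> s' (e i) (e i) = (1 / (real DIM('f) - 1)) *\<^sub>R (\<Sum>i\<in>{1..DIM('f)}. s' (e i) (e i))"
proof -
  let ?n = "DIM('f)"
  have "orthonormal_upto (gM p) (\<lambda>i. if i = 1 then u else v) 2"
  proof -
    have "{1..2} = {1, 2::nat}" by auto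
    with uv inner_product_sym[OF ip_M, of v u] show ?thesis
      by (auto simp: orthonormal_upto_def orthonormal_pair_def)
  qed
  then obtain e where e: "orthonormal_basis (gM p) e" and e': "\<forall>i\<in>{1..2}. e i = (if i = 1 then u else v)"
    using orthonormal_basis_extends[OF ip_M, of _ 2] n by fastforce
  have e12: "e 1 = u" "e 2 = v" using e' by auto
  define t where "t = (\<Sum>i\<in>{1..?n}. s (e i) (e i))"
  define t' where "t' = (\<Sum>i\<in>{1..?n}. s' (e i) (e i))"
  let ?P = "\<lambda>s i j. g p (s (e i) (e j)) (s (e i) (e j)) - g p (s (e i) (e i)) (s (e j) (e j))"
  define Q where "Q a = (\<Sum>i\<in>{1..?n}. \<Sum>j\<in>{i<..?n}. g p (a i j) (a i j) - g p (a i i) (a j j)) -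
      (g p (a 1 2) (a 1 2) - g p (a 1 1) (a 2 2)) +
      (real ?n - 2) / (2 * (real ?n - 1)) * g p (\<Sum>i\<in>{1..?n}. a i i) (\<Sum>i\<in>{1..?n}. a i i)" for a :: "nat \<Rightarrow> nat \<Rightarrow> 'e"
  let ?a = "\<lambda>i j. s (e i) (e j)" and ?a' = "\<lambda>i j. s' (e i) (e j)"
  have n2: "2 < ?n" and n0: "real ?n \<noteq> 0" "real ?n - 1 \<noteq> 0" using n by auto
  have H: "mean_curv M N g D p = (1 / real ?n) *\<^sub>R t" "mean_curv M N g D' p = (1 / real ?n) *\<^sub>R t'"
    unfolding t_def t'_def using mean_curv_trace[OF e] connN by auto
  \<comment> \<open>The factor \<open>(real DIM('f))\<^sup>2\<close> converts the squared lengths of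
    the mean curvature vectors into those of the traces \<open>t\<close> and
    \<open>t'\<close>.\<close>
  have HH: "(real ?n)\<^sup>2 * (real ?n - 2) / (4 * (real ?n - 1)) *
      (g p ((1 / real ?n) *\<^sub>R t) ((1 / real ?n) *\<^sub>R t) + g p ((1 / real ?n) *\<^sub>R t') ((1 / real ?n) *\<^sub>R t')) =
    (real ?n - 2) / (2 * (real ?n - 1)) * g p t t / 2 + (real ?n - 2) / (2 * (real ?n - 1)) * g p t' t' / 2"
  proof -
    have "x\<^sup>2 * k / (4 * y) * ((1 / x) * ((1 / x) * a) + (1 / x) * ((1 / x) * b)) = k / (2 * y) * a / 2 + k / (2 * y) * b / 2"
      if "x \<noteq> 0" for x y k a b :: real
    proof -
      have "x\<^sup>2 * ((1 / x) * ((1 / x) * a) + (1 / x) * ((1 / x) * b)) = a + b"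
        using that by (simp add: power2_eq_square field_simps)
      then have "x\<^sup>2 * k / (4 * y) * ((1 / x) * ((1 / x) * a) + (1 / x) * ((1 / x) * b)) = k / (4 * y) * (a + b)"
        by (metis (no_types, lifting) mult.commute mult.left_commute times_divide_eq_right)
      then show ?thesis by (simp add: distrib_left add_divide_distrib)
    qed
    from this[OF n0(1)] show ?thesis unfolding bilinear_lmul[OF bil_N] bilinear_rmul[OF bil_N] real_scaleR_def .
  qed
  \<comment> \<open>The constant is \<open>c / 4\<close> times the number of coordinate planes other
    than the distinguished one.\<close>
  have cc: "c / 8 * (real ?n - 2) * (real ?n + 1) = c / 4 * (real ?n * (real ?n - 1) / 2) - c / 4"
    by (simp add: field_simps)
  \<comment> \<open>Each \<open>Q\<close> is the defect contributed by one second fundamental form;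
    equality in Chen's inequality makes the two nonnegative defects sum to zero.\<close>
  have "Q ?a / 2 + Q ?a' / 2 = 0"
    using eq[unfolded chen_equality_def Let_def H HH cc] sum_planes_integrand[OF e] chen_integrand[OF uv]
    unfolding Q_def t_def[symmetric] t'_def[symmetric] e12 by argo
  moreover note shape = chen_equality_shape[OF ip_N n2, folded Q_def]
  moreover have "0 \<le> Q ?a" "0 \<le> Q ?a'" by (rule shape(1))+
  ultimately have Q: "Q ?a \<le> 0" "Q ?a' \<le> 0" by linarith+
  show thesis
    by (rule that[OF e]) (use shape(2)[OF Q(1)] shape(2)[OF Q(2)] shape(3)[OF Q(1)] shape(3)[OF Q(2)] in blast)+
qed

lemma mean_curv_vanishes:
  assumes kaehler: "\<And>V X Y \<alpha> q. openin (mtop N) V \<Longrightarrow> V \<subseteq> U \<Longrightarrow> smooth_vf N V X \<Longrightarrow> smooth_vf N V Y \<Longrightarrow> q \<in> V \<Longrightarrow>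
      D X (\<lambda>r. J \<alpha> r (Y r)) q - J \<alpha> q (D X Y q) =
        \<omega> (\<alpha> + 2) q (X q) *\<^sub>R J (\<alpha> + 1) q (Y q) - \<omega> (\<alpha> + 1) q (X q) *\<^sub>R J (\<alpha> + 2) q (Y q)"
  shows "mean_curv M N g D p = 0" "mean_curv M N g D' p = 0"
proof -
  obtain e where e: "orthonormal_basis (gM p) e"
    and off: "\<And>i j. 1 \<le> i \<Longrightarrow> i < j \<Longrightarrow> j \<le> DIM('f) \<Longrightarrow> 3 \<le> j \<Longrightarrow> s (e i) (e j) = 0"
      "\<And>i j. 1 \<le> i \<Longrightarrow> i < j \<Longrightarrow> j \<le> DIM('f) \<Longrightarrow> 3 \<le> j \<Longrightarrow> s' (e i) (e j) = 0"
    and diag: "\<And>i. 3 \<le> i \<Longrightarrow> i \<le> DIM('f) \<Longrightarrow> s (e i) (e i) = (1 / (real DIM('f) - 1)) *\<^sub>R (\<Sum>i\<in>{1..DIM('f)}. s (e i) (e i))"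
      "\<And>i. 3 \<le> i \<Longrightarrow> i \<le> DIM('f) \<Longrightarrow> s' (e i) (e i) = (1 / (real DIM('f) - 1)) *\<^sub>R (\<Sum>i\<in>{1..DIM('f)}. s' (e i) (e i))"
    using chen_shape by blast
  define t where "t = (\<Sum>i\<in>{1..DIM('f)}. s (e i) (e i))"
  define t' where "t' = (\<Sum>i\<in>{1..DIM('f)}. s' (e i) (e i))"
  have dual: "g p (s' x y) (J \<alpha> p (\<iota> z)) = - g p (\<iota> y) (J \<alpha> p (s x z))" for x y z \<alpha>
    by (rule second_ff_J[OF connN(1,3,5) kaehler])
  note sym = second_ff_sym[OF connN(1,2)] and sym' = second_ff_sym[OF connN(3,4)]
  \<comment> \<open>The form is symmetric in \<open>x\<close> and \<open>y\<close> because
    \<open>s'\<close> is, and by \<open>dual\<close> symmetric in \<open>x\<close> and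
    \<open>z\<close> because \<open>s\<close> is. These two transpositions generate the
    third.\<close>
  have cubic': "g p (s' x y) (J \<alpha> p (\<iota> z)) = g p (s' x z) (J \<alpha> p (\<iota> y))" for x y z \<alpha>
    using dual[of x y \<alpha> z] dual[of z y \<alpha> x] dual[of y z \<alpha> x] dual[of x z \<alpha> y] sym[of x z] sym[of x y] sym'[of y z]
    by simp
  have cubic: "g p (J \<alpha> p (s x y)) (\<iota> z) = g p (J \<alpha> p (s x z)) (\<iota> y)" for x y z \<alpha>
    using dual[of x z \<alpha> y] dual[of x y \<alpha> z] cubic'[of x y \<alpha> z]
    by (simp add: inner_product_sym[OF ip_N, of "J \<alpha> p (s x y)" "\<iota> z"]
        inner_product_sym[OF ip_N, of "J \<alpha> p (s x z)" "\<iota> y"])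
  have bJ: "bilinear (\<lambda>w z. g p (J \<alpha> p w) (\<iota> z))" and bJ': "bilinear (\<lambda>w z. g p w (J \<alpha> p (\<iota> z)))" for \<alpha>
    unfolding bilinear_def
    by (auto intro!: linearI simp: linear_add[OF linear_J] linear_cmul[OF linear_J] linear_add[OF linear_incl]
        linear_cmul[OF linear_incl] bilinear_ladd[OF bil_N] bilinear_radd[OF bil_N] bilinear_lmul[OF bil_N] bilinear_rmul[OF bil_N])
  have normal: "g p t (\<iota> z) = 0" "g p t' (\<iota> z) = 0" for z
  proof -
    have l: "linear (\<lambda>x. g p x (\<iota> z))" using bil_N by (simp add: bilinear_def)
    show "g p t (\<iota> z) = 0" "g p t' (\<iota> z) = 0"
      by (simp_all add: t_def t'_def linear_sum[OF l] second_ff_normal)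
  qed
  \<comment> \<open>For \<open>s\<close> the totally symmetric form has \<open>J\<close> applied to
    the normal argument, below for \<open>s'\<close> to the tangent one; the two criteria for a
    vanishing normal vector match these pairings.\<close>
  have "g p (J \<alpha> p t) (\<iota> z) = 0" for \<alpha> z
    by (rule trace_vanishes[OF ip_M e refl n bJ cubic sym off(1) diag(1)[folded t_def]])
  from normal_eq_0_if_J_normal[OF normal(1) this] have "t = 0" .
  moreover have "g p t' (J \<alpha> p (\<iota> z)) = 0" for \<alpha> z
    by (rule trace_vanishes[OF ip_M e refl n bJ' cubic' sym' off(2) diag(2)[folded t'_def]])
  from normal_eq_0_if_metric_J[OF normal(2) this] have "t' = 0" .
  ultimately show "mean_curv M N g D p = 0" "mean_curv M N g D' p = 0"
    using mean_curv_trace[OF e connN(1)] mean_curv_trace[OF e connN(3)] by (simp_all add: t_def t'_def)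
qed

end

end

end

theorem theorem3p3:
  fixes N :: "('a, 'e::euclidean_space) manifold"
    and M :: "('a, 'f::euclidean_space) manifold"
    and g :: "('a, 'e) metric"
    and D D' :: "('a, 'e) connection"
    and \<Lambda> :: "'a \<Rightarrow> ('e \<Rightarrow> 'e) set"
    and c :: real
    and m n :: nat
  assumes "statistical_manifold N g D D'"
    and "quaternionic_kaehler_like N D \<Lambda>"
    and "quaternionic_space_form_like c N g D D' \<Lambda>"
    and "DIM('e) = 4 * m"
    and "statistical_submanifold M N g D D'"
    and "DIM('f) = n"
    and "lagrangian M N g \<Lambda>"
    and "n \<ge> 4"
    and "\<forall>p\<in>points M. \<exists>u v.
           orthonormal_pair (induced_metric M N g p) u v \<and> chen_equality c M N g D D' p u v"
  shows "\<forall>p\<in>points M. mean_curv M N g D p = 0 \<and> mean_curv M N g D' p = 0"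
proof
  fix p assume p: "p \<in> points M"
  note st = assms(1)
  have sub: "submanifold M N"
    and stM: "statistical_manifold M (induced_metric M N g) (induced_conn M N g D) (induced_conn M N g D')"
    using assms(5) by (auto simp: statistical_submanifold_def)
  have pN: "p \<in> points N" using sub p by (auto simp: submanifold_def)
  \<comment> \<open>The frame has to be one that comes with its 1-forms. The curvature formulas and
    the totally real condition hold in every frame, hence also in this one.\<close>
  obtain U J \<omega> where UJ: "p \<in> U" "quaternionic_frame N \<Lambda> U J"
    and kaehler: "\<forall>V X Y \<alpha>. openin (mtop N) V \<and> V \<subseteq> U \<and> smooth_vf N V X \<and> smooth_vf N V Y \<longrightarrow>
           (\<forall>q\<in>V. D X (\<lambda>r. J \<alpha> r (Y r)) q - J \<alpha> q (D X Y q) =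
                    \<omega> (\<alpha> + 2) q (X q) *\<^sub>R J (\<alpha> + 1) q (Y q) -
                    \<omega> (\<alpha> + 1) q (X q) *\<^sub>R J (\<alpha> + 2) q (Y q))"
    using assms(2) pN unfolding quaternionic_kaehler_like_def by blast
  interpret lagrangian_point M N g p \<Lambda> U J
    by unfold_locales (use sub p UJ assms(7) st stM in \<open>auto simp: statistical_manifold_def\<close>)
  obtain u v where uv: "orthonormal_pair (induced_metric M N g p) u v" "chen_equality c M N g D D' p u v"
    using assms(9) p by blast
  show "mean_curv M N g D p = 0 \<and> mean_curv M N g D' p = 0"
    using mean_curv_vanishes[OF st stM assms(3) _ uv, of \<omega>] kaehler assms(6,8) by blast
qed

end
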